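(* Let $p\in(0,1)$, and let $\mathbb E\mu^p$ be the permuton defined by $(\mathbb E\mu^p)(A)=\mathbb E[\mu^p(A)]$ for every Borel set $A\subset[0,1]^2$. Then $\mathbb E\mu^p$ is the measure $\alpha(x,y)\,dx\,dy$ on $[0,1]^2$, where $$\alpha(x,y)=\int_{\max(0,x+y-1)}^{\min(x,y)}\frac{3p^2(1-p)^2\,da}{2\pi\,\bigl(a(x-a)(1-x-y+a)(y-a)\bigr)^{3/2}\left(\frac{p^2}{a}+\frac{(1-p)^2}{x-a}+\frac{p^2}{1-x-y+a}+\frac{(1-p)^2}{y-a}\right)^{5/2}}.$$
   Context: A permuton is a probability measure on $[0,1]^2$ with both marginals uniform on $[0,1]$. For distinct reals $x_1,\dots,x_k$, $\mathrm{rank}(x_1,\dots,x_k)$ is the permutation $\alpha$ of $\{1,\dots,k\}$ with $\alpha(i)<\alpha(j)\iff x_i<x_j$. For a random permuton $\mu$, $\mathrm{subperm}_k(\mu)=\mathrm{rank}(Y_1,\dots,Y_k)\circ \mathrm{rank}(X_1,\dots,X_k)^{-1}$, where conditionally on $\mu$ the $(X_i,Y_i)$, $1\le i\le k$, are independent with law $\mu$. The law of a random permuton is determined by the laws of $\mathrm{subperm}_k(\mu)$, $k\ge1$. For a rooted plane tree $t$ with leaves labeled $1,\dots,k$ in left-to-right order and internal nodes decorated with signs in $\{\oplus,\ominus\}$, let $\tilde t$ be obtained by reversing the order of the children of every node with sign $\ominus$; $\mathrm{perm}(t)$ is the permutation $\sigma$ with $\sigma(i)$ the position in $\tilde t$ of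 leaf $i$. The biased Brownian separable permuton $\mu^p$ is the random permuton whose law is determined by $\mathrm{subperm}_k(\mu^p)\stackrel d=\mathrm{perm}(t_{k,p})$ for all $k\ge1$, where $t_{k,p}$ is a uniform rooted plane binary tree with $k$ leaves whose internal nodes carry i.i.d. signs, $\oplus$ with probability $p$ and $\ominus$ with probability $1-p$. *)

theory Defs
  imports "HOL-Probability.Probability" "HOL-Combinatorics.Permutations"
begin

section \<open>Permutons\<close>

text \<open>A permuton is kept as a Borel measure on the whole plane; its uniform marginals
  force it to be carried by the unit square.\<close>

definition permuton :: "(real \<times> real) measure \<Rightarrow> bool" where
  "permuton \<mu> \<longleftrightarrow> prob_space \<mu> \<and> sets \<mu> = sets borel \<and>
     distr \<mu> borel fst = uniform_measure lborel {0..1} \<and>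
     distr \<mu> borel snd = uniform_measure lborel {0..1}"

lemma permuton_unit_square:
  assumes "permuton \<mu>"
  shows "emeasure \<mu> ({0..1} \<times> {0..1}) = 1"
proof -
  interpret prob_space \<mu> using assms by (simp add: permuton_def)
  have sets: "sets \<mu> = sets (borel \<Otimes>\<^sub>M borel)"
    using assms unfolding permuton_def borel_prod by blast
  have mfst: "fst \<in> \<mu> \<rightarrow>\<^sub>M borel" and msnd: "snd \<in> \<mu> \<rightarrow>\<^sub>M borel"
    unfolding measurable_cong_sets[OF sets refl] by (rule measurable_fst measurable_snd)+
  have fst: "AE z in \<mu>. fst z \<in> {0..1}"
  proof -
    have "AE x in distr \<mu> borel fst. x \<in> {0..1::real}"
      using assms AE_uniform_measureI[of "{0..1::real}" lborel "\<lambda>x. x \<in> {0..1}"]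
      unfolding permuton_def by (metis (no_types, lifting) AE_I2 atLeastAtMost_borel sets_lborel)
    thus ?thesis
      using mfst by (subst (asm) AE_distr_iff) auto
  qed
  have snd: "AE z in \<mu>. snd z \<in> {0..1}"
  proof -
    have "AE x in distr \<mu> borel snd. x \<in> {0..1::real}"
      using assms AE_uniform_measureI[of "{0..1::real}" lborel "\<lambda>x. x \<in> {0..1}"]
      unfolding permuton_def by (metis (no_types, lifting) AE_I2 atLeastAtMost_borel sets_lborel)
    thus ?thesis
      using msnd by (subst (asm) AE_distr_iff) auto
  qed
  have m: "{0..1} \<times> {0..1::real} \<in> sets \<mu>"
    using assms by (simp add: permuton_def borel_closed closed_Times)
  have "AE z in \<mu>. z \<in> {0..1} \<times> {0..1}"
    using fst snd by eventually_elim (auto simp: mem_Times_iff)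
  thus ?thesis using m by (intro emeasure_eq_1_AE)
qed

text \<open>The \<open>\<sigma>\<close>-algebra of \<open>prob_algebra borel\<close>, generated by the evaluations
  \<open>\<mu> \<mapsto> \<mu> A\<close>, is the Borel \<open>\<sigma>\<close>-algebra of weak convergence.\<close>

definition random_permuton :: "'w measure \<Rightarrow> ('w \<Rightarrow> (real \<times> real) measure) \<Rightarrow> bool" where
  "random_permuton M \<mu> \<longleftrightarrow> prob_space M \<and> \<mu> \<in> M \<rightarrow>\<^sub>M prob_algebra borel \<and>
     (\<forall>\<omega>\<in>space M. permuton (\<mu> \<omega>))"

definition expected_permuton ::
    "'w measure \<Rightarrow> ('w \<Rightarrow> (real \<times> real) measure) \<Rightarrow> (real \<times> real) measure" where
  "expected_permuton M \<mu> =
     measure_of UNIV (sets borel) (\<lambda>A. \<integral>\<^sup>+\<omega>. emeasure (\<mu> \<omega>) A \<partial>M)"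

lemma sets_expected_permuton [simp]: "sets (expected_permuton M \<mu>) = sets borel"
  unfolding expected_permuton_def using sets.sigma_sets_eq[of "borel :: (real \<times> real) measure"] by simp

lemma emeasure_expected_permuton:
  assumes "random_permuton M \<mu>" and "A \<in> sets borel"
  shows "emeasure (expected_permuton M \<mu>) A = (\<integral>\<^sup>+\<omega>. emeasure (\<mu> \<omega>) A \<partial>M)"
proof -
  have \<mu>: "\<mu> \<in> M \<rightarrow>\<^sub>M prob_algebra borel" and M: "prob_space M"
    using assms(1) by (auto simp: random_permuton_def)
  have Mspace: "M \<in> space (prob_algebra M)" using M by (simp add: space_prob_algebra)
  have eq: "emeasure (M \<bind> \<mu>) B = (\<integral>\<^sup>+\<omega>. emeasure (\<mu> \<omega>) B \<partial>M)" if "B \<in> sets borel" for B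
    using emeasure_bind_prob_algebra[OF Mspace \<mu> that] .
  have s: "sets (M \<bind> \<mu>) = sets borel" using sets_bind'[OF Mspace \<mu>] .
  have "expected_permuton M \<mu> = measure_of UNIV (sets borel) (emeasure (M \<bind> \<mu>))"
    unfolding expected_permuton_def
    using eq sets.sigma_sets_eq[of "borel :: (real \<times> real) measure"]
    by (intro measure_of_eq) auto
  also have "\<dots> = M \<bind> \<mu>"
    using measure_of_of_measure[of "M \<bind> \<mu>"] s sets_eq_imp_space_eq[OF s] by simp
  finally show ?thesis using eq assms(2) by simp
qed


section \<open>Permutations sampled from a random permuton\<close>

text \<open>A permutation of \<open>{1..k}\<close> is a function on the naturals fixing everything
  outside \<open>{1..k}\<close>.\<close>

definition rank :: "nat \<Rightarrow> (nat \<Rightarrow> real) \<Rightarrow> nat \<Rightarrow> nat" where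
  "rank k x = (THE \<alpha>. \<alpha> permutes {1..k} \<and>
     (\<forall>i\<in>{1..k}. \<forall>j\<in>{1..k}. \<alpha> i < \<alpha> j \<longleftrightarrow> x i < x j))"

lemma rank_unique:
  fixes \<alpha> \<beta> :: "nat \<Rightarrow> nat" and x :: "nat \<Rightarrow> real"
  assumes a: "\<alpha> permutes {1..k}" and b: "\<beta> permutes {1..k}"
    and oa: "\<forall>i\<in>{1..k}. \<forall>j\<in>{1..k}. \<alpha> i < \<alpha> j \<longleftrightarrow> x i < x j"
    and ob: "\<forall>i\<in>{1..k}. \<forall>j\<in>{1..k}. \<beta> i < \<beta> j \<longleftrightarrow> x i < x j"
  shows "\<alpha> = \<beta>"
proof -
  have card: "\<gamma> i = Suc (card {j\<in>{1..k}. x j < x i})"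
    if g: "\<gamma> permutes {1..k}"
      and o: "\<forall>i\<in>{1..k}. \<forall>j\<in>{1..k}. \<gamma> i < \<gamma> j \<longleftrightarrow> x i < x j"
      and i: "i \<in> {1..k}" for \<gamma> :: "nat \<Rightarrow> nat" and i
  proof -
    have gi: "\<gamma> i \<in> {1..k}" using permutes_in_image[OF g] i by blast
    have "\<gamma> ` {j\<in>{1..k}. x j < x i} = {m\<in>{1..k}. m < \<gamma> i}"
    proof (intro set_eqI iffI)
      fix m assume "m \<in> \<gamma> ` {j\<in>{1..k}. x j < x i}"
      then show "m \<in> {m\<in>{1..k}. m < \<gamma> i}" using permutes_in_image[OF g] o i by blast
    next
      fix m assume m: "m \<in> {m\<in>{1..k}. m < \<gamma> i}"
      then obtain j where "j \<in> {1..k}" "m = \<gamma> j"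
        using permutes_image[OF g] by (metis (no_types, lifting) imageE mem_Collect_eq)
      then show "m \<in> \<gamma> ` {j\<in>{1..k}. x j < x i}" using o i m by blast
    qed
    also have "\<dots> = {1..<\<gamma> i}" using gi by auto
    finally have "card (\<gamma> ` {j\<in>{1..k}. x j < x i}) = \<gamma> i - 1" by simp
    moreover have "inj_on \<gamma> {j\<in>{1..k}. x j < x i}"
      using permutes_inj_on[OF g] .
    ultimately show ?thesis using gi by (simp add: card_image)
  qed
  show ?thesis
  proof
    fix i show "\<alpha> i = \<beta> i"
      using card[OF a oa] card[OF b ob] permutes_not_in[OF a] permutes_not_in[OF b]
      by (cases "i \<in> {1..k}") auto
  qed
qed

lemma rank_spec:
  fixes x :: "nat \<Rightarrow> real"
  assumes inj: "inj_on x {1..k}"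
  shows "rank k x permutes {1..k}"
    and "\<forall>i\<in>{1..k}. \<forall>j\<in>{1..k}. rank k x i < rank k x j \<longleftrightarrow> x i < x j"
proof -
  define f where "f i = (if i \<in> {1..k} then card {j\<in>{1..k}. x j \<le> x i} else i)" for i
  have less: "f i < f j" if "i \<in> {1..k}" "j \<in> {1..k}" "x i < x j" for i j
  proof -
    have "{l\<in>{1..k}. x l \<le> x i} \<subset> {l\<in>{1..k}. x l \<le> x j}"
    proof (rule psubsetI)
      show "{l\<in>{1..k}. x l \<le> x i} \<subseteq> {l\<in>{1..k}. x l \<le> x j}" using that by auto
      have "j \<in> {l\<in>{1..k}. x l \<le> x j}" "j \<notin> {l\<in>{1..k}. x l \<le> x i}" using that by auto
      then show "{l\<in>{1..k}. x l \<le> x i} \<noteq> {l\<in>{1..k}. x l \<le> x j}" by blast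
    qed
    then show ?thesis using that by (simp add: f_def psubset_card_mono)
  qed
  have iff: "\<forall>i\<in>{1..k}. \<forall>j\<in>{1..k}. f i < f j \<longleftrightarrow> x i < x j"
  proof (intro ballI)
    fix i j assume ij: "i \<in> {1..k}" "j \<in> {1..k}"
    show "f i < f j \<longleftrightarrow> x i < x j"
      using less[OF ij] less[OF ij(2,1)] inj_onD[OF inj _ ij]
      by (cases "x i" "x j" rule: linorder_cases) auto
  qed
  have "inj_on f {1..k}"
  proof (rule inj_onI)
    fix i j assume ij: "i \<in> {1..k}" "j \<in> {1..k}" "f i = f j"
    then have "x i = x j" using iff by (metis less_irrefl linorder_neqE)
    then show "i = j" using inj_onD[OF inj] ij by blast
  qed
  moreover have "f ` {1..k} \<subseteq> {1..k}"
  proof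
    fix m assume "m \<in> f ` {1..k}"
    then obtain i where i: "i \<in> {1..k}" "m = card {j\<in>{1..k}. x j \<le> x i}"
      by (auto simp: f_def)
    have "m \<le> card {1..k}" unfolding i(2) by (intro card_mono) auto
    moreover have "0 < m" unfolding i(2) card_gt_0_iff using i(1) by auto
    ultimately show "m \<in> {1..k}" by simp
  qed
  ultimately have "bij_betw f {1..k} {1..k}"
    using endo_inj_surj[of "{1..k}" f] by (simp only: bij_betw_def finite_atLeastAtMost simp_thms)
  then have "f permutes {1..k}"
    by (rule bij_imp_permutes) (simp only: f_def if_False)
  then have f: "f permutes {1..k} \<and> (\<forall>i\<in>{1..k}. \<forall>j\<in>{1..k}. f i < f j \<longleftrightarrow> x i < x j)"
    using iff by blast
  have "rank k x = f"
    unfolding rank_def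
  proof (rule the_equality[where P = "\<lambda>\<alpha>. \<alpha> permutes {1..k} \<and>
      (\<forall>i\<in>{1..k}. \<forall>j\<in>{1..k}. \<alpha> i < \<alpha> j \<longleftrightarrow> x i < x j)", OF f])
    fix \<alpha> assume "\<alpha> permutes {1..k} \<and> (\<forall>i\<in>{1..k}. \<forall>j\<in>{1..k}. \<alpha> i < \<alpha> j \<longleftrightarrow> x i < x j)"
    then show "\<alpha> = f"
      using rank_unique[OF _ conjunct1[OF f] _ conjunct2[OF f]] by (elim conjE)
  qed
  with f show "rank k x permutes {1..k}"
    and "\<forall>i\<in>{1..k}. \<forall>j\<in>{1..k}. rank k x i < rank k x j \<longleftrightarrow> x i < x j" by auto
qed

definition subperm :: "nat \<Rightarrow> (nat \<Rightarrow> real \<times> real) \<Rightarrow> nat \<Rightarrow> nat" where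
  "subperm k z = rank k (\<lambda>i. snd (z i)) \<circ> inv (rank k (\<lambda>i. fst (z i)))"

text \<open>Ties among the coordinates, for which \<open>rank\<close> is unspecified, have probability
  zero because the marginals are atomless.\<close>

definition subperm_law ::
    "'w measure \<Rightarrow> ('w \<Rightarrow> (real \<times> real) measure) \<Rightarrow> nat \<Rightarrow> (nat \<Rightarrow> nat) measure" where
  "subperm_law M \<mu> k =
     distr (M \<bind> (\<lambda>\<omega>. \<Pi>\<^sub>M i\<in>{1..k}. \<mu> \<omega>)) (count_space UNIV) (subperm k)"

lemma measurable_iid_sample:
  assumes "random_permuton M \<mu>"
  shows "(\<lambda>\<omega>. \<Pi>\<^sub>M i\<in>{1..k::nat}. \<mu> \<omega>) \<in> M \<rightarrow>\<^sub>M prob_algebra (\<Pi>\<^sub>M i\<in>{1..k}. borel)"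
proof (rule measurable_prob_algebra_generated)
  have \<mu>: "\<mu> \<in> M \<rightarrow>\<^sub>M prob_algebra borel"
    using assms by (simp add: random_permuton_def)
  have \<mu>': "prob_space (\<mu> \<omega>)" "sets (\<mu> \<omega>) = sets borel" if "\<omega> \<in> space M" for \<omega>
    using measurable_space[OF \<mu> that] by (auto simp: space_prob_algebra)
  let ?G = "prod_algebra {1..k} (\<lambda>i. borel :: (real \<times> real) measure)"
  show "sets (\<Pi>\<^sub>M i\<in>{1..k}. borel :: (real \<times> real) measure) =
      sigma_sets (\<Pi>\<^sub>E i\<in>{1..k}. space borel) ?G"
    by (rule sets_PiM)
  show "Int_stable ?G" by (rule Int_stable_prod_algebra)
  show "?G \<subseteq> Pow (\<Pi>\<^sub>E i\<in>{1..k}. space borel)" by (rule prod_algebra_sets_into_space)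
  show "prob_space (\<Pi>\<^sub>M i\<in>{1..k}. \<mu> \<omega>)" if "\<omega> \<in> space M" for \<omega>
    using \<mu>'(1)[OF that] by (intro prob_space_PiM)
  show "sets (\<Pi>\<^sub>M i\<in>{1..k}. \<mu> \<omega>) = sets (\<Pi>\<^sub>M i\<in>{1..k}. borel)" if "\<omega> \<in> space M" for \<omega>
    using \<mu>'(2)[OF that] by (intro sets_PiM_cong) auto
  fix A assume "A \<in> ?G"
  then obtain E where E: "A = (\<Pi>\<^sub>E i\<in>{1..k}. E i)" "\<And>i. i \<in> {1..k} \<Longrightarrow> E i \<in> sets borel"
    unfolding prod_algebra_eq_finite[OF finite_atLeastAtMost] by blast
  have "emeasure (\<Pi>\<^sub>M i\<in>{1..k}. \<mu> \<omega>) A = (\<Prod>i\<in>{1..k}. emeasure (\<mu> \<omega>) (E i))"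
    if w: "\<omega> \<in> space M" for \<omega>
  proof -
    interpret prob_space "\<mu> \<omega>" using \<mu>'(1)[OF w] .
    interpret finite_product_sigma_finite "\<lambda>_. \<mu> \<omega>" "{1..k}"
      by unfold_locales auto
    show ?thesis unfolding E(1) using E(2) \<mu>'(2)[OF w] by (intro measure_times) auto
  qed
  moreover have "(\<lambda>\<omega>. \<Prod>i\<in>{1..k}. emeasure (\<mu> \<omega>) (E i)) \<in> borel_measurable M"
    using E(2) measurable_compose[OF measurable_prob_algebraD[OF \<mu>]
      measurable_emeasure_subprob_algebra]
    by (intro borel_measurable_prod_ennreal) auto
  ultimately show "(\<lambda>\<omega>. emeasure (\<Pi>\<^sub>M i\<in>{1..k}. \<mu> \<omega>) A) \<in> borel_measurable M"
    using measurable_cong by (metis (no_types, lifting))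
qed


section \<open>Signed plane trees and separable permutations\<close>

datatype sign = Plus | Minus

datatype 's ptree = Leaf nat | Node 's "'s ptree list"

primrec leaves :: "'s ptree \<Rightarrow> nat list" where
  "leaves (Leaf l) = [l]"
| "leaves (Node s ts) = concat (map leaves ts)"

primrec binary :: "'s ptree \<Rightarrow> bool" where
  "binary (Leaf l) \<longleftrightarrow> True"
| "binary (Node s ts) \<longleftrightarrow> length ts = 2 \<and> list_all binary ts"

primrec reverse_minus :: "sign ptree \<Rightarrow> sign ptree" where
  "reverse_minus (Leaf l) = Leaf l"
| "reverse_minus (Node s ts) =
     Node s ((case s of Plus \<Rightarrow> \<lambda>us. us | Minus \<Rightarrow> rev) (map reverse_minus ts))"

text \<open>Intended for trees with \<open>leaves t = [1..<Suc k]\<close>, i.e. labelled \<open>1, \<dots>, k\<close> from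
  left to right. Positions are counted from 1.\<close>

definition perm :: "sign ptree \<Rightarrow> nat \<Rightarrow> nat" where
  "perm t i = (if i \<in> set (leaves t)
     then Suc (length (takeWhile (\<lambda>l. l \<noteq> i) (leaves (reverse_minus t)))) else i)"

definition plane_binary_trees :: "nat \<Rightarrow> unit ptree set" where
  "plane_binary_trees k = {t. binary t \<and> leaves t = [1..<Suc k]}"

lemma finite_binary_leaves: "finite {t :: unit ptree. binary t \<and> leaves t = ls}"
proof (induction "length ls" arbitrary: ls rule: less_induct)
  case less
  have pos: "leaves t \<noteq> []" if "binary t" for t :: "unit ptree"
    using that by (induction t) (auto simp: length_Suc_conv numeral_2_eq_2)
  let ?T = "\<lambda>ls. {t :: unit ptree. binary t \<and> leaves t = ls}"
  let ?S = "{n. 0 < n \<and> n < length ls}"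
  have "?T ls \<subseteq> Leaf ` set ls \<union>
      (\<Union>n\<in>?S. (\<lambda>(l, r). Node () [l, r]) ` (?T (take n ls) \<times> ?T (drop n ls)))"
  proof
    fix t :: "unit ptree" assume t: "t \<in> ?T ls"
    show "t \<in> Leaf ` set ls \<union>
      (\<Union>n\<in>?S. (\<lambda>(l, r). Node () [l, r]) ` (?T (take n ls) \<times> ?T (drop n ls)))"
    proof (cases t)
      case (Leaf l)
      then show ?thesis using t by auto
    next
      case (Node u ts)
      then obtain l r where lr: "t = Node () [l, r]" "binary l" "binary r"
        "ls = leaves l @ leaves r"
        using t by (auto simp: length_Suc_conv numeral_2_eq_2)
      have "length (leaves l) \<in> ?S" using lr pos[of l] pos[of r] by simp
      then show ?thesis using lr
        by (intro UnI2 UN_I[of "length (leaves l)"] image_eqI[of _ _ "(l, r)"]) simp_all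
    qed
  qed
  moreover have "finite (\<Union>n\<in>?S. (\<lambda>(l, r). Node () [l, r]) ` (?T (take n ls) \<times> ?T (drop n ls)))"
    by (intro finite_UN_I finite_imageI finite_cartesian_product less) auto
  ultimately show ?case by (meson finite_Un finite_imageI finite_set finite_subset)
qed

lemma finite_plane_binary_trees: "finite (plane_binary_trees k)"
  unfolding plane_binary_trees_def by (rule finite_binary_leaves)

lemma plane_binary_trees_nonempty:
  assumes "1 \<le> k"
  shows "plane_binary_trees k \<noteq> {}"
proof -
  have "\<exists>t :: unit ptree. binary t \<and> leaves t = [1..<Suc k]"
    using assms
  proof (induction k rule: dec_induct)
    case base
    have "binary (Leaf 1 :: unit ptree) \<and> leaves (Leaf 1 :: unit ptree) = [1..<Suc 1]" by simp
    then show ?case by blast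
  next
    case (step k)
    then obtain t :: "unit ptree" where "binary t" "leaves t = [1..<Suc k]" by blast
    then have "binary (Node () [t, Leaf (Suc k)]) \<and>
        leaves (Node () [t, Leaf (Suc k)]) = [1..<Suc (Suc k)]" by simp
    then show ?case by blast
  qed
  then show ?thesis by (simp add: plane_binary_trees_def)
qed

primrec sequence_pmf :: "'a pmf list \<Rightarrow> 'a list pmf" where
  "sequence_pmf [] = return_pmf []"
| "sequence_pmf (q # qs) =
     bind_pmf q (\<lambda>x. bind_pmf (sequence_pmf qs) (\<lambda>xs. return_pmf (x # xs)))"

definition sign_pmf :: "real \<Rightarrow> sign pmf" where
  "sign_pmf p = map_pmf (\<lambda>b. if b then Plus else Minus) (bernoulli_pmf p)"

primrec iid_signs :: "real \<Rightarrow> 'a ptree \<Rightarrow> sign ptree pmf" where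
  "iid_signs p (Leaf l) = return_pmf (Leaf l)"
| "iid_signs p (Node u ts) =
     bind_pmf (sign_pmf p) (\<lambda>s.
     bind_pmf (sequence_pmf (map (iid_signs p) ts)) (\<lambda>us. return_pmf (Node s us)))"

definition signed_tree_pmf :: "nat \<Rightarrow> real \<Rightarrow> sign ptree pmf" where
  "signed_tree_pmf k p = bind_pmf (pmf_of_set (plane_binary_trees k)) (iid_signs p)"


section \<open>The biased Brownian separable permuton\<close>

definition brownian_separable_permuton ::
    "real \<Rightarrow> 'w measure \<Rightarrow> ('w \<Rightarrow> (real \<times> real) measure) \<Rightarrow> bool" where
  "brownian_separable_permuton p M \<mu> \<longleftrightarrow> random_permuton M \<mu> \<and>
     (\<forall>k\<ge>1. subperm_law M \<mu> k = measure_pmf (map_pmf perm (signed_tree_pmf k p)))"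

definition separable_density :: "real \<Rightarrow> real \<Rightarrow> real \<Rightarrow> real" where
  "separable_density p x y =
     (LBINT a:{max 0 (x + y - 1)..min x y}.
        3 * p\<^sup>2 * (1 - p)\<^sup>2 /
        (2 * pi * (a * (x - a) * (1 - x - y + a) * (y - a)) powr (3/2) *
         (p\<^sup>2 / a + (1 - p)\<^sup>2 / (x - a) + p\<^sup>2 / (1 - x - y + a) + (1 - p)\<^sup>2 / (y - a))
           powr (5/2)))"

end

theory Submission
  imports Defs "HOL-Real_Asymp.Real_Asymp"
begin

text \<open>
  Both measures live on the unit square and are compared through the moments of \<open>s X + t Y\<close>,
  \<open>s, t \<ge> 0\<close>. For a sample of \<open>k = n + 1\<close> points, the statistic
  \<open>\<Sum>\<^sub>i \<Prod>\<^sub>j\<^sub>\<noteq>\<^sub>i (s [X\<^sub>j < X\<^sub>i] + t [Y\<^sub>j < Y\<^sub>i])\<close> depends only on the sampled permutation, and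
  since the marginals are uniform its expectation is \<open>k E (s X + t Y)^n\<close>. On a signed tree
  the same statistic factors along the path from the root to the leaf \<open>i\<close>. With \<open>C\<close> the generating
  function of binary trees and \<open>q = 1 - p\<close>, summing over trees gives
  \<open>E (1 - 4 w (s X + t Y)) powr (-1/2) = 1 / (1 - p C((s + t) w) - q C(s w) - q C(t w))\<close>.

  On the density side, \<open>\<alpha>\<close> is the marginal of a density on the simplex \<open>a + b + c + d = 1\<close>,
  where \<open>x = a + c\<close> and \<open>y = a + d\<close>. That density is a mixture over \<open>r\<close> of products of one-sided
  stable densities of index 1/2, whose Laplace transforms are \<open>exp (- r p \<surd>u)\<close> and \<open>exp (- r q \<surd>u)\<close>,
  and this yields the same function of \<open>w\<close>.
\<close>

section \<open>One-sided stable densities of index 1/2\<close>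

text \<open>The exponent -1/2 is dictated by counting: n + 1 times the number of binary trees with n
  + 1 leaves is the central binomial coefficient, the n-th coefficient of (1 - 4 z) powr (-1/2).
  Multiplied by it, the n-th moment of s X + t Y becomes the n-th coefficient of the transform in w.
  The same exponent suits the simplex: the density there is homogeneous of degree -7/2 in four
  variables, so its product with a linear form to the power -1/2 has degree -4, and polar
  coordinates can be undone without a leftover power of the radius. On the tree side the
  coefficients are known one by one; on the density side only the sum is known, for small w >= 0.
  The two are matched as formal power series. Restricting to s, t >= 0 keeps all terms nonnegative,
  so sums and integrals are exchanged in \<open>ennreal\<close> without integrability. These
  directions suffice, since the functions exp (s x + t y) are closed under products and separate
  points. For r > 0, \<open>levy r\<close> is the density of the time at which a Brownian motion of
  variance 2 per unit time first hits r; this scale removes constants from the Laplace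
  transform.\<close>

definition levy :: "real \<Rightarrow> real \<Rightarrow> real" where
  "levy r x = (if 0 < x then r / (2 * sqrt pi) * x powr (-3/2) * exp (- r\<^sup>2 / (4 * x)) else 0)"

lemma levy_nonneg: "0 \<le> r \<Longrightarrow> 0 \<le> levy r x"
  by (simp add: levy_def)

lemma levy_measurable [measurable]:
  assumes [measurable]: "f \<in> borel_measurable M" "g \<in> borel_measurable M"
  shows "(\<lambda>w. levy (f w) (g w)) \<in> borel_measurable M"
  unfolding levy_def by measurable

text \<open>Up to the factor 2 / sqrt pi, the error function.\<close>

definition gauss_primitive :: "real \<Rightarrow> real" where
  "gauss_primitive z = (LBINT y=0..z. exp (- y\<^sup>2))"

lemma gauss_primitive_deriv: "(gauss_primitive has_real_derivative exp (- z\<^sup>2)) (at z)"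
proof -
  have "((\<lambda>u. LBINT y=0..u. exp (- y\<^sup>2)) has_vector_derivative exp (- z\<^sup>2))
     (at z within {min 0 z - 1..max 0 z + 1})"
    unfolding zero_ereal_def
    by (rule interval_integral_FTC2) (auto intro!: continuous_intros)
  then show ?thesis
    unfolding gauss_primitive_def has_real_derivative_iff_has_vector_derivative
    by (subst (asm) at_within_interior) auto
qed

lemma gauss_primitive_minus: "gauss_primitive (- z) = - gauss_primitive z"
proof -
  have "((\<lambda>z. gauss_primitive z + gauss_primitive (- z)) has_real_derivative 0) (at z)" for z
    by (auto intro!: derivative_eq_intros DERIV_chain2[of gauss_primitive] gauss_primitive_deriv)
  then have "gauss_primitive z + gauss_primitive (- z) = gauss_primitive 0 + gauss_primitive (- 0)"
    using DERIV_isconst_all by blast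
  then show ?thesis by (simp add: gauss_primitive_def flip: zero_ereal_def)
qed

lemma gauss_primitive_at_top: "(gauss_primitive \<longlongrightarrow> sqrt pi / 2) at_top"
proof -
  have g: "has_bochner_integral lborel (\<lambda>x::real. indicator {0..} x *\<^sub>R exp (- x\<^sup>2)) (sqrt pi / 2)"
    using gaussian_moment_even_pos[of 0] by simp
  have "((\<lambda>y::real. \<integral>x. indicator {..y} x *\<^sub>R (indicator {0..} x *\<^sub>R exp (- x\<^sup>2)) \<partial>lborel)
     \<longlongrightarrow> (\<integral>x. indicator {0..} x *\<^sub>R exp (- x\<^sup>2) \<partial>lborel)) at_top"
    by (rule tendsto_integral_at_top[where f = "\<lambda>x. indicator {0..} x *\<^sub>R exp (- x\<^sup>2)"]) (use g in \<open>auto simp: has_bochner_integral_iff\<close>)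
  moreover have "eventually (\<lambda>y. (\<integral>x. indicator {..y} x *\<^sub>R (indicator {0..} x *\<^sub>R exp (- x\<^sup>2)) \<partial>lborel)
      = gauss_primitive y) at_top"
    using eventually_ge_at_top[of 0]
  proof eventually_elim
    case (elim y)
    then show ?case
      unfolding gauss_primitive_def interval_integral_Icc[OF elim, folded zero_ereal_def]
      unfolding set_lebesgue_integral_def
      by (intro Bochner_Integration.integral_cong) (auto simp: indicator_def)
  qed
  ultimately show ?thesis
    unfolding has_bochner_integral_integral_eq[OF g] by (rule Lim_transform_eventually)
qed

lemma gauss_primitive_at_bot: "(gauss_primitive \<longlongrightarrow> - (sqrt pi / 2)) at_bot"
  using tendsto_minus[OF gauss_primitive_at_top]
  by (simp add: filterlim_at_bot_mirror gauss_primitive_minus)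

text \<open>The integrand is the derivative of
  \<open>- (exp (r \<surd>u) G(r / (2 \<surd>x) + \<surd>(u x)) + exp (- r \<surd>u) G(r / (2 \<surd>x) - \<surd>(u x))) / \<surd>\<pi>\<close>
  with \<open>G\<close> the primitive of \<open>exp (- y\<^sup>2)\<close>.\<close>

lemma levy_laplace:
  assumes r: "0 < r" and u: "0 < u"
  shows "(\<integral>\<^sup>+x. ennreal (levy r x * exp (- u * x)) \<partial>lborel) = ennreal (exp (- r * sqrt u))"
proof -
  let ?h = "\<lambda>e x. r / (2 * sqrt x) + e * sqrt (u * x)"
  let ?F = "\<lambda>x. - (exp (r * sqrt u) * gauss_primitive (?h 1 x)
      + exp (- (r * sqrt u)) * gauss_primitive (?h (-1) x)) / sqrt pi"
  let ?f = "\<lambda>x. levy r x * exp (- u * x)"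
  have lev: "levy r x = r / (2 * sqrt pi) * (exp (- r\<^sup>2 / (4 * x)) / (x * sqrt x))" if "0 < x" for x
  proof -
    have "x powr (-3/2) = 1 / (x * sqrt x)"
      using that powr_add[of x 1 "1/2"] powr_minus_divide[of x "3/2"] by (simp add: powr_half_sqrt)
    then show ?thesis using that by (simp add: levy_def)
  qed
  have cont: "isCont ?f x" if "0 < x" for x
  proof -
    have "isCont (\<lambda>x. r / (2 * sqrt pi) * (exp (- r\<^sup>2 / (4 * x)) / (x * sqrt x)) * exp (- u * x)) x"
      using that by (intro continuous_intros) auto
    moreover have "eventually (\<lambda>y. ?f y = r / (2 * sqrt pi) * (exp (- r\<^sup>2 / (4 * y)) / (y * sqrt y)) * exp (- u * y)) (nhds x)"
      using eventually_nhds_in_open[of "{0<..}" x] that by (auto elim!: eventually_mono simp: lev)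
    ultimately show ?thesis by (subst isCont_cong)
  qed
  have der: "(?F has_real_derivative ?f x) (at x)" if x: "0 < x" for x
  proof -
    have d: "((\<lambda>x. gauss_primitive (?h e x)) has_real_derivative
        exp (- (?h e x)\<^sup>2) * (- r / (4 * (x * sqrt x)) + e * sqrt u / (2 * sqrt x))) (at x)" for e :: real
    proof (rule DERIV_chain2[OF gauss_primitive_deriv])
      have "((\<lambda>x. r / (2 * sqrt x) + e * (sqrt u * sqrt x)) has_real_derivative
          (- r / (4 * (x * sqrt x)) + e * sqrt u / (2 * sqrt x))) (at x)"
        using x by (auto intro!: derivative_eq_intros simp: field_simps)
      then show "(?h e has_real_derivative (- r / (4 * (x * sqrt x)) + e * sqrt u / (2 * sqrt x))) (at x)"
        by (simp add: real_sqrt_mult)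
    qed
    \<comment> \<open>Completing the square: the cross term of the squared argument is e r sqrt u,
      which cancels the exponential prefactor. Both halves of \<open>?F\<close> thus carry the same
      Gaussian factor, and in the derivative their terms in sqrt u cancel.\<close>
    have sq: "exp (e * (r * sqrt u)) * exp (- (?h e x)\<^sup>2) = exp (- r\<^sup>2 / (4 * x)) * exp (- u * x)"
      if e: "e * e = 1" for e :: real
    proof -
      have "(?h e x)\<^sup>2 = r\<^sup>2 / (4 * x) + e * (r * sqrt u) + u * x * (e * e)"
        using x u by (simp add: real_sqrt_mult power2_sum power_divide power_mult_distrib) (simp add: field_simps power2_eq_square)
      then show ?thesis using e by (simp flip: exp_add add: algebra_simps)
    qed
    have "(?F has_real_derivative
       - (exp (r * sqrt u) * (exp (- (?h 1 x)\<^sup>2) * (- r / (4 * (x * sqrt x)) + 1 * sqrt u / (2 * sqrt x)))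
        + exp (- (r * sqrt u)) * (exp (- (?h (-1) x)\<^sup>2) * (- r / (4 * (x * sqrt x)) + (-1) * sqrt u / (2 * sqrt x)))) / sqrt pi) (at x)"
      by (intro DERIV_cdivide DERIV_minus DERIV_add DERIV_cmult d)
    also have "- (exp (r * sqrt u) * (exp (- (?h 1 x)\<^sup>2) * (- r / (4 * (x * sqrt x)) + 1 * sqrt u / (2 * sqrt x)))
        + exp (- (r * sqrt u)) * (exp (- (?h (-1) x)\<^sup>2) * (- r / (4 * (x * sqrt x)) + (-1) * sqrt u / (2 * sqrt x)))) / sqrt pi
      = - ((exp (1 * (r * sqrt u)) * exp (- (?h 1 x)\<^sup>2)) * (- r / (4 * (x * sqrt x)) + 1 * sqrt u / (2 * sqrt x))
        + (exp ((-1) * (r * sqrt u)) * exp (- (?h (-1) x)\<^sup>2)) * (- r / (4 * (x * sqrt x)) + (-1) * sqrt u / (2 * sqrt x))) / sqrt pi"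
      by simp
    also have "\<dots> = ?f x"
      using x by (subst (1 2) sq) (simp_all add: lev field_simps)
    finally show ?thesis .
  qed
  have pos: "0 \<le> ?f x" for x using r by (simp add: levy_nonneg)
  \<comment> \<open>At 0 both arguments are driven to infinity by r / (2 sqrt x); at infinity their
    sign is that of e. The half with e = 1 has equal limits at both ends, so only exp (- r sqrt u)
    survives in the difference.\<close>
  have fl0: "filterlim (?h e) at_top (at_right 0)" and flt: "filterlim (?h 1) at_top at_top"
     and flb: "filterlim (?h (-1)) at_bot at_top" for e :: real
    using r u by real_asymp+
  have l0: "(?F \<longlongrightarrow> - (exp (r * sqrt u) * (sqrt pi / 2) + exp (- (r * sqrt u)) * (sqrt pi / 2)) / sqrt pi) (at_right 0)"
    by (intro tendsto_intros filterlim_compose[OF gauss_primitive_at_top] fl0) auto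
  have l1: "(?F \<longlongrightarrow> - (exp (r * sqrt u) * (sqrt pi / 2) + exp (- (r * sqrt u)) * (- (sqrt pi / 2))) / sqrt pi) at_top"
    by (intro tendsto_intros filterlim_compose[OF gauss_primitive_at_top flt]
       filterlim_compose[OF gauss_primitive_at_bot flb]) auto
  have i: "set_integrable lborel (einterval 0 \<infinity>) ?f"
    and v: "(LBINT x=0..\<infinity>. ?f x) = exp (- r * sqrt u)"
    using interval_integral_FTC_nonneg[where a=0 and b=\<infinity> and F="?F" and f="?f"
      and A = "- (exp (r * sqrt u) * (sqrt pi / 2) + exp (- (r * sqrt u)) * (sqrt pi / 2)) / sqrt pi"
      and B = "- (exp (r * sqrt u) * (sqrt pi / 2) + exp (- (r * sqrt u)) * (- (sqrt pi / 2))) / sqrt pi"]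
      l0 l1 der cont pos
    unfolding zero_ereal_def by (auto simp: ereal_tendsto_simps1 field_simps)
  have eq: "indicator (einterval 0 \<infinity>) x *\<^sub>R ?f x = ?f x" for x
    by (auto simp: indicator_def einterval_def levy_def)
  have "(\<integral>\<^sup>+x. ennreal (?f x) \<partial>lborel) = ennreal (\<integral>x. ?f x \<partial>lborel)"
    using i[unfolded set_integrable_def eq] pos by (intro nn_integral_eq_integral AE_I2)
  also have "(\<integral>x. ?f x \<partial>lborel) = exp (- r * sqrt u)"
    using v unfolding interval_lebesgue_integral_def set_lebesgue_integral_def eq by simp
  finally show ?thesis .
qed
lemma levy_eq_0: "x \<le> 0 \<Longrightarrow> levy r x = 0"
  by (simp add: levy_def)

text \<open>Stability of index 1/2: dividing a variable with density \<open>levy r\<close> by t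
  divides the parameter by sqrt t. A common factor of the four coordinates can thus be absorbed into
  the mixing variable s.\<close>

lemma levy_scale:
  assumes t: "0 < t"
  shows "levy (r / sqrt t) x = t * levy r (t * x)"
proof (cases "0 < x")
  case True
  have "t powr (-3/2) = 1 / (t * sqrt t)"
    using t powr_add[of t 1 "1/2"] powr_minus_divide[of t "3/2"] by (simp add: powr_half_sqrt)
  then show ?thesis
    using t True by (simp add: levy_def powr_mult power_divide field_simps)
qed (use t in \<open>simp add: levy_def zero_less_mult_iff\<close>)

section \<open>Integrals over the mixing variables\<close>

lemma nn_integral_exp_Ioi:
  assumes "0 < c"
  shows "(\<integral>\<^sup>+s. ennreal (indicator {0<..} s * (2 * exp (- c * s))) \<partial>lborel) = ennreal (2 / c)"
proof -
  have "(\<integral>\<^sup>+s. ennreal (2 * exp (- c * s)) * indicator {0..} s \<partial>lborel) = 0 - (- 2 / c * exp (- c * 0))"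
  proof (rule nn_integral_FTC_atLeast)
    show "((\<lambda>s. - 2 / c * exp (- c * s)) \<longlongrightarrow> 0) at_top"
      using assms by real_asymp
  qed (use assms in \<open>auto intro!: derivative_eq_intros\<close>)
  moreover have "(\<integral>\<^sup>+s. ennreal (indicator {0<..} s * (2 * exp (- c * s))) \<partial>lborel) =
      (\<integral>\<^sup>+s. ennreal (2 * exp (- c * s)) * indicator {0..} s \<partial>lborel)"
    by (intro nn_integral_cong_AE AE_mp[OF AE_lborel_singleton[of 0] AE_I2])
       (auto simp: indicator_def)
  ultimately show ?thesis by simp
qed

text \<open>The power s ^ 4 collects the prefactors of four \<open>levy\<close> densities; the
  substitution by sqrt c is the origin of the exponent 5/2 in the density of the theorem.\<close>

lemma nn_integral_gauss_power4:
  assumes c: "0 < c"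
  shows "(\<integral>\<^sup>+s. ennreal (indicator {0<..} s * (s ^ 4 * exp (- c * s\<^sup>2))) \<partial>lborel) =
    ennreal (3 * sqrt pi / 8 * c powr (-5/2))"
proof -
  let ?f = "\<lambda>s::real. ennreal (indicator {0..} s *\<^sub>R (exp (- s\<^sup>2) * s ^ 4))"
  have "has_bochner_integral lborel (\<lambda>s::real. indicator {0..} s *\<^sub>R (exp (- s\<^sup>2) * s ^ 4)) (3 * sqrt pi / 8)"
    using gaussian_moment_even_pos[of 2] by (simp add: fact_numeral mult.commute)
  then have "ennreal (3 * sqrt pi / 8) = (\<integral>\<^sup>+s. ?f s \<partial>lborel)"
    by (subst nn_integral_eq_integral) (auto simp: has_bochner_integral_iff)
  also have "\<dots> = ennreal (sqrt c) * (\<integral>\<^sup>+s. ?f (0 + sqrt c * s) \<partial>lborel)"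
    using c by (subst nn_integral_real_affine[of _ "sqrt c" 0]) auto
  also have "(\<integral>\<^sup>+s. ?f (0 + sqrt c * s) \<partial>lborel) =
      (\<integral>\<^sup>+s. ennreal (c\<^sup>2) * ennreal (indicator {0<..} s * (s ^ 4 * exp (- c * s\<^sup>2))) \<partial>lborel)"
  proof (intro nn_integral_cong_AE AE_mp[OF AE_lborel_singleton[of 0] AE_I2] impI)
    fix s :: real assume "s \<noteq> 0"
    have "sqrt c ^ 4 = c\<^sup>2"
      using c by (simp add: power4_eq_xxxx power2_eq_square)
    then show "?f (0 + sqrt c * s) = ennreal (c\<^sup>2) * ennreal (indicator {0<..} s * (s ^ 4 * exp (- c * s\<^sup>2)))"
      using c \<open>s \<noteq> 0\<close> by (auto simp: indicator_def power_mult_distrib zero_le_mult_iff simp flip: ennreal_mult')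
  qed
  also have "\<dots> = ennreal (c\<^sup>2) * (\<integral>\<^sup>+s. ennreal (indicator {0<..} s * (s ^ 4 * exp (- c * s\<^sup>2))) \<partial>lborel)"
    by (rule nn_integral_cmult) auto
  \<comment> \<open>The substitution has produced the integral times c powr (5/2); multiplying by
    the inverse power isolates it without dividing in \<open>ennreal\<close>.\<close>
  finally have "ennreal (c powr (-5/2)) * ennreal (3 * sqrt pi / 8) = ennreal (c powr (-5/2)) * (ennreal (sqrt c) *
      (ennreal (c\<^sup>2) * (\<integral>\<^sup>+s. ennreal (indicator {0<..} s * (s ^ 4 * exp (- c * s\<^sup>2))) \<partial>lborel)))"
    by simp
  also have "\<dots> = ennreal (c powr (-5/2) * sqrt c * c\<^sup>2) * (\<integral>\<^sup>+s. ennreal (indicator {0<..} s * (s ^ 4 * exp (- c * s\<^sup>2))) \<partial>lborel)"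
    using c by (simp add: ennreal_mult mult_ac)
  also have "c powr (-5/2) * sqrt c * c\<^sup>2 = 1"
  proof -
    have "c powr (-5/2) * sqrt c * c\<^sup>2 = c powr (-5/2) * c powr (1/2) * c powr 2"
      using c by (simp add: powr_half_sqrt)
    also have "\<dots> = c powr (-5/2 + 1/2 + 2)"
      by (simp only: powr_add)
    finally show ?thesis using c by simp
  qed
  finally have "(\<integral>\<^sup>+s. ennreal (indicator {0<..} s * (s ^ 4 * exp (- c * s\<^sup>2))) \<partial>lborel) =
      ennreal (c powr (-5/2)) * ennreal (3 * sqrt pi / 8)"
    by (simp only: ennreal_1 mult_1)
  also have "\<dots> = ennreal (3 * sqrt pi / 8 * c powr (-5/2))"
    by (subst ennreal_mult'[symmetric]) (simp_all only: powr_ge_zero mult.commute)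
  finally show ?thesis .
qed

lemma nn_integral_powr_neg_half:
  assumes w: "0 < w"
  shows "(\<integral>\<^sup>+t. ennreal (indicator {0<..} t * (t powr (-1/2) * exp (- w * t))) \<partial>lborel) =
    ennreal (sqrt pi * w powr (-1/2))"
proof -
  let ?f = "\<lambda>t::real. ennreal (indicator {0..} t * t powr (1/2 - 1) / exp t)"
  have "ennreal (sqrt pi) = (\<integral>\<^sup>+t. ?f t \<partial>lborel)"
    using Gamma_conv_nn_integral_real[of "1/2"] by (simp add: Gamma_one_half_real)
  also have "\<dots> = ennreal w * (\<integral>\<^sup>+t. ?f (0 + w * t) \<partial>lborel)"
    using w by (subst nn_integral_real_affine[of _ w 0]) auto
  also have "(\<integral>\<^sup>+t. ?f (0 + w * t) \<partial>lborel) =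
      (\<integral>\<^sup>+t. ennreal (w powr (-1/2)) * ennreal (indicator {0<..} t * (t powr (-1/2) * exp (- w * t))) \<partial>lborel)"
  proof (intro nn_integral_cong)
    fix t :: real
    show "?f (0 + w * t) = ennreal (w powr (-1/2)) * ennreal (indicator {0<..} t * (t powr (-1/2) * exp (- w * t)))"
      using w by (auto simp: indicator_def powr_mult zero_le_mult_iff exp_minus field_simps simp flip: ennreal_mult')
  qed
  also have "\<dots> = ennreal (w powr (-1/2)) * (\<integral>\<^sup>+t. ennreal (indicator {0<..} t * (t powr (-1/2) * exp (- w * t))) \<partial>lborel)"
    by (rule nn_integral_cmult) auto
  finally have "ennreal (w powr (-1/2)) * ennreal (sqrt pi) = ennreal (w powr (-1/2)) * (ennreal w *
      (ennreal (w powr (-1/2)) * (\<integral>\<^sup>+t. ennreal (indicator {0<..} t * (t powr (-1/2) * exp (- w * t))) \<partial>lborel)))"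
    by simp
  also have "\<dots> = ennreal (w powr (-1/2) * w * w powr (-1/2)) * (\<integral>\<^sup>+t. ennreal (indicator {0<..} t * (t powr (-1/2) * exp (- w * t))) \<partial>lborel)"
    using w by (simp add: ennreal_mult mult_ac)
  also have "w powr (-1/2) * w * w powr (-1/2) = 1"
    using w powr_add[of w "-1/2" "-1/2"] by (simp add: powr_minus field_simps)
  finally have "(\<integral>\<^sup>+t. ennreal (indicator {0<..} t * (t powr (-1/2) * exp (- w * t))) \<partial>lborel) =
      ennreal (w powr (-1/2)) * ennreal (sqrt pi)"
    by (simp only: ennreal_1 mult_1)
  also have "\<dots> = ennreal (sqrt pi * w powr (-1/2))"
    by (subst ennreal_mult'[symmetric]) (simp_all only: powr_ge_zero mult.commute)
  finally show ?thesis .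
qed

section \<open>The density on the simplex\<close>

text \<open>The integrand of \<open>separable_density\<close> with its four factors as independent
  variables, in the order of their occurrence there: a and b go with p, c and d with q. The value 0
  off the open orthant lets later integrals run over whole lines.\<close>

definition sep_kernel :: "real \<Rightarrow> real \<Rightarrow> real \<Rightarrow> real \<Rightarrow> real \<Rightarrow> real \<Rightarrow> real" where
  "sep_kernel p q a c b d = (if 0 < a \<and> 0 < c \<and> 0 < b \<and> 0 < d then
     3 * p\<^sup>2 * q\<^sup>2 / (2 * pi * (a * c * b * d) powr (3/2) *
       (p\<^sup>2 / a + q\<^sup>2 / c + p\<^sup>2 / b + q\<^sup>2 / d) powr (5/2)) else 0)"

text \<open>The four exponentials combine to exp (- s^2 S / 4), with S the sum in the last factor of
  the kernel, which leaves a Gaussian moment in s. The constant 3 / (2 pi) arises as 2 sqrt pi times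
  (2 sqrt pi) powr (-4) times 3 sqrt pi / 8 times 4 powr (5/2).\<close>

lemma sep_kernel_mixture:
  assumes p: "0 < p" and q: "0 < q" and v: "0 < a" "0 < c" "0 < b" "0 < d"
  shows "ennreal (sep_kernel p q a c b d) =
    (\<integral>\<^sup>+s. ennreal (indicator {0<..} s * (2 * sqrt pi *
       (levy (s * p) a * levy (s * q) c * levy (s * p) b * levy (s * q) d))) \<partial>lborel)"
proof -
  define S where "S = p\<^sup>2 / a + q\<^sup>2 / c + p\<^sup>2 / b + q\<^sup>2 / d"
  define K where "K = 2 * sqrt pi * p\<^sup>2 * q\<^sup>2 / (16 * pi\<^sup>2) * (a * c * b * d) powr (-3/2)"
  have S: "0 < S" unfolding S_def using p q v by (intro add_pos_pos divide_pos_pos) auto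
  have eq: "2 * sqrt pi * (levy (s * p) a * levy (s * q) c * levy (s * p) b * levy (s * q) d) =
      K * (s ^ 4 * exp (- (S / 4) * s\<^sup>2))" for s
  proof -
    have "exp (- (S / 4) * s\<^sup>2) = exp (- (s * p)\<^sup>2 / (4 * a)) * exp (- (s * q)\<^sup>2 / (4 * c))
        * exp (- (s * p)\<^sup>2 / (4 * b)) * exp (- (s * q)\<^sup>2 / (4 * d))"
      by (simp add: S_def power_mult_distrib algebra_simps flip: exp_add)
    moreover have "sqrt pi ^ 4 = pi\<^sup>2" by (simp add: power4_eq_xxxx power2_eq_square)
    ultimately show ?thesis
      using v by (simp add: levy_def K_def powr_mult power2_eq_square power4_eq_xxxx)
  qed
  have "(\<integral>\<^sup>+s. ennreal (indicator {0<..} s * (2 * sqrt pi *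
       (levy (s * p) a * levy (s * q) c * levy (s * p) b * levy (s * q) d))) \<partial>lborel) =
     (\<integral>\<^sup>+s. ennreal K * ennreal (indicator {0<..} s * (s ^ 4 * exp (- (S / 4) * s\<^sup>2))) \<partial>lborel)"
    unfolding eq using v by (intro nn_integral_cong) (simp add: K_def mult_ac flip: ennreal_mult')
  also have "\<dots> = ennreal (K * (3 * sqrt pi / 8 * (S / 4) powr (-5/2)))"
    using S nn_integral_gauss_power4[of "S / 4"] v
    by (subst nn_integral_cmult, simp) (simp add: K_def flip: ennreal_mult')
  also have "K * (3 * sqrt pi / 8 * (S / 4) powr (-5/2)) = sep_kernel p q a c b d"
  proof -
    have "(4::real) powr (5/2) = 32"
      using powr_powr[of 2 2 "5/2"] by simp
    then have 4: "(S / 4) powr (-5/2) = 32 / S powr (5/2)"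
      using S by (simp add: powr_divide powr_minus field_simps)
    have k: "sep_kernel p q a c b d = 3 * p\<^sup>2 * q\<^sup>2 / (2 * pi * (a * c * b * d) powr (3/2) * S powr (5/2))"
      using v unfolding sep_kernel_def S_def by simp
    show ?thesis
      unfolding 4 k using v by (simp add: K_def powr_minus power2_eq_square field_simps)
  qed
  finally show ?thesis ..
qed

section \<open>The transform of the simplex density\<close>

lemma nn_integral_lborel_swap3:
  fixes F :: "real \<Rightarrow> real \<Rightarrow> real \<Rightarrow> real \<Rightarrow> ennreal"
  assumes "(\<lambda>(a, c, d, t). F a c d t) \<in> borel_measurable (borel \<Otimes>\<^sub>M borel \<Otimes>\<^sub>M borel \<Otimes>\<^sub>M borel)"
  shows "(\<integral>\<^sup>+a. \<integral>\<^sup>+c. \<integral>\<^sup>+d. \<integral>\<^sup>+t. F a c d t \<partial>lborel \<partial>lborel \<partial>lborel \<partial>lborel) =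
    (\<integral>\<^sup>+t. \<integral>\<^sup>+a. \<integral>\<^sup>+c. \<integral>\<^sup>+d. F a c d t \<partial>lborel \<partial>lborel \<partial>lborel \<partial>lborel)"
proof -
  define G where "G = (\<lambda>(a, c, d, t). F a c d t)"
  have [measurable]: "G \<in> borel_measurable (borel \<Otimes>\<^sub>M borel \<Otimes>\<^sub>M borel \<Otimes>\<^sub>M borel)"
    using assms by (simp add: G_def)
  have F: "F a c d t = G (a, c, d, t)" for a c d t by (simp add: G_def)
  have "(\<integral>\<^sup>+a. \<integral>\<^sup>+c. \<integral>\<^sup>+d. \<integral>\<^sup>+t. F a c d t \<partial>lborel \<partial>lborel \<partial>lborel \<partial>lborel) =
     (\<integral>\<^sup>+a. \<integral>\<^sup>+c. \<integral>\<^sup>+t. \<integral>\<^sup>+d. F a c d t \<partial>lborel \<partial>lborel \<partial>lborel \<partial>lborel)"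
    unfolding F by (rule nn_integral_cong, rule nn_integral_cong, rule lborel_pair.Fubini') measurable
  also have "\<dots> = (\<integral>\<^sup>+a. \<integral>\<^sup>+t. \<integral>\<^sup>+c. \<integral>\<^sup>+d. F a c d t \<partial>lborel \<partial>lborel \<partial>lborel \<partial>lborel)"
    unfolding F by (rule nn_integral_cong, rule lborel_pair.Fubini') measurable
  also have "\<dots> = (\<integral>\<^sup>+t. \<integral>\<^sup>+a. \<integral>\<^sup>+c. \<integral>\<^sup>+d. F a c d t \<partial>lborel \<partial>lborel \<partial>lborel \<partial>lborel)"
    unfolding F by (rule lborel_pair.Fubini') measurable
  finally show ?thesis .
qed

lemma nn_integral_lborel_scale3:
  fixes F :: "real \<Rightarrow> real \<Rightarrow> real \<Rightarrow> ennreal"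
  assumes t: "0 < t" and "(\<lambda>(a, c, d). F a c d) \<in> borel_measurable (borel \<Otimes>\<^sub>M borel \<Otimes>\<^sub>M borel)"
  shows "(\<integral>\<^sup>+a. \<integral>\<^sup>+c. \<integral>\<^sup>+d. F a c d \<partial>lborel \<partial>lborel \<partial>lborel) =
    (\<integral>\<^sup>+a. \<integral>\<^sup>+c. \<integral>\<^sup>+d. ennreal (t ^ 3) * F (t * a) (t * c) (t * d) \<partial>lborel \<partial>lborel \<partial>lborel)"
proof -
  define G where "G = (\<lambda>(a, c, d). F a c d)"
  have [measurable]: "G \<in> borel_measurable (borel \<Otimes>\<^sub>M borel \<Otimes>\<^sub>M borel)"
    using assms by (simp add: G_def)
  have F: "F a c d = G (a, c, d)" for a c d by (simp add: G_def)
  have sc: "(\<integral>\<^sup>+x. f x \<partial>lborel) = ennreal t * (\<integral>\<^sup>+x. f (t * x) \<partial>lborel)"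
    if "f \<in> borel_measurable borel" for f :: "real \<Rightarrow> ennreal"
    using nn_integral_real_affine[OF that, of t 0] t by simp
  have "(\<integral>\<^sup>+a. \<integral>\<^sup>+c. \<integral>\<^sup>+d. F a c d \<partial>lborel \<partial>lborel \<partial>lborel) =
     ennreal t * (\<integral>\<^sup>+a. \<integral>\<^sup>+c. \<integral>\<^sup>+d. F (t * a) c d \<partial>lborel \<partial>lborel \<partial>lborel)"
    unfolding F by (rule sc) measurable
  also have "(\<integral>\<^sup>+a. \<integral>\<^sup>+c. \<integral>\<^sup>+d. F (t * a) c d \<partial>lborel \<partial>lborel \<partial>lborel) =
     (\<integral>\<^sup>+a. ennreal t * (\<integral>\<^sup>+c. \<integral>\<^sup>+d. F (t * a) (t * c) d \<partial>lborel \<partial>lborel) \<partial>lborel)"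
    unfolding F by (rule nn_integral_cong, rule sc) measurable
  also have "\<dots> = (\<integral>\<^sup>+a. ennreal t * (\<integral>\<^sup>+c. ennreal t * (\<integral>\<^sup>+d. F (t * a) (t * c) (t * d) \<partial>lborel) \<partial>lborel) \<partial>lborel)"
    unfolding F by (rule nn_integral_cong, rule arg_cong[where f="\<lambda>x. ennreal t * x"], rule nn_integral_cong, rule sc) measurable
  finally show ?thesis
    using t unfolding F by (simp add: nn_integral_cmult power3_eq_cube ennreal_mult mult.assoc)
qed

text \<open>The integral over b is innermost because b will take the place of the radius t in
  \<open>nn_integral_sep_kernel_simplex\<close>.\<close>

lemma levy_laplace4:
  assumes r: "0 < r1" "0 < r2" "0 < r3" "0 < r4" and u: "0 < u1" "0 < u2" "0 < u3" "0 < u4"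
  shows "(\<integral>\<^sup>+a. \<integral>\<^sup>+c. \<integral>\<^sup>+d. \<integral>\<^sup>+b. ennreal (levy r1 a * levy r2 c * levy r3 b * levy r4 d
      * exp (- (u1 * a + u2 * c + u3 * b + u4 * d))) \<partial>lborel \<partial>lborel \<partial>lborel \<partial>lborel)
    = ennreal (exp (- (r1 * sqrt u1 + r2 * sqrt u2 + r3 * sqrt u3 + r4 * sqrt u4)))"
proof -
  let ?l = "\<lambda>r u x. ennreal (levy r x * exp (- u * x))"
  have "(\<integral>\<^sup>+a. \<integral>\<^sup>+c. \<integral>\<^sup>+d. \<integral>\<^sup>+b. ennreal (levy r1 a * levy r2 c * levy r3 b * levy r4 d
      * exp (- (u1 * a + u2 * c + u3 * b + u4 * d))) \<partial>lborel \<partial>lborel \<partial>lborel \<partial>lborel) =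
    (\<integral>\<^sup>+a. \<integral>\<^sup>+c. \<integral>\<^sup>+d. \<integral>\<^sup>+b. ?l r1 u1 a * (?l r2 u2 c * (?l r4 u4 d * ?l r3 u3 b))
       \<partial>lborel \<partial>lborel \<partial>lborel \<partial>lborel)"
  proof (intro nn_integral_cong)
    fix a c d b :: real
    have "exp (- (u1 * a + u2 * c + u3 * b + u4 * d)) = exp (- u1 * a) * exp (- u2 * c) * exp (- u3 * b) * exp (- u4 * d)"
      by (simp flip: exp_add)
    then have "levy r1 a * levy r2 c * levy r3 b * levy r4 d * exp (- (u1 * a + u2 * c + u3 * b + u4 * d)) =
      (levy r1 a * exp (- u1 * a)) * ((levy r2 c * exp (- u2 * c)) * ((levy r4 d * exp (- u4 * d)) * (levy r3 b * exp (- u3 * b))))"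
      by (simp only: mult_ac)
    then show "ennreal (levy r1 a * levy r2 c * levy r3 b * levy r4 d * exp (- (u1 * a + u2 * c + u3 * b + u4 * d))) =
       ?l r1 u1 a * (?l r2 u2 c * (?l r4 u4 d * ?l r3 u3 b))"
      using r by (simp only:) (simp add: ennreal_mult levy_nonneg)
  qed
  also have "\<dots> = ennreal (exp (- r1 * sqrt u1)) * (ennreal (exp (- r2 * sqrt u2)) *
      (ennreal (exp (- r4 * sqrt u4)) * ennreal (exp (- r3 * sqrt u3))))"
    unfolding levy_laplace[OF r(1) u(1), symmetric] levy_laplace[OF r(2) u(2), symmetric]
      levy_laplace[OF r(3) u(3), symmetric] levy_laplace[OF r(4) u(4), symmetric]
    by (simp add: nn_integral_cmult nn_integral_multc)
  also have "\<dots> = ennreal (exp (- (r1 * sqrt u1 + r2 * sqrt u2 + r3 * sqrt u3 + r4 * sqrt u4)))"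
    by (simp flip: ennreal_mult' exp_add)
  finally show ?thesis .
qed

context
  fixes p q u1 u2 u3 u4 :: real
  assumes p: "0 < p" and q: "0 < q" and u: "0 < u1" "0 < u2" "0 < u3" "0 < u4"
begin

definition levy_prod :: "real \<Rightarrow> real \<Rightarrow> real \<Rightarrow> real \<Rightarrow> real \<Rightarrow> real" where
  "levy_prod s a c b d = levy (s * p) a * levy (s * q) c * levy (s * p) b * levy (s * q) d
      * exp (- (u1 * a + u2 * c + u3 * b + u4 * d))"

lemma levy_prod_measurable [measurable]:
  assumes [measurable]: "f \<in> borel_measurable M" "g \<in> borel_measurable M" "h \<in> borel_measurable M"
     "k \<in> borel_measurable M" "l \<in> borel_measurable M"
  shows "(\<lambda>w. levy_prod (f w) (g w) (h w) (k w) (l w)) \<in> borel_measurable M"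
  unfolding levy_prod_def by measurable

text \<open>Writing \<open>w powr (-1/2)\<close> as a Gamma integral over \<open>t\<close> and rescaling \<open>s\<close> by \<open>1 / sqrt t\<close> makes
  the integrand a function of \<open>t (a, c, b, d)\<close>; the factor \<open>t ^ 3\<close> is the Jacobian of
  polar coordinates on the orthant, so that the integral over the simplex becomes one over the orthant.\<close>

lemma sep_kernel_powr_mixture:
  "ennreal (sep_kernel p q a c b d) * ennreal ((u1 * a + u2 * c + u3 * b + u4 * d) powr (-1/2)) =
    (\<integral>\<^sup>+t. \<integral>\<^sup>+s. ennreal (indicator {0<..} t * indicator {0<..} s * 2 * t ^ 3 *
       levy_prod s (t * a) (t * c) (t * b) (t * d)) \<partial>lborel \<partial>lborel)"
proof (cases "0 < a \<and> 0 < c \<and> 0 < b \<and> 0 < d")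
  case False
  then have z: "indicator {0<..} t * indicator {0<..} s * 2 * t ^ 3 * levy_prod s (t * a) (t * c) (t * b) (t * d) = 0" for s t
    by (cases "0 < t") (auto simp: levy_prod_def levy_eq_0 mult_le_0_iff not_less)
  have "sep_kernel p q a c b d = 0" using False by (auto simp: sep_kernel_def)
  then show ?thesis unfolding z by simp
next
  case True
  define w where "w = u1 * a + u2 * c + u3 * b + u4 * d"
  have w: "0 < w" unfolding w_def using True u by (intro add_pos_pos mult_pos_pos) auto
  have "ennreal (sep_kernel p q a c b d) * ennreal (w powr (-1/2)) =
     ennreal (sep_kernel p q a c b d) * (ennreal (1 / sqrt pi) *
       (\<integral>\<^sup>+t. ennreal (indicator {0<..} t * (t powr (-1/2) * exp (- w * t))) \<partial>lborel))"
    unfolding nn_integral_powr_neg_half[OF w] by (simp flip: ennreal_mult')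
  also have "\<dots> = (\<integral>\<^sup>+t. ennreal (indicator {0<..} t * (t powr (-1/2) * exp (- w * t)) / sqrt pi) * ennreal (sep_kernel p q a c b d) \<partial>lborel)"
    by (simp add: nn_integral_multc nn_integral_cmult mult_ac flip: ennreal_mult' nn_integral_cmult)
  also have "\<dots> = (\<integral>\<^sup>+t. \<integral>\<^sup>+s. ennreal (indicator {0<..} t * indicator {0<..} s * 2 * t ^ 3 *
       levy_prod s (t * a) (t * c) (t * b) (t * d)) \<partial>lborel \<partial>lborel)"
  proof (intro nn_integral_cong)
    fix t :: real
    show "ennreal (indicator {0<..} t * (t powr (-1/2) * exp (- w * t)) / sqrt pi) * ennreal (sep_kernel p q a c b d) =
      (\<integral>\<^sup>+s. ennreal (indicator {0<..} t * indicator {0<..} s * 2 * t ^ 3 *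
       levy_prod s (t * a) (t * c) (t * b) (t * d)) \<partial>lborel)"
    proof (cases "0 < t")
      case t: True
      let ?g = "\<lambda>s. ennreal (indicator {0<..} s * (2 * sqrt pi *
         (levy (s * p) a * levy (s * q) c * levy (s * p) b * levy (s * q) d)))"
      let ?c = "ennreal (indicator {0<..} t * (t powr (-1/2) * exp (- w * t)) / sqrt pi)"
      have "?c * ennreal (sep_kernel p q a c b d) = ?c * (\<integral>\<^sup>+s. ?g s \<partial>lborel)"
        using sep_kernel_mixture[OF p q] True by simp
      also have "\<dots> = ?c * (ennreal (1 / sqrt t) * (\<integral>\<^sup>+s. ?g (0 + 1 / sqrt t * s) \<partial>lborel))"
        using t by (subst nn_integral_real_affine[of ?g "1 / sqrt t" 0]) auto
      also have "\<dots> = (\<integral>\<^sup>+s. ?c * (ennreal (1 / sqrt t) * ?g (0 + 1 / sqrt t * s)) \<partial>lborel)"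
        by (subst nn_integral_cmult, measurable, subst nn_integral_cmult, measurable)
      also have "\<dots> = (\<integral>\<^sup>+s. ennreal (indicator {0<..} t * indicator {0<..} s * 2 * t ^ 3 *
       levy_prod s (t * a) (t * c) (t * b) (t * d)) \<partial>lborel)"
      proof (intro nn_integral_cong)
        fix s :: real
        have sc: "levy (1 / sqrt t * s * r) x = t * levy (s * r) (t * x)" for r x
          using levy_scale[OF t, of "s * r" x] by simp
        have ind: "indicator {0<..} (1 / sqrt t * s) = (indicator {0<..} s :: real)"
          using t by (simp add: indicator_def zero_less_divide_iff)
        \<comment> \<open>Powers of t: the Gamma weight and the Jacobian of s together give 1 / t,
          the four \<open>levy\<close> factors give t ^ 4, so t ^ 3 remains.\<close>
        have t12: "t powr (-1/2) * (1 / sqrt t) = 1 / t"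
          using t by (simp add: powr_minus powr_half_sqrt field_simps)
        have "indicator {0<..} t * (t powr (-1/2) * exp (- w * t)) / sqrt pi * (1 / sqrt t *
            (indicator {0<..} s * (2 * sqrt pi * ((t * levy (s * p) (t * a)) * (t * levy (s * q) (t * c)) *
              (t * levy (s * p) (t * b)) * (t * levy (s * q) (t * d))))))
          = (t powr (-1/2) * (1 / sqrt t)) * t * (indicator {0<..} t * indicator {0<..} s * 2 * t ^ 3 *
            levy_prod s (t * a) (t * c) (t * b) (t * d))"
          by (simp add: levy_prod_def w_def field_simps power3_eq_cube)
        then show "?c * (ennreal (1 / sqrt t) * ?g (0 + 1 / sqrt t * s)) =
           ennreal (indicator {0<..} t * indicator {0<..} s * 2 * t ^ 3 *
             levy_prod s (t * a) (t * c) (t * b) (t * d))"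
          unfolding t12 add_0 sc ind using t by (simp flip: ennreal_mult')
      qed
      finally show ?thesis .
    qed simp
  qed
  finally show ?thesis by (simp add: w_def)
qed

lemma nn_integral_levy_prod_scale:
  assumes t: "0 < t"
  shows "(\<integral>\<^sup>+a. \<integral>\<^sup>+c. \<integral>\<^sup>+d. ennreal (t ^ 3) * ennreal (levy_prod s (t * a) (t * c) (t * (1 - a - c - d)) (t * d)) \<partial>lborel \<partial>lborel \<partial>lborel)
    = (\<integral>\<^sup>+a. \<integral>\<^sup>+c. \<integral>\<^sup>+d. ennreal (levy_prod s a c (t - a - c - d) d) \<partial>lborel \<partial>lborel \<partial>lborel)"
proof -
  have eq: "t - t * a - t * c - t * d = t * (1 - a - c - d)" for a c d
    by (simp add: algebra_simps)
  show ?thesis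
    using nn_integral_lborel_scale3[where F = "\<lambda>a c d. ennreal (levy_prod s a c (t - a - c - d) d)", OF t]
    unfolding eq by (rule sym) measurable
qed

text \<open>After rescaling, (a, c, d) ranges over the simplex of size t, and integrating over t as
  well fills the orthant. There the integrand is a product, the four Laplace transforms multiply to
  exp (- \<sigma> s), and s is integrated last.\<close>

lemma nn_integral_sep_kernel_simplex:
  "(\<integral>\<^sup>+a. \<integral>\<^sup>+c. \<integral>\<^sup>+d. ennreal (sep_kernel p q a c (1 - a - c - d) d) *
      ennreal ((u1 * a + u2 * c + u3 * (1 - a - c - d) + u4 * d) powr (-1/2)) \<partial>lborel \<partial>lborel \<partial>lborel)
   = ennreal (2 / (p * sqrt u1 + q * sqrt u2 + p * sqrt u3 + q * sqrt u4))" (is "?lhs = _")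
proof -
  define \<sigma> where "\<sigma> = p * sqrt u1 + q * sqrt u2 + p * sqrt u3 + q * sqrt u4"
  have \<sigma>: "0 < \<sigma>" unfolding \<sigma>_def using p q u by (intro add_pos_pos mult_pos_pos) auto
  let ?G = "\<lambda>t s a c d. ennreal (indicator {0<..} t * indicator {0<..} s * 2 * t ^ 3 *
       levy_prod s (t * a) (t * c) (t * (1 - a - c - d)) (t * d))"
  let ?H = "\<lambda>t s a c d. ennreal (indicator {0<..} t * (indicator {0<..} s * 2 * levy_prod s a c (t - a - c - d) d))"
  have "?lhs = (\<integral>\<^sup>+a. \<integral>\<^sup>+c. \<integral>\<^sup>+d. \<integral>\<^sup>+t. \<integral>\<^sup>+s. ?G t s a c d \<partial>lborel \<partial>lborel \<partial>lborel \<partial>lborel \<partial>lborel)"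
    unfolding sep_kernel_powr_mixture ..
  also have "\<dots> = (\<integral>\<^sup>+t. \<integral>\<^sup>+a. \<integral>\<^sup>+c. \<integral>\<^sup>+d. \<integral>\<^sup>+s. ?G t s a c d \<partial>lborel \<partial>lborel \<partial>lborel \<partial>lborel \<partial>lborel)"
    by (rule nn_integral_lborel_swap3) measurable
  also have "\<dots> = (\<integral>\<^sup>+t. \<integral>\<^sup>+s. \<integral>\<^sup>+a. \<integral>\<^sup>+c. \<integral>\<^sup>+d. ?G t s a c d \<partial>lborel \<partial>lborel \<partial>lborel \<partial>lborel \<partial>lborel)"
    by (rule nn_integral_cong, rule nn_integral_lborel_swap3) measurable
  also have "\<dots> = (\<integral>\<^sup>+t. \<integral>\<^sup>+s. \<integral>\<^sup>+a. \<integral>\<^sup>+c. \<integral>\<^sup>+d. ?H t s a c d \<partial>lborel \<partial>lborel \<partial>lborel \<partial>lborel \<partial>lborel)"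
  proof (rule nn_integral_cong, rule nn_integral_cong)
    fix t s :: real
    show "(\<integral>\<^sup>+a. \<integral>\<^sup>+c. \<integral>\<^sup>+d. ?G t s a c d \<partial>lborel \<partial>lborel \<partial>lborel) =
       (\<integral>\<^sup>+a. \<integral>\<^sup>+c. \<integral>\<^sup>+d. ?H t s a c d \<partial>lborel \<partial>lborel \<partial>lborel)"
    proof (cases "0 < t \<and> 0 < s")
      case True
      then have "(\<integral>\<^sup>+a. \<integral>\<^sup>+c. \<integral>\<^sup>+d. ?G t s a c d \<partial>lborel \<partial>lborel \<partial>lborel) =
        2 * (\<integral>\<^sup>+a. \<integral>\<^sup>+c. \<integral>\<^sup>+d. ennreal (t ^ 3) * ennreal (levy_prod s (t * a) (t * c) (t * (1 - a - c - d)) (t * d)) \<partial>lborel \<partial>lborel \<partial>lborel)"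
        by (simp add: ennreal_mult' mult.assoc flip: nn_integral_cmult)
      also have "\<dots> = (\<integral>\<^sup>+a. \<integral>\<^sup>+c. \<integral>\<^sup>+d. ?H t s a c d \<partial>lborel \<partial>lborel \<partial>lborel)"
        using True unfolding nn_integral_levy_prod_scale[OF conjunct1[OF True]]
        by (simp add: ennreal_mult' mult.assoc flip: nn_integral_cmult)
      finally show ?thesis .
    qed auto
  qed
  also have "\<dots> = (\<integral>\<^sup>+s. \<integral>\<^sup>+t. \<integral>\<^sup>+a. \<integral>\<^sup>+c. \<integral>\<^sup>+d. ?H t s a c d \<partial>lborel \<partial>lborel \<partial>lborel \<partial>lborel \<partial>lborel)"
    by (rule lborel_pair.Fubini') measurable
  also have "\<dots> = (\<integral>\<^sup>+s. \<integral>\<^sup>+a. \<integral>\<^sup>+c. \<integral>\<^sup>+d. \<integral>\<^sup>+t. ?H t s a c d \<partial>lborel \<partial>lborel \<partial>lborel \<partial>lborel \<partial>lborel)"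
    by (rule nn_integral_cong, rule nn_integral_lborel_swap3[symmetric]) measurable
  also have "\<dots> = (\<integral>\<^sup>+s. \<integral>\<^sup>+a. \<integral>\<^sup>+c. \<integral>\<^sup>+d. \<integral>\<^sup>+b. ennreal (indicator {0<..} s * 2) * ennreal (levy_prod s a c b d) \<partial>lborel \<partial>lborel \<partial>lborel \<partial>lborel \<partial>lborel)"
  proof (rule nn_integral_cong, rule nn_integral_cong, rule nn_integral_cong, rule nn_integral_cong)
    fix s a c d :: real
    \<comment> \<open>For fixed a, c, d the radius is replaced by the fourth coordinate b = t - a -
      c - d.\<close>
    have "(\<integral>\<^sup>+t. ?H t s a c d \<partial>lborel) = (\<integral>\<^sup>+b. ?H ((a + c + d) + 1 * b) s a c d \<partial>lborel)"
      by (subst nn_integral_real_affine[of _ 1 "a + c + d"]) auto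
    also have "\<dots> = (\<integral>\<^sup>+b. ennreal (indicator {0<..} s * 2) * ennreal (levy_prod s a c b d) \<partial>lborel)"
    proof (intro nn_integral_cong)
      fix b :: real
      have "levy_prod s a c b d = 0" if "\<not> 0 < a + c + d + b"
        using that unfolding levy_prod_def by (cases "0 < a"; cases "0 < c"; cases "0 < d"; cases "0 < b") (auto simp: levy_eq_0)
      then show "?H ((a + c + d) + 1 * b) s a c d = ennreal (indicator {0<..} s * 2) * ennreal (levy_prod s a c b d)"
        by (auto simp: indicator_def ennreal_mult')
    qed
    finally show "(\<integral>\<^sup>+t. ?H t s a c d \<partial>lborel) = (\<integral>\<^sup>+b. ennreal (indicator {0<..} s * 2) * ennreal (levy_prod s a c b d) \<partial>lborel)" .
  qed
  also have "\<dots> = (\<integral>\<^sup>+s. ennreal (indicator {0<..} s * (2 * exp (- \<sigma> * s))) \<partial>lborel)"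
  proof (rule nn_integral_cong)
    fix s :: real
    have "(\<integral>\<^sup>+a. \<integral>\<^sup>+c. \<integral>\<^sup>+d. \<integral>\<^sup>+b. ennreal (levy_prod s a c b d) \<partial>lborel \<partial>lborel \<partial>lborel \<partial>lborel) = ennreal (exp (- \<sigma> * s))" if "0 < s"
      unfolding levy_prod_def using p q u that
      by (subst levy_laplace4) (auto simp: \<sigma>_def algebra_simps)
    then show "(\<integral>\<^sup>+a. \<integral>\<^sup>+c. \<integral>\<^sup>+d. \<integral>\<^sup>+b. ennreal (indicator {0<..} s * 2) * ennreal (levy_prod s a c b d) \<partial>lborel \<partial>lborel \<partial>lborel \<partial>lborel)
      = ennreal (indicator {0<..} s * (2 * exp (- \<sigma> * s)))"
      by (cases "0 < s") (auto simp: nn_integral_cmult ennreal_mult')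
  qed
  also have "\<dots> = ennreal (2 / \<sigma>)" by (rule nn_integral_exp_Ioi[OF \<sigma>])
  finally show ?thesis unfolding \<sigma>_def .
qed

end

text \<open>Unlike \<open>separable_density\<close>, which takes the junk value 0 where the integral diverges, this
  is an extended nonnegative integral; the two agree almost everywhere on the square.\<close>

definition sep_density :: "real \<Rightarrow> real \<Rightarrow> real \<Rightarrow> ennreal" where
  "sep_density p x y = (\<integral>\<^sup>+a. ennreal (sep_kernel p (1 - p) a (x - a) (1 - x - y + a) (y - a)) \<partial>lborel)"

lemma sep_kernel_nonneg: "0 \<le> sep_kernel p q a c b d"
  by (simp add: sep_kernel_def)

lemma sep_kernel_measurable [measurable]:
  assumes [measurable]: "f \<in> borel_measurable M" "g \<in> borel_measurable M" "h \<in> borel_measurable M"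
     "k \<in> borel_measurable M"
  shows "(\<lambda>w. sep_kernel p q (f w) (g w) (h w) (k w)) \<in> borel_measurable M"
  unfolding sep_kernel_def by measurable

lemma sep_density_measurable [measurable]: "(\<lambda>(x, y). sep_density p x y) \<in> borel_measurable borel"
proof -
  have "(\<lambda>(x, y). sep_density p x y) \<in> borel_measurable (borel \<Otimes>\<^sub>M borel)"
    unfolding sep_density_def by measurable
  then show ?thesis by (simp add: borel_prod)
qed

section \<open>The marginal density on the square\<close>

lemma nn_integral_lborel_pair:
  fixes f :: "real \<times> real \<Rightarrow> ennreal"
  assumes "f \<in> borel_measurable borel"
  shows "(\<integral>\<^sup>+z. f z \<partial>lborel) = (\<integral>\<^sup>+x. \<integral>\<^sup>+y. f (x, y) \<partial>lborel \<partial>lborel)"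
proof -
  have "f \<in> borel_measurable (lborel \<Otimes>\<^sub>M lborel)"
    using assms by (simp add: lborel_prod)
  from lborel.nn_integral_fst[OF this] show ?thesis
    by (simp add: lborel_prod)
qed

lemma nn_integral_lborel_shift:
  fixes f :: "real \<Rightarrow> ennreal"
  assumes "f \<in> borel_measurable borel"
  shows "(\<integral>\<^sup>+x. f x \<partial>lborel) = (\<integral>\<^sup>+x. f (a + x) \<partial>lborel)"
  using nn_integral_real_affine[OF assms, of 1 a] by simp

text \<open>With x = a + c, y = a + d and 1 = a + b + c + d, the expression 1 - (s x + t y) becomes
  a linear form with coefficients 1 - (s + t), 1 - s, 1, 1 - t at a, c, b, d. They are positive
  because s + t < 1; the isolated p in the result is p sqrt 1, coming from b.\<close>

lemma nn_integral_sep_density: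
  assumes p: "0 < p" "p < 1" and st: "0 \<le> s" "0 \<le> t" "s + t < 1"
  shows "(\<integral>\<^sup>+z. sep_density p (fst z) (snd z) * ennreal ((1 - (s * fst z + t * snd z)) powr (-1/2)) \<partial>lborel)
    = ennreal (2 / (p + p * sqrt (1 - (s + t)) + (1 - p) * sqrt (1 - s) + (1 - p) * sqrt (1 - t)))"
proof -
  let ?K = "\<lambda>a x y. ennreal (sep_kernel p (1 - p) a (x - a) (1 - x - y + a) (y - a))"
  let ?w = "\<lambda>x y. ennreal ((1 - (s * x + t * y)) powr (-1/2))"
  have "(\<lambda>z. sep_density p (fst z) (snd z) * ?w (fst z) (snd z)) \<in> borel_measurable (borel \<Otimes>\<^sub>M borel)"
    unfolding sep_density_def by measurable
  then have m: "(\<lambda>z. sep_density p (fst z) (snd z) * ?w (fst z) (snd z)) \<in> borel_measurable borel"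
    by (simp only: borel_prod)
  have "(\<integral>\<^sup>+z. sep_density p (fst z) (snd z) * ?w (fst z) (snd z) \<partial>lborel)
     = (\<integral>\<^sup>+x. \<integral>\<^sup>+y. sep_density p x y * ?w x y \<partial>lborel \<partial>lborel)"
    using nn_integral_lborel_pair[OF m] by simp
  also have "\<dots> = (\<integral>\<^sup>+x. \<integral>\<^sup>+y. \<integral>\<^sup>+a. ?K a x y * ?w x y \<partial>lborel \<partial>lborel \<partial>lborel)"
    unfolding sep_density_def by (simp add: nn_integral_multc)
  also have "\<dots> = (\<integral>\<^sup>+x. \<integral>\<^sup>+a. \<integral>\<^sup>+y. ?K a x y * ?w x y \<partial>lborel \<partial>lborel \<partial>lborel)"
    by (rule nn_integral_cong, rule lborel_pair.Fubini') measurable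
  also have "\<dots> = (\<integral>\<^sup>+a. \<integral>\<^sup>+x. \<integral>\<^sup>+y. ?K a x y * ?w x y \<partial>lborel \<partial>lborel \<partial>lborel)"
    by (rule lborel_pair.Fubini') measurable
  also have "\<dots> = (\<integral>\<^sup>+a. \<integral>\<^sup>+c. \<integral>\<^sup>+d. ?K a (a + c) (a + d) * ?w (a + c) (a + d) \<partial>lborel \<partial>lborel \<partial>lborel)"
  proof (rule nn_integral_cong)
    fix a :: real
    have "(\<integral>\<^sup>+x. \<integral>\<^sup>+y. ?K a x y * ?w x y \<partial>lborel \<partial>lborel) =
        (\<integral>\<^sup>+c. \<integral>\<^sup>+y. ?K a (a + c) y * ?w (a + c) y \<partial>lborel \<partial>lborel)"
      by (rule nn_integral_lborel_shift) measurable
    also have "\<dots> = (\<integral>\<^sup>+c. \<integral>\<^sup>+d. ?K a (a + c) (a + d) * ?w (a + c) (a + d) \<partial>lborel \<partial>lborel)"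
    proof (rule nn_integral_cong)
      fix c :: real
      show "(\<integral>\<^sup>+y. ?K a (a + c) y * ?w (a + c) y \<partial>lborel) =
         (\<integral>\<^sup>+d. ?K a (a + c) (a + d) * ?w (a + c) (a + d) \<partial>lborel)"
        by (rule nn_integral_lborel_shift) measurable
    qed
    finally show "(\<integral>\<^sup>+x. \<integral>\<^sup>+y. ?K a x y * ?w x y \<partial>lborel \<partial>lborel) =
      (\<integral>\<^sup>+c. \<integral>\<^sup>+d. ?K a (a + c) (a + d) * ?w (a + c) (a + d) \<partial>lborel \<partial>lborel)" .
  qed
  also have "\<dots> = (\<integral>\<^sup>+a. \<integral>\<^sup>+c. \<integral>\<^sup>+d. ennreal (sep_kernel p (1 - p) a c (1 - a - c - d) d) *
      ennreal (((1 - (s + t)) * a + (1 - s) * c + 1 * (1 - a - c - d) + (1 - t) * d) powr (-1/2)) \<partial>lborel \<partial>lborel \<partial>lborel)"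
    by (intro nn_integral_cong) (simp add: algebra_simps)
  also have "\<dots> = ennreal (2 / (p * sqrt (1 - (s + t)) + (1 - p) * sqrt (1 - s) + p * sqrt 1 + (1 - p) * sqrt (1 - t)))"
    using p st by (intro nn_integral_sep_kernel_simplex) auto
  finally show ?thesis by (simp add: algebra_simps)
qed

text \<open>At s = t = 0 all four roots are 1 and the denominator is 2 p + 2 (1 - p) = 2.\<close>

lemma nn_integral_sep_density_1:
  assumes "0 < p" "p < 1"
  shows "(\<integral>\<^sup>+z. sep_density p (fst z) (snd z) \<partial>lborel) = 1"
  using nn_integral_sep_density[OF assms, of 0 0] by simp

text \<open>Positivity of the four coordinates gives x = a + c > 0 and 1 - x = b + d > 0, and
  likewise for y.\<close>

lemma sep_density_outside:
  assumes "(x, y) \<notin> {0..1} \<times> {0..1}"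
  shows "sep_density p x y = 0"
proof -
  have "sep_kernel p (1 - p) a (x - a) (1 - x - y + a) (y - a) = 0" for a
    using assms by (auto simp: sep_kernel_def)
  then show ?thesis by (simp add: sep_density_def)
qed

lemma separable_density_eq_sep_density:
  assumes "sep_density p x y < \<top>"
  shows "ennreal (separable_density p x y) = sep_density p x y"
proof -
  let ?m = "max 0 (x + y - 1)" and ?M = "min x y"
  let ?k = "\<lambda>a. sep_kernel p (1 - p) a (x - a) (1 - x - y + a) (y - a)"
  have "separable_density p x y = (\<integral>a. ?k a \<partial>lborel)"
    unfolding separable_density_def set_lebesgue_integral_def
  proof (rule integral_cong_AE)
    show "AE a in lborel. indicat_real {?m..?M} a *\<^sub>R
        (3 * p\<^sup>2 * (1 - p)\<^sup>2 /
        (2 * pi * (a * (x - a) * (1 - x - y + a) * (y - a)) powr (3/2) *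
         (p\<^sup>2 / a + (1 - p)\<^sup>2 / (x - a) + p\<^sup>2 / (1 - x - y + a) + (1 - p)\<^sup>2 / (y - a))
           powr (5/2))) = ?k a"
      \<comment> \<open>Away from the two endpoints, the closed interval of integration is exactly
        the set where all four coordinates are positive.\<close>
      using AE_lborel_singleton[of ?m] AE_lborel_singleton[of ?M]
    proof eventually_elim
      case (elim a)
      have "a \<in> {?m..?M} \<longleftrightarrow> 0 < a \<and> 0 < x - a \<and> 0 < 1 - x - y + a \<and> 0 < y - a"
        using elim by (auto simp: max_def min_def split: if_splits)
      then show ?case by (auto simp: sep_kernel_def)
    qed
  qed measurable
  \<comment> \<open>This equality holds even if the integral diverges, both sides being 0;
    finiteness is needed to return from \<open>enn2real\<close> to the extended integral.\<close>
  also have "\<dots> = enn2real (sep_density p x y)"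
    unfolding sep_density_def by (rule integral_eq_nn_integral) (auto simp: sep_kernel_nonneg)
  finally show ?thesis using assms by simp
qed

lemma separable_density_measurable:
  "(\<lambda>(x, y). separable_density p x y) \<in> borel_measurable borel"
proof -
  have "(\<lambda>(x, y). separable_density p x y) \<in> borel_measurable (borel \<Otimes>\<^sub>M borel)"
    unfolding separable_density_def set_lebesgue_integral_def indicator_def atLeastAtMost_iff
    by measurable
  then show ?thesis by (simp add: borel_prod)
qed

text \<open>Since \<open>sep_density p\<close> has total mass 1, it is finite almost everywhere, so
  that \<open>separable_density_eq_sep_density\<close> applies at almost every point of the square;
  off the square both densities vanish.\<close>

lemma density_separable_density:
  assumes p: "0 < p" "p < 1"
  shows "density lborel (\<lambda>(x, y). ennreal (separable_density p x y) * indicator ({0..1} \<times> {0..1}) (x, y)) =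
    density lborel (\<lambda>(x, y). sep_density p x y)"
proof (rule density_cong)
  have [measurable]: "{0..1::real} \<times> {0..1::real} \<in> sets borel"
    by (intro borel_closed closed_Times) auto
  note separable_density_measurable[of p, measurable]
  have "(\<lambda>z. ennreal (case z of (x, y) \<Rightarrow> separable_density p x y) * indicator ({0..1} \<times> {0..1}) z) \<in> borel_measurable borel"
    by measurable
  then show "(\<lambda>(x, y). ennreal (separable_density p x y) * indicator ({0..1} \<times> {0..1}) (x, y)) \<in> borel_measurable lborel"
    by (simp add: case_prod_beta')
  show "(\<lambda>(x, y). sep_density p x y) \<in> borel_measurable lborel"
    by simp
  have "AE z in lborel. (case z of (x, y) \<Rightarrow> sep_density p x y) \<noteq> \<infinity>"
    using nn_integral_sep_density_1[OF p] sep_density_measurable[of p]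
    by (intro nn_integral_PInf_AE) (simp_all add: case_prod_beta')
  then show "AE z in lborel. (case z of (x, y) \<Rightarrow> ennreal (separable_density p x y) * indicator ({0..1} \<times> {0..1}) (x, y)) =
      (case z of (x, y) \<Rightarrow> sep_density p x y)"
  proof eventually_elim
    case (elim z)
    obtain x y where z: "z = (x, y)" by (cases z)
    show ?case
      using elim separable_density_eq_sep_density[of p x y] sep_density_outside[of x y p]
      unfolding z by (cases "(x, y) \<in> {0..1} \<times> {0..1}") (auto simp: less_top)
  qed
qed

section \<open>Counting binary trees\<close>

text \<open>The formal power series of (1 - 4 z) powr a.\<close>

definition binomial_series :: "real \<Rightarrow> real fps" where
  "binomial_series a = fps_binomial a oo (fps_const (-4) * fps_X)"

lemma binomial_series_nth: "fps_nth (binomial_series a) n = (a gchoose n) * (-4) ^ n"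
  by (simp add: binomial_series_def fps_compose_linear)

lemma binomial_series_add: "binomial_series (a + b) = binomial_series a * binomial_series b"
  unfolding binomial_series_def fps_binomial_add_mult by (rule fps_compose_mult_distrib) simp

lemma binomial_series_half_square:
  "binomial_series (1/2) * binomial_series (1/2) = 1 - 4 * fps_X"
proof -
  have "binomial_series (1/2) * binomial_series (1/2) = binomial_series 1"
    by (simp flip: binomial_series_add)
  also have "\<dots> = 1 - 4 * fps_X"
    unfolding binomial_series_def fps_binomial_1 fps_compose_linear
    by (rule fps_ext) (auto simp: numeral_fps_const le_Suc_eq)
  finally show ?thesis .
qed

lemma binomial_series_half_inverse:
  "binomial_series (-1/2) * binomial_series (1/2) = 1"
proof -
  have "binomial_series (-1/2) * binomial_series (1/2) = binomial_series 0"
    by (simp flip: binomial_series_add)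
  also have "\<dots> = 1" by (simp add: binomial_series_def)
  finally show ?thesis .
qed

text \<open>The Catalan series shifted by one, so that the index will count leaves rather than
  internal nodes.\<close>

definition catalan_series :: "real fps" where
  "catalan_series = fps_const (1/2) * (1 - binomial_series (1/2))"

lemma two_catalan_series: "2 * catalan_series = 1 - binomial_series (1/2)"
proof -
  have "2 * fps_const (1/2) = (1 :: real fps)" by (simp add: numeral_fps_const)
  then show ?thesis unfolding catalan_series_def mult.assoc[symmetric] by simp
qed

text \<open>From (1 - 2 C)^2 = 1 - 4 z. In the form C = z + C^2 it says that a binary tree is a leaf
  or a pair of binary trees.\<close>

lemma catalan_series_square: "catalan_series * catalan_series = catalan_series - fps_X"
proof -
  have R: "binomial_series (1/2) = 1 - 2 * catalan_series"
    by (simp add: two_catalan_series)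
  have "(1 - 2 * catalan_series) * (1 - 2 * catalan_series) = 1 - 4 * fps_X"
    using binomial_series_half_square unfolding R .
  then have "4 * (catalan_series * catalan_series) = 4 * (catalan_series - fps_X)"
    by (simp add: algebra_simps)
  then show ?thesis by (subst (asm) mult_cancel_left) simp
qed

lemma catalan_series_deriv: "fps_deriv catalan_series = binomial_series (-1/2)"
proof -
  let ?R = "binomial_series (1/2)" and ?B = "binomial_series (-1/2)"
  have "fps_deriv (?R * ?R) = - 4"
    unfolding binomial_series_half_square by simp
  then have "2 * (?R * fps_deriv ?R) = - 4" by (simp add: mult.commute)
  then have "(?R * fps_deriv ?R) = - 2"
    by (metis mult_cancel_left mult_minus_right mult_2 numeral_Bit0 zero_neq_numeral)
  then have "(?B * ?R) * fps_deriv ?R = - 2 * ?B"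
    by (simp only: mult.assoc) simp
  then have "fps_deriv ?R = - 2 * ?B"
    by (simp only: binomial_series_half_inverse mult_1)
  moreover have "fps_deriv (2 * catalan_series) = - fps_deriv ?R"
    unfolding two_catalan_series by simp
  ultimately have "2 * fps_deriv catalan_series = 2 * ?B" by simp
  then show ?thesis by simp
qed

text \<open>The factor \<open>Suc n\<close> will come from the choice of the marked sample point;
  this is where the exponent -1/2 enters on the tree side.\<close>

lemma catalan_series_nth_Suc:
  "real (Suc n) * fps_nth catalan_series (Suc n) = fps_nth (binomial_series (-1/2)) n"
  unfolding catalan_series_deriv[symmetric] by (simp add: fps_deriv_nth)

lemma catalan_series_0 [simp]: "fps_nth catalan_series 0 = 0"
  by (simp add: catalan_series_def binomial_series_nth)

lemma catalan_series_1 [simp]: "fps_nth catalan_series (Suc 0) = 1"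
  by (simp add: catalan_series_def binomial_series_nth)

lemma fps_mult_nth_no_constant:
  fixes f g :: "real fps"
  assumes "fps_nth f 0 = 0" "fps_nth g 0 = 0"
  shows "fps_nth (f * g) n = (\<Sum>m\<in>{1..<n}. fps_nth f m * fps_nth g (n - m))"
  unfolding fps_mult_nth
  by (rule sum.mono_neutral_right) (use assms in \<open>auto simp: not_less_eq_eq Suc_le_eq\<close>)

lemma catalan_series_rec:
  assumes "2 \<le> n"
  shows "fps_nth catalan_series n =
    (\<Sum>m\<in>{1..<n}. fps_nth catalan_series m * fps_nth catalan_series (n - m))"
proof -
  have "fps_nth (catalan_series * catalan_series) n = fps_nth (catalan_series - fps_X) n"
    by (simp only: catalan_series_square)
  also have "\<dots> = fps_nth catalan_series n" using assms by (simp add: fps_X_def)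
  finally show ?thesis by (simp add: fps_mult_nth_no_constant)
qed

text \<open>Unlike \<open>plane_binary_trees\<close>, this allows arbitrary labels, so that
  subtrees, whose labels form a prefix or a suffix, are covered too.\<close>

definition binary_trees :: "nat list \<Rightarrow> unit ptree set" where
  "binary_trees ls = {t. binary t \<and> leaves t = ls}"

lemma binary_induct [consumes 1, case_names Leaf Node]:
  assumes "binary t"
    and "\<And>l. P (Leaf l)"
    and "\<And>u l r. binary l \<Longrightarrow> binary r \<Longrightarrow> P l \<Longrightarrow> P r \<Longrightarrow> P (Node u [l, r])"
  shows "P t"
  using assms(1)
proof (induction t)
  case (Leaf l)
  show ?case by (rule assms(2))
next
  case (Node u ts)
  then obtain l r where "ts = [l, r]" by (auto simp: length_Suc_conv numeral_2_eq_2)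
  then show ?case using Node by (auto intro: assms(3))
qed

lemma leaves_nonempty: "binary t \<Longrightarrow> leaves t \<noteq> []"
  by (induction t rule: binary_induct) auto

lemma finite_binary_trees: "finite (binary_trees ls)"
  unfolding binary_trees_def by (rule finite_binary_leaves)

lemma binary_trees_singleton: "binary_trees [x] = {Leaf x}"
proof -
  have "t = Leaf x" if "binary t" "leaves t = [x]" for t :: "unit ptree"
    using that
  proof (induction t rule: binary_induct)
    case (Node u l r)
    then show ?case
      using leaves_nonempty[of l] leaves_nonempty[of r]
      by (cases "leaves l"; cases "leaves r") auto
  qed simp
  then show ?thesis by (auto simp: binary_trees_def)
qed

lemma binary_trees_split:
  assumes "2 \<le> length ls"
  shows "binary_trees ls = (\<Union>n\<in>{1..<length ls}.
    (\<lambda>(l, r). Node () [l, r]) ` (binary_trees (take n ls) \<times> binary_trees (drop n ls)))"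
proof (intro equalityI subsetI)
  fix t assume t: "t \<in> binary_trees ls"
  show "t \<in> (\<Union>n\<in>{1..<length ls}.
    (\<lambda>(l, r). Node () [l, r]) ` (binary_trees (take n ls) \<times> binary_trees (drop n ls)))"
  proof (cases t)
    case (Leaf l)
    then show ?thesis using t assms by (auto simp: binary_trees_def)
  next
    case (Node u ts)
    then obtain l r where lr: "t = Node () [l, r]" "binary l" "binary r"
      using t by (auto simp: binary_trees_def length_Suc_conv numeral_2_eq_2)
    then have "ls = leaves l @ leaves r" using t by (auto simp: binary_trees_def)
    moreover have "leaves l \<noteq> []" "leaves r \<noteq> []" 
      using leaves_nonempty[OF lr(2)] leaves_nonempty[OF lr(3)] by simp_all
    ultimately show ?thesis using lr
      by (intro UN_I[of "length (leaves l)"] image_eqI[of _ _ "(l, r)"])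
         (auto simp: binary_trees_def Suc_le_eq)
  qed
qed (auto simp: binary_trees_def)

lemma sum_binary_trees:
  fixes f :: "unit ptree \<Rightarrow> 'a::comm_monoid_add"
  assumes "2 \<le> length ls"
  shows "(\<Sum>t\<in>binary_trees ls. f t) = (\<Sum>n\<in>{1..<length ls}.
    \<Sum>l\<in>binary_trees (take n ls). \<Sum>r\<in>binary_trees (drop n ls). f (Node () [l, r]))"
proof -
  let ?A = "\<lambda>n. (\<lambda>(l, r). Node () [l, r]) ` (binary_trees (take n ls) \<times> binary_trees (drop n ls))"
  have "(\<Sum>t\<in>binary_trees ls. f t) = (\<Sum>n\<in>{1..<length ls}. \<Sum>t\<in>?A n. f t)"
    unfolding binary_trees_split[OF assms]
  proof (rule sum.UNION_disjoint)
    show "\<forall>i\<in>{1..<length ls}. \<forall>j\<in>{1..<length ls}. i \<noteq> j \<longrightarrow> ?A i \<inter> ?A j = {}"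
    proof (intro ballI impI)
      fix i j assume ij: "i \<in> {1..<length ls}" "j \<in> {1..<length ls}" "i \<noteq> j"
      have "take i ls \<noteq> take j ls"
        using ij by (metis atLeastLessThan_iff length_take min.absorb2 min.commute less_imp_le)
      then show "?A i \<inter> ?A j = {}" by (auto simp: binary_trees_def)
    qed
  qed (auto intro: finite_binary_trees)
  also have "\<dots> = (\<Sum>n\<in>{1..<length ls}.
    \<Sum>(l, r)\<in>binary_trees (take n ls) \<times> binary_trees (drop n ls). f (Node () [l, r]))"
    by (intro sum.cong refl, subst sum.reindex) (auto simp: inj_on_def case_prod_beta')
  also have "\<dots> = (\<Sum>n\<in>{1..<length ls}.
    \<Sum>l\<in>binary_trees (take n ls). \<Sum>r\<in>binary_trees (drop n ls). f (Node () [l, r]))"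
    by (simp add: sum.cartesian_product)
  finally show ?thesis .
qed

lemma card_binary_trees: "real (card (binary_trees ls)) = fps_nth catalan_series (length ls)"
proof (induction "length ls" arbitrary: ls rule: less_induct)
  case less
  consider "ls = []" | x where "ls = [x]" | "2 \<le> length ls"
    by (cases ls; cases "tl ls") auto
  then show ?case
  proof cases
    case 1
    have "binary_trees [] = {}" using leaves_nonempty by (auto simp: binary_trees_def)
    then show ?thesis using 1 by simp
  next
    case 2
    then show ?thesis by (simp add: binary_trees_singleton)
  next
    case 3
    have "real (card (binary_trees ls)) = (\<Sum>t\<in>binary_trees ls. 1)" by simp
    also have "\<dots> = (\<Sum>n\<in>{1..<length ls}.
        real (card (binary_trees (take n ls))) * real (card (binary_trees (drop n ls))))"
      unfolding sum_binary_trees[OF 3] by simp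
    also have "\<dots> = (\<Sum>n\<in>{1..<length ls}.
        fps_nth catalan_series n * fps_nth catalan_series (length ls - n))"
    proof (intro sum.cong refl)
      fix n assume n: "n \<in> {1..<length ls}"
      then have "length ls - n < length ls" by auto
      then show "real (card (binary_trees (take n ls))) * real (card (binary_trees (drop n ls))) =
          fps_nth catalan_series n * fps_nth catalan_series (length ls - n)"
        using less[of "take n ls"] less[of "drop n ls"] n by simp
    qed
    also have "\<dots> = fps_nth catalan_series (length ls)" using catalan_series_rec[OF 3] ..
    finally show ?thesis .
  qed
qed

text \<open>The coefficients are defined through generalized binomials of varying sign; counting
  trees settles the sign.\<close>

lemma catalan_series_nonneg: "0 \<le> fps_nth catalan_series n"
  using card_binary_trees[of "replicate n 0"] by (metis length_replicate of_nat_0_le_iff)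

section \<open>The spine decomposition of signed trees\<close>

definition position :: "'a list \<Rightarrow> 'a \<Rightarrow> nat" where
  "position xs i = length (takeWhile (\<lambda>l. l \<noteq> i) xs)"

lemma position_less: "i \<in> set xs \<Longrightarrow> position xs i < length xs"
  unfolding position_def by (induction xs) auto

lemma position_append1: "i \<in> set xs \<Longrightarrow> position (xs @ ys) i = position xs i"
  unfolding position_def by (subst takeWhile_append1) auto

lemma position_append2: "i \<notin> set xs \<Longrightarrow> position (xs @ ys) i = length xs + position ys i"
  unfolding position_def by (subst takeWhile_append2) auto

text \<open>The statistic of the overview for two linear orders given as lists: xs for the
  horizontal and ys for the vertical coordinate. Lists, rather than a permutation, make sense for
  subtrees with arbitrary labels.\<close>

definition order_weight :: "real \<Rightarrow> real \<Rightarrow> 'a list \<Rightarrow> 'a list \<Rightarrow> real" where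
  "order_weight s t xs ys = (\<Sum>i\<in>set xs. \<Prod>j\<in>set xs - {i}.
     s * of_bool (position xs j < position xs i) + t * of_bool (position ys j < position ys i))"

lemma order_weight_nonneg: "0 \<le> s \<Longrightarrow> 0 \<le> t \<Longrightarrow> 0 \<le> order_weight s t xs ys"
  unfolding order_weight_def by (intro sum_nonneg prod_nonneg) auto

text \<open>Models a node whose two blocks of leaves do not interleave in either order: the factor
  that a leaf of one block contributes to a marked leaf of the other is then constant.\<close>

lemma sum_prod_Un_disjoint:
  fixes f g h :: "'a \<Rightarrow> 'a \<Rightarrow> real"
  assumes fin: "finite A" "finite B" and disj: "A \<inter> B = {}"
    and AA: "\<And>i j. i \<in> A \<Longrightarrow> j \<in> A \<Longrightarrow> f j i = g j i"
    and BB: "\<And>i j. i \<in> B \<Longrightarrow> j \<in> B \<Longrightarrow> f j i = h j i"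
    and AB: "\<And>i j. i \<in> A \<Longrightarrow> j \<in> B \<Longrightarrow> f j i = u"
    and BA: "\<And>i j. i \<in> B \<Longrightarrow> j \<in> A \<Longrightarrow> f j i = v"
  shows "(\<Sum>i\<in>A \<union> B. \<Prod>j\<in>A \<union> B - {i}. f j i) =
    (\<Sum>i\<in>A. \<Prod>j\<in>A - {i}. g j i) * u ^ card B + (\<Sum>i\<in>B. \<Prod>j\<in>B - {i}. h j i) * v ^ card A"
proof -
  have 1: "(\<Prod>j\<in>A \<union> B - {i}. f j i) = (\<Prod>j\<in>A - {i}. g j i) * u ^ card B" if i: "i \<in> A" for i
  proof -
    have "A \<union> B - {i} = (A - {i}) \<union> B" using i disj by auto
    then have "(\<Prod>j\<in>A \<union> B - {i}. f j i) = (\<Prod>j\<in>A - {i}. f j i) * (\<Prod>j\<in>B. f j i)"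
      using fin disj by (simp only:) (rule prod.union_disjoint; auto)
    also have "\<dots> = (\<Prod>j\<in>A - {i}. g j i) * (\<Prod>j\<in>B. u)"
      using i AA AB by (intro arg_cong2[where f = times] prod.cong) auto
    finally show ?thesis by simp
  qed
  have 2: "(\<Prod>j\<in>A \<union> B - {i}. f j i) = (\<Prod>j\<in>B - {i}. h j i) * v ^ card A" if i: "i \<in> B" for i
  proof -
    have "A \<union> B - {i} = (B - {i}) \<union> A" using i disj by auto
    then have "(\<Prod>j\<in>A \<union> B - {i}. f j i) = (\<Prod>j\<in>B - {i}. f j i) * (\<Prod>j\<in>A. f j i)"
      using fin disj by (simp only:) (rule prod.union_disjoint; auto)
    also have "\<dots> = (\<Prod>j\<in>B - {i}. h j i) * (\<Prod>j\<in>A. v)"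
      using i BB BA by (intro arg_cong2[where f = times] prod.cong) auto
    finally show ?thesis by simp
  qed
  have "(\<Sum>i\<in>A \<union> B. \<Prod>j\<in>A \<union> B - {i}. f j i) =
      (\<Sum>i\<in>A. \<Prod>j\<in>A \<union> B - {i}. f j i) + (\<Sum>i\<in>B. \<Prod>j\<in>A \<union> B - {i}. f j i)"
    by (rule sum.union_disjoint[OF fin disj])
  also have "\<dots> = (\<Sum>i\<in>A. (\<Prod>j\<in>A - {i}. g j i) * u ^ card B) + (\<Sum>i\<in>B. (\<Prod>j\<in>B - {i}. h j i) * v ^ card A)"
    using 1 2 by (intro arg_cong2[where f = plus] sum.cong) auto
  finally show ?thesis by (simp add: sum_distrib_right)
qed

text \<open>The two cases are \<oplus> and \<ominus>. A marked leaf on the right sees each left leaf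
  before it in both orders (factor s + t) or only in the first (factor s). A marked leaf on the left
  sees each right leaf before it in neither order (factor 0) or only in the second (factor
  t).\<close>

lemma order_weight_append:
  assumes dist: "distinct (xs @ xs')" and sets: "set ys = set xs" "set ys' = set xs'"
  shows "order_weight s t (xs @ xs') (ys @ ys') =
      order_weight s t xs ys * 0 ^ length xs' + order_weight s t xs' ys' * (s + t) ^ length xs"
    and "order_weight s t (xs @ xs') (ys' @ ys) =
      order_weight s t xs ys * t ^ length xs' + order_weight s t xs' ys' * s ^ length xs"
proof -
  let ?A = "set xs" and ?B = "set xs'"
  have disj: "?A \<inter> ?B = {}" and card: "card ?A = length xs" "card ?B = length xs'"
    using dist by (auto simp: distinct_card)
  have xA: "position (xs @ xs') i = position xs i" "position xs i < length xs"
    "position (ys @ ys') i = position ys i" "position ys i < length ys"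
    "position (ys' @ ys) i = length ys' + position ys i" if "i \<in> ?A" for i
    using that disj sets by (auto simp: position_append1 position_append2 position_less)
  have xB: "position (xs @ xs') i = length xs + position xs' i"
    "position (ys' @ ys) i = position ys' i" "position ys' i < length ys'"
    "position (ys @ ys') i = length ys + position ys' i" if "i \<in> ?B" for i
    using that disj sets by (auto simp: position_append1 position_append2 position_less)
  have ne: "\<not> length xs + a < position xs i" "position xs i < length xs + a"
    "\<not> length ys + a < position ys i" "position ys i < length ys + a" if "i \<in> ?A" for i a
    using xA(2,4)[OF that] by auto
  have ne': "\<not> length ys' + a < position ys' i" "position ys' i < length ys' + a" if "i \<in> ?B" for i a
    using xB(3)[OF that] by auto
  show "order_weight s t (xs @ xs') (ys @ ys') =
      order_weight s t xs ys * 0 ^ length xs' + order_weight s t xs' ys' * (s + t) ^ length xs"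
    unfolding order_weight_def set_append card[symmetric]
    by (rule sum_prod_Un_disjoint[OF _ _ disj]) (auto simp: xA(1,3,5) xB(1,2,4) ne ne')
  show "order_weight s t (xs @ xs') (ys' @ ys) =
      order_weight s t xs ys * t ^ length xs' + order_weight s t xs' ys' * s ^ length xs"
    unfolding order_weight_def set_append card[symmetric]
    by (rule sum_prod_Un_disjoint[OF _ _ disj]) (auto simp: xA(1,3,5) xB(1,2,4) ne ne')
qed

lemma set_leaves_reverse_minus: "set (leaves (reverse_minus t)) = set (leaves t)"
proof (induction t)
  case (Node s ts)
  then show ?case by (cases s) auto
qed simp

definition tree_weight :: "real \<Rightarrow> real \<Rightarrow> sign ptree \<Rightarrow> real" where
  "tree_weight s t \<tau> = order_weight s t (leaves \<tau>) (leaves (reverse_minus \<tau>))"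

lemma tree_weight_nonneg: "0 \<le> s \<Longrightarrow> 0 \<le> t \<Longrightarrow> 0 \<le> tree_weight s t \<tau>"
  unfolding tree_weight_def by (rule order_weight_nonneg)

lemma tree_weight_Node:
  assumes "distinct (leaves l @ leaves r)"
  shows "tree_weight s t (Node Plus [l, r]) = tree_weight s t l * 0 ^ length (leaves r)
      + tree_weight s t r * (s + t) ^ length (leaves l)"
    and "tree_weight s t (Node Minus [l, r]) = tree_weight s t l * t ^ length (leaves r)
      + tree_weight s t r * s ^ length (leaves l)"
  unfolding tree_weight_def
  using order_weight_append[OF assms set_leaves_reverse_minus set_leaves_reverse_minus] by simp_all

lemma iid_signs_Node2:
  "iid_signs p (Node u [l, r]) = bind_pmf (sign_pmf p) (\<lambda>\<epsilon>. bind_pmf (iid_signs p l)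
     (\<lambda>l'. bind_pmf (iid_signs p r) (\<lambda>r'. return_pmf (Node \<epsilon> [l', r']))))"
  by (simp add: bind_assoc_pmf bind_return_pmf)

lemma leaves_iid_signs:
  assumes "binary t" "\<tau> \<in> set_pmf (iid_signs p t)"
  shows "leaves \<tau> = leaves t"
  using assms
proof (induction t arbitrary: \<tau> rule: binary_induct)
  case (Node u l r)
  then show ?case unfolding iid_signs_Node2 by (fastforce simp: set_bind_pmf)
qed simp

definition expected_tree_weight :: "real \<Rightarrow> real \<Rightarrow> real \<Rightarrow> 'a ptree \<Rightarrow> ennreal" where
  "expected_tree_weight p s t T = (\<integral>\<^sup>+\<tau>. ennreal (tree_weight s t \<tau>) \<partial>measure_pmf (iid_signs p T))"

lemma nn_integral_sign_pmf:
  assumes "0 \<le> p" "p \<le> 1"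
  shows "(\<integral>\<^sup>+\<epsilon>. f \<epsilon> \<partial>measure_pmf (sign_pmf p)) = ennreal p * f Plus + ennreal (1 - p) * f Minus"
  using assms by (simp add: sign_pmf_def mult.commute)

text \<open>The weight of a node is linear in the weights of its children, with coefficients
  depending only on the numbers of leaves, so the independent signs of the two subtrees are averaged
  separately.\<close>

lemma expected_tree_weight_Node:
  assumes p: "0 \<le> p" "p \<le> 1" and st: "0 \<le> s" "0 \<le> t"
    and bin: "binary l" "binary r" and dist: "distinct (leaves l @ leaves r)"
  shows "expected_tree_weight p s t (Node u [l, r]) =
    expected_tree_weight p s t r * ennreal (p * (s + t) ^ length (leaves l) + (1 - p) * s ^ length (leaves l))
    + expected_tree_weight p s t l * ennreal ((1 - p) * t ^ length (leaves r))"
proof -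
  let ?E = "expected_tree_weight p s t"
  have *: "(\<integral>\<^sup>+l'. \<integral>\<^sup>+r'. ennreal (tree_weight s t (Node \<epsilon> [l', r'])) \<partial>measure_pmf (iid_signs p r) \<partial>measure_pmf (iid_signs p l))
     = ?E l * ennreal a + ?E r * ennreal b"
    if \<epsilon>: "\<And>l' r'. leaves l' = leaves l \<Longrightarrow> leaves r' = leaves r \<Longrightarrow>
         tree_weight s t (Node \<epsilon> [l', r']) = tree_weight s t l' * a + tree_weight s t r' * b"
      and ab: "0 \<le> a" "0 \<le> b" for \<epsilon> a b
  proof -
    have "(\<integral>\<^sup>+l'. \<integral>\<^sup>+r'. ennreal (tree_weight s t (Node \<epsilon> [l', r'])) \<partial>measure_pmf (iid_signs p r) \<partial>measure_pmf (iid_signs p l))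
      = (\<integral>\<^sup>+l'. \<integral>\<^sup>+r'. (ennreal (tree_weight s t l') * ennreal a + ennreal (tree_weight s t r') * ennreal b)
          \<partial>measure_pmf (iid_signs p r) \<partial>measure_pmf (iid_signs p l))"
      using ab by (intro nn_integral_cong_AE AE_pmfI)
        (simp add: \<epsilon> leaves_iid_signs bin tree_weight_nonneg st ennreal_mult)
    also have "\<dots> = ?E l * ennreal a + ?E r * ennreal b"
      by (simp add: nn_integral_add nn_integral_multc expected_tree_weight_def)
    finally show ?thesis .
  qed
  \<comment> \<open>The right subtree has at least one leaf, so \<open>0 ^ length (leaves r)\<close>
    is 0 and the term of the left subtree disappears.\<close>
  have plus: "(\<integral>\<^sup>+l'. \<integral>\<^sup>+r'. ennreal (tree_weight s t (Node Plus [l', r'])) \<partial>measure_pmf (iid_signs p r) \<partial>measure_pmf (iid_signs p l))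
     = ?E l * ennreal 0 + ?E r * ennreal ((s + t) ^ length (leaves l))"
    by (rule *) (use st dist leaves_nonempty[OF bin(2)] in \<open>simp_all add: tree_weight_Node\<close>)
  have minus: "(\<integral>\<^sup>+l'. \<integral>\<^sup>+r'. ennreal (tree_weight s t (Node Minus [l', r'])) \<partial>measure_pmf (iid_signs p r) \<partial>measure_pmf (iid_signs p l))
     = ?E l * ennreal (t ^ length (leaves r)) + ?E r * ennreal (s ^ length (leaves l))"
    by (rule *) (use st dist in \<open>simp_all add: tree_weight_Node\<close>)
  have "?E (Node u [l, r]) =
     ennreal p * (?E l * ennreal 0 + ?E r * ennreal ((s + t) ^ length (leaves l))) +
     ennreal (1 - p) * (?E l * ennreal (t ^ length (leaves r)) + ?E r * ennreal (s ^ length (leaves l)))"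
    unfolding plus[symmetric] minus[symmetric]
    by (subst expected_tree_weight_def, subst iid_signs_Node2) (simp add: nn_integral_sign_pmf p)
  then show ?thesis
    using p st by (simp add: ennreal_mult distrib_left distrib_right mult_ac add_ac)
qed

section \<open>The generating function of trees with a marked leaf\<close>

definition dilate :: "real \<Rightarrow> real fps \<Rightarrow> real fps" where
  "dilate c f = Abs_fps (\<lambda>n. c ^ n * fps_nth f n)"

text \<open>Counts one step of the path from the root to the marked leaf: a right step at a \<open>\<oplus>\<close> node puts a
  subtree of weight \<open>s + t\<close> per leaf off the path, steps at a \<open>\<ominus>\<close> node put \<open>s\<close> or \<open>t\<close> per leaf, and
  a left step at a \<open>\<oplus>\<close> node contributes nothing.\<close>

definition spine_series :: "real \<Rightarrow> real \<Rightarrow> real \<Rightarrow> real fps" where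
  "spine_series p s t = fps_const p * dilate (s + t) catalan_series
     + fps_const (1 - p) * dilate s catalan_series + fps_const (1 - p) * dilate t catalan_series"

text \<open>A geometric series over the number of steps of the path, with \<open>fps_X\<close> for
  the marked leaf at its end.\<close>

definition marked_series :: "real \<Rightarrow> real \<Rightarrow> real \<Rightarrow> real fps" where
  "marked_series p s t = fps_X * inverse (1 - spine_series p s t)"

lemma spine_series_nth: "fps_nth (spine_series p s t) n =
   fps_nth catalan_series n * (p * (s + t) ^ n + (1 - p) * s ^ n + (1 - p) * t ^ n)"
  by (simp add: spine_series_def dilate_def algebra_simps)

lemma marked_series_eq: "marked_series p s t = fps_X + spine_series p s t * marked_series p s t"
proof -
  have "inverse (1 - spine_series p s t) * (1 - spine_series p s t) = 1"
    by (rule inverse_mult_eq_1) (simp add: spine_series_nth)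
  then have "marked_series p s t * (1 - spine_series p s t) = fps_X"
    by (simp only: marked_series_def mult.assoc) simp
  then show ?thesis by (simp add: algebra_simps)
qed

lemma marked_series_0 [simp]: "fps_nth (marked_series p s t) 0 = 0"
  by (simp add: marked_series_def)

lemma marked_series_1 [simp]: "fps_nth (marked_series p s t) (Suc 0) = 1"
  by (subst marked_series_eq) (simp add: fps_mult_nth_no_constant spine_series_nth)

lemma marked_series_rec:
  assumes "2 \<le> n"
  shows "fps_nth (marked_series p s t) n =
    (\<Sum>m\<in>{1..<n}. fps_nth (spine_series p s t) m * fps_nth (marked_series p s t) (n - m))"
  using assms by (subst marked_series_eq) (simp add: fps_mult_nth_no_constant spine_series_nth)

lemma marked_series_nonneg:
  assumes "0 \<le> p" "p \<le> 1" "0 \<le> s" "0 \<le> t"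
  shows "0 \<le> fps_nth (marked_series p s t) n"
proof (induction n rule: less_induct)
  case (less n)
  consider "n = 0" | "n = Suc 0" | "2 \<le> n" by linarith
  then show ?case
  proof cases
    case 3
    show ?thesis unfolding marked_series_rec[OF 3] using assms less
      by (intro sum_nonneg mult_nonneg_nonneg)
        (auto simp: spine_series_nth catalan_series_nonneg)
  qed simp_all
qed

text \<open>Induction on the root split: the child without the marked leaf enters only through its
  number of leaves, hence through a Catalan number, and the other child is covered by the induction
  hypothesis.\<close>

lemma sum_expected_tree_weight:
  assumes p: "0 \<le> p" "p \<le> 1" and st: "0 \<le> s" "0 \<le> t" and "distinct ls"
  shows "(\<Sum>T\<in>binary_trees ls. expected_tree_weight p s t T) =
    ennreal (fps_nth (marked_series p s t) (length ls))"
  using assms(5)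
proof (induction "length ls" arbitrary: ls rule: less_induct)
  case less
  let ?E = "expected_tree_weight p s t" and ?H = "fps_nth (marked_series p s t)" and ?C = "fps_nth catalan_series"
  note [simp] = marked_series_nonneg[OF p st] catalan_series_nonneg
  consider "ls = []" | x where "ls = [x]" | "2 \<le> length ls"
    by (cases ls; cases "tl ls") auto
  then show ?case
  proof cases
    case 1
    have "binary_trees [] = {}" using leaves_nonempty by (auto simp: binary_trees_def)
    then show ?thesis using 1 by simp
  next
    case 2
    then show ?thesis
      by (simp add: binary_trees_singleton expected_tree_weight_def tree_weight_def order_weight_def)
  next
    case 3
    let ?k = "length ls"
    let ?a = "\<lambda>n. p * (s + t) ^ n + (1 - p) * s ^ n" and ?b = "\<lambda>n. (1 - p) * t ^ n"
    have ab: "0 \<le> ?a n" "0 \<le> ?b n" for n using p st by auto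
    have prod_sum: "ennreal c * (ennreal h * ennreal a) + ennreal c' * (ennreal h' * ennreal b) =
        ennreal (c * a * h + c' * b * h')"
      if "0 \<le> c" "0 \<le> h" "0 \<le> a" "0 \<le> c'" "0 \<le> h'" "0 \<le> b" for c h a c' h' b
      using that by (simp add: ennreal_mult mult_ac)
    have "(\<Sum>T\<in>binary_trees ls. ?E T) = (\<Sum>n\<in>{1..<?k}. \<Sum>l\<in>binary_trees (take n ls).
        \<Sum>r\<in>binary_trees (drop n ls). ?E (Node () [l, r]))"
      by (rule sum_binary_trees[OF 3])
    also have "\<dots> = (\<Sum>n\<in>{1..<?k}. ennreal (?C n * ?a n * ?H (?k - n) + ?C (?k - n) * ?b (?k - n) * ?H n))"
    proof (intro sum.cong refl)
      fix n assume n: "n \<in> {1..<?k}"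
      then have n': "n < ?k" "?k - n < ?k" by auto
      have "(\<Sum>l\<in>binary_trees (take n ls). \<Sum>r\<in>binary_trees (drop n ls). ?E (Node () [l, r]))
        = (\<Sum>l\<in>binary_trees (take n ls). \<Sum>r\<in>binary_trees (drop n ls).
            ?E r * ennreal (?a n) + ?E l * ennreal (?b (?k - n)))"
      proof (intro sum.cong refl)
        fix l r assume "l \<in> binary_trees (take n ls)" "r \<in> binary_trees (drop n ls)"
        then have lr: "binary l" "binary r" "leaves l = take n ls" "leaves r = drop n ls"
          by (auto simp: binary_trees_def)
        then have "distinct (leaves l @ leaves r)" using less.prems by simp
        from expected_tree_weight_Node[OF p st lr(1,2) this]
        show "?E (Node () [l, r]) = ?E r * ennreal (?a n) + ?E l * ennreal (?b (?k - n))"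
          using lr n' by simp
      qed
      also have "\<dots> = of_nat (card (binary_trees (take n ls))) * ((\<Sum>r\<in>binary_trees (drop n ls). ?E r) * ennreal (?a n))
          + of_nat (card (binary_trees (drop n ls))) * ((\<Sum>l\<in>binary_trees (take n ls). ?E l) * ennreal (?b (?k - n)))"
        by (simp add: sum.distrib sum_distrib_right sum_distrib_left)
      also have "\<dots> = ennreal (?C n) * (ennreal (?H (?k - n)) * ennreal (?a n))
          + ennreal (?C (?k - n)) * (ennreal (?H n) * ennreal (?b (?k - n)))"
        using less.hyps[of "take n ls"] less.hyps[of "drop n ls"] less.prems n'
        by (simp add: card_binary_trees min_absorb2 flip: ennreal_of_nat_eq_real_of_nat)
          (simp add: ennreal_of_nat_eq_real_of_nat card_binary_trees)
      also have "\<dots> = ennreal (?C n * ?a n * ?H (?k - n) + ?C (?k - n) * ?b (?k - n) * ?H n)"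
        by (rule prod_sum) (use ab in simp_all)
      finally show "(\<Sum>l\<in>binary_trees (take n ls). \<Sum>r\<in>binary_trees (drop n ls). ?E (Node () [l, r]))
        = ennreal (?C n * ?a n * ?H (?k - n) + ?C (?k - n) * ?b (?k - n) * ?H n)" .
    qed
    also have "\<dots> = ennreal (\<Sum>n\<in>{1..<?k}. ?C n * ?a n * ?H (?k - n) + ?C (?k - n) * ?b (?k - n) * ?H n)"
      using ab by (intro sum_ennreal) (auto intro!: add_nonneg_nonneg mult_nonneg_nonneg)
    also have "(\<Sum>n\<in>{1..<?k}. ?C n * ?a n * ?H (?k - n) + ?C (?k - n) * ?b (?k - n) * ?H n) =
       (\<Sum>n\<in>{1..<?k}. ?C n * ?a n * ?H (?k - n)) + (\<Sum>n\<in>{1..<?k}. ?C (?k - n) * ?b (?k - n) * ?H n)"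
      by (rule sum.distrib)
    \<comment> \<open>After this reflection n counts the leaves of the subtree off the path in both
      sums, and the two coefficients add up to that of \<open>spine_series\<close>.\<close>
    also have "(\<Sum>n\<in>{1..<?k}. ?C (?k - n) * ?b (?k - n) * ?H n) = (\<Sum>n\<in>{1..<?k}. ?C n * ?b n * ?H (?k - n))"
      by (rule sum.reindex_bij_witness[of _ "\<lambda>n. ?k - n" "\<lambda>n. ?k - n"]) auto
    also have "(\<Sum>n\<in>{1..<?k}. ?C n * ?a n * ?H (?k - n)) + (\<Sum>n\<in>{1..<?k}. ?C n * ?b n * ?H (?k - n)) = ?H ?k"
      unfolding marked_series_rec[OF 3] spine_series_nth sum.distrib[symmetric]
      by (intro sum.cong refl) (simp add: algebra_simps)
    finally show ?thesis .
  qed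
qed

section \<open>The statistic as a function of the permutation\<close>

definition perm_weight :: "real \<Rightarrow> real \<Rightarrow> nat \<Rightarrow> (nat \<Rightarrow> nat) \<Rightarrow> real" where
  "perm_weight s t k \<sigma> = (\<Sum>i\<in>{1..k}. \<Prod>j\<in>{1..k} - {i}.
     s * of_bool (j < i) + t * of_bool (\<sigma> j < \<sigma> i))"

lemma position_upt:
  assumes "i \<in> {1..k}"
  shows "position [1..<Suc k] i = i - 1"
proof -
  have "[1..<Suc k] = [1..<i] @ i # [Suc i..<Suc k]"
    using assms upt_add_eq_append[of 1 i "Suc k - i"] by (simp add: upt_conv_Cons)
  then show ?thesis
    by (simp only: position_def) (subst takeWhile_append2, auto)
qed

text \<open>\<open>position\<close> counts from 0, labels and \<open>perm\<close> from 1; a common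
  shift changes no comparison.\<close>

lemma perm_weight_perm:
  assumes "leaves \<tau> = [1..<Suc k]"
  shows "perm_weight s t k (perm \<tau>) = tree_weight s t \<tau>"
proof -
  have set: "set (leaves \<tau>) = {1..k}" using assms by auto
  have "perm \<tau> i = Suc (position (leaves (reverse_minus \<tau>)) i)" if "i \<in> {1..k}" for i
    using that set by (simp add: perm_def position_def)
  then show ?thesis
    unfolding perm_weight_def tree_weight_def order_weight_def set unfolding assms
    by (intro sum.cong prod.cong refl) (auto simp: position_upt[unfolded One_nat_def] simp del: upt_Suc)
qed

text \<open>The Catalan number on the left clears the denominator of the uniform average over
  trees.\<close>

lemma nn_integral_perm_weight:
  assumes p: "0 \<le> p" "p \<le> 1" and st: "0 \<le> s" "0 \<le> t" and k: "1 \<le> k"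
  shows "ennreal (fps_nth catalan_series k) *
     (\<integral>\<^sup>+\<sigma>. ennreal (perm_weight s t k \<sigma>) \<partial>measure_pmf (map_pmf perm (signed_tree_pmf k p))) =
     ennreal (fps_nth (marked_series p s t) k)"
proof -
  have T: "plane_binary_trees k = binary_trees [1..<Suc k]"
    by (simp add: plane_binary_trees_def binary_trees_def)
  have ne: "binary_trees [1..<Suc k] \<noteq> {}"
    using plane_binary_trees_nonempty[OF k] by (simp add: T)
  have card: "ennreal (fps_nth catalan_series k) = of_nat (card (binary_trees [1..<Suc k]))"
    using card_binary_trees[of "[1..<Suc k]"] by (simp add: ennreal_of_nat_eq_real_of_nat del: upt_Suc)
  have "(\<integral>\<^sup>+\<sigma>. ennreal (perm_weight s t k \<sigma>) \<partial>measure_pmf (map_pmf perm (signed_tree_pmf k p))) =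
     (\<integral>\<^sup>+T. (\<integral>\<^sup>+\<tau>. ennreal (perm_weight s t k (perm \<tau>)) \<partial>measure_pmf (iid_signs p T))
        \<partial>measure_pmf (pmf_of_set (binary_trees [1..<Suc k])))"
    by (simp add: signed_tree_pmf_def T)
  also have "\<dots> = (\<integral>\<^sup>+T. expected_tree_weight p s t T \<partial>measure_pmf (pmf_of_set (binary_trees [1..<Suc k])))"
    unfolding expected_tree_weight_def
  proof (rule nn_integral_cong_AE, rule AE_pmfI, rule nn_integral_cong_AE, rule AE_pmfI)
    fix T \<tau> assume "T \<in> set_pmf (pmf_of_set (binary_trees [1..<Suc k]))" "\<tau> \<in> set_pmf (iid_signs p T)"
    moreover from this have "T \<in> binary_trees [1..<Suc k]"
      using set_pmf_of_set[OF ne finite_binary_trees] by simp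
    ultimately have "leaves \<tau> = [1..<Suc k]"
      using leaves_iid_signs[of T \<tau> p] by (simp add: binary_trees_def del: upt_Suc)
    then show "ennreal (perm_weight s t k (perm \<tau>)) = ennreal (tree_weight s t \<tau>)"
      by (simp add: perm_weight_perm)
  qed
  also have "\<dots> = (\<Sum>T\<in>binary_trees [1..<Suc k]. expected_tree_weight p s t T) / of_nat (card (binary_trees [1..<Suc k]))"
    using ne finite_binary_trees by (rule nn_integral_pmf_of_set)
  also have "\<dots> = ennreal (fps_nth (marked_series p s t) k) / of_nat (card (binary_trees [1..<Suc k]))"
    by (subst sum_expected_tree_weight[OF p st]) (simp_all del: upt_Suc)
  finally show ?thesis
    unfolding card using ne finite_binary_trees
    by (simp add: ennreal_times_divide mult.commute[of "of_nat _"] ennreal_mult_divide_eq)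
qed

section \<open>Sampling from a permuton\<close>

lemma permuton_fst_snd_measurable:
  assumes "sets \<nu> = sets (borel :: (real \<times> real) measure)"
  shows "fst \<in> borel_measurable \<nu>" "snd \<in> borel_measurable \<nu>"
proof -
  have s: "sets \<nu> = sets (borel \<Otimes>\<^sub>M borel)" using assms by (simp only: borel_prod)
  show "fst \<in> borel_measurable \<nu>" "snd \<in> borel_measurable \<nu>"
    using measurable_cong_sets[OF s refl] measurable_fst measurable_snd by blast+
qed

lemma uniform_marginal:
  assumes h: "h \<in> borel_measurable \<nu>" and d: "distr \<nu> borel h = uniform_measure lborel {0..1::real}"
  shows "0 \<le> x \<Longrightarrow> x \<le> 1 \<Longrightarrow> emeasure \<nu> {z \<in> space \<nu>. h z < x} = ennreal x"
    and "emeasure \<nu> {z \<in> space \<nu>. h z = x} = 0"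
    and "AE z in \<nu>. h z \<in> {0..1}"
proof -
  have e: "emeasure \<nu> {z \<in> space \<nu>. h z \<in> A} = emeasure lborel ({0..1} \<inter> A)" if "A \<in> sets borel" for A
  proof -
    have "emeasure (distr \<nu> borel h) A = emeasure \<nu> {z \<in> space \<nu>. h z \<in> A}"
      using emeasure_distr[OF h that] by (simp add: vimage_def Int_def conj_commute)
    then show ?thesis using that by (simp add: d divide_ennreal_def)
  qed
  show "emeasure \<nu> {z \<in> space \<nu>. h z < x} = ennreal x" if "0 \<le> x" "x \<le> 1"
  proof -
    have "{0..1} \<inter> {..<x} = {0..<x}" using that by auto
    then show ?thesis using e[of "{..<x}"] that by simp
  qed
  have "emeasure lborel ({0..1} \<inter> {x}) \<le> emeasure lborel {x}"
    by (intro emeasure_mono) auto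
  then show "emeasure \<nu> {z \<in> space \<nu>. h z = x} = 0" using e[of "{x}"] by simp
  have "emeasure \<nu> {z \<in> space \<nu>. h z \<in> - {0..1}} = 0" using e[of "- {0..1}"] by simp
  moreover have "{z \<in> space \<nu>. h z \<in> - {0..1}} \<in> sets \<nu>" using h by measurable
  ultimately show "AE z in \<nu>. h z \<in> {0..1}"
    by (intro AE_I[of _ _ "{z \<in> space \<nu>. h z \<in> - {0..1}}"]) auto
qed

text \<open>\<open>rank\<close> is measurable even on ties, because it only depends on the finite order relation.\<close>

definition rank_of_order :: "nat \<Rightarrow> (nat \<times> nat) set \<Rightarrow> nat \<Rightarrow> nat" where
  "rank_of_order k R = (THE \<alpha>. \<alpha> permutes {1..k} \<and>
     (\<forall>i\<in>{1..k}. \<forall>j\<in>{1..k}. \<alpha> i < \<alpha> j \<longleftrightarrow> (i, j) \<in> R))"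

definition order_rel :: "nat \<Rightarrow> (nat \<Rightarrow> real) \<Rightarrow> (nat \<times> nat) set" where
  "order_rel k x = {(i, j) \<in> {1..k} \<times> {1..k}. x i < x j}"

lemma rank_eq_rank_of_order: "rank k x = rank_of_order k (order_rel k x)"
  unfolding rank_def rank_of_order_def order_rel_def
  by (rule arg_cong[where f = The]) (auto simp: fun_eq_iff)

lemma order_rel_measurable:
  assumes [measurable]: "\<And>i. i \<in> {1..k} \<Longrightarrow> (\<lambda>z. X z i) \<in> borel_measurable M"
  shows "(\<lambda>z. order_rel k (X z)) \<in> M \<rightarrow>\<^sub>M count_space (Pow ({1..k} \<times> {1..k}))"
  unfolding measurable_count_space_eq2[OF finite_Pow_iff[THEN iffD2, OF finite_cartesian_product[OF finite_atLeastAtMost finite_atLeastAtMost]]]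
proof (intro conjI ballI funcsetI)
  show "order_rel k (X z) \<in> Pow ({1..k} \<times> {1..k})" for z
    by (auto simp: order_rel_def)
  fix R assume R: "R \<in> Pow ({1..k} \<times> {1..k})"
  have "(\<lambda>z. order_rel k (X z)) -` {R} \<inter> space M =
    {z \<in> space M. \<forall>i\<in>{1..k}. \<forall>j\<in>{1..k}. X z i < X z j \<longleftrightarrow> (i, j) \<in> R}"
  proof -
    have "order_rel k (X z) = R \<longleftrightarrow> (\<forall>i\<in>{1..k}. \<forall>j\<in>{1..k}. X z i < X z j \<longleftrightarrow> (i, j) \<in> R)" for z
      using R by (intro iffI set_eqI) (auto simp: order_rel_def subset_iff)
    then show ?thesis by auto
  qed
  also have "\<dots> \<in> sets M" by measurable
  finally show "(\<lambda>z. order_rel k (X z)) -` {R} \<inter> space M \<in> sets M" .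
qed

lemma subperm_measurable:
  "subperm k \<in> (\<Pi>\<^sub>M i\<in>{1..k}. borel :: (real \<times> real) measure) \<rightarrow>\<^sub>M count_space UNIV"
proof -
  let ?M = "\<Pi>\<^sub>M i\<in>{1..k}. borel :: (real \<times> real) measure"
  let ?C = "count_space (Pow ({1..k} \<times> {1..k}))"
  note fs = permuton_fst_snd_measurable[OF refl]
  have R: "(\<lambda>z. order_rel k (\<lambda>i. fst (z i))) \<in> ?M \<rightarrow>\<^sub>M ?C" "(\<lambda>z. order_rel k (\<lambda>i. snd (z i))) \<in> ?M \<rightarrow>\<^sub>M ?C"
    by (intro order_rel_measurable measurable_compose[OF measurable_component_singleton] fs; assumption)+
  have "?C \<Otimes>\<^sub>M ?C = count_space (Pow ({1..k} \<times> {1..k}) \<times> Pow ({1..k} \<times> {1..k}))"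
    by (rule pair_measure_countable) (auto intro: countable_finite)
  then have "(\<lambda>(A, B). rank_of_order k B \<circ> inv (rank_of_order k A)) \<in> ?C \<Otimes>\<^sub>M ?C \<rightarrow>\<^sub>M count_space UNIV"
    by simp
  from measurable_compose[OF measurable_Pair[OF R] this] show ?thesis
    by (simp add: subperm_def[abs_def] rank_eq_rank_of_order)
qed

section \<open>The expected statistic of a sample\<close>

definition sample_weight :: "real \<Rightarrow> real \<Rightarrow> real \<times> real \<Rightarrow> real \<times> real \<Rightarrow> real" where
  "sample_weight s t z w = s * of_bool (fst z < fst w) + t * of_bool (snd z < snd w)"

text \<open>Without ties, the point of horizontal rank m has vertical rank
  \<open>subperm k z m\<close>. Reindexing the sum and the products by the horizontal rank turns
  comparisons of ranks into comparisons of coordinates.\<close>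

lemma perm_weight_subperm:
  assumes inj: "inj_on (\<lambda>i. fst (z i)) {1..k}" "inj_on (\<lambda>i. snd (z i)) {1..k}"
  shows "perm_weight s t k (subperm k z) =
    (\<Sum>i\<in>{1..k}. \<Prod>j\<in>{1..k} - {i}. sample_weight s t (z j) (z i))"
proof -
  let ?\<rho> = "rank k (\<lambda>i. fst (z i))" and ?\<eta> = "rank k (\<lambda>i. snd (z i))"
  note \<rho> = rank_spec[OF inj(1)] and \<eta> = rank_spec[OF inj(2)]
  have bij: "bij_betw ?\<rho> {1..k} {1..k}" using \<rho>(1) by (rule permutes_imp_bij)
  have sub: "subperm k z (?\<rho> i) = ?\<eta> i" for i
    using permutes_inverses(2)[OF \<rho>(1)] by (simp add: subperm_def)
  have "perm_weight s t k (subperm k z) = (\<Sum>i\<in>{1..k}. \<Prod>j\<in>{1..k} - {?\<rho> i}.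
      s * of_bool (j < ?\<rho> i) + t * of_bool (subperm k z j < subperm k z (?\<rho> i)))"
    unfolding perm_weight_def by (rule sum.reindex_bij_betw[OF bij, symmetric])
  also have "\<dots> = (\<Sum>i\<in>{1..k}. \<Prod>j\<in>{1..k} - {i}. sample_weight s t (z j) (z i))"
  proof (rule sum.cong[OF refl])
    fix i assume i: "i \<in> {1..k}"
    have b: "bij_betw ?\<rho> ({1..k} - {i}) ({1..k} - {?\<rho> i})"
      by (rule bij_betw_DiffI[OF bij])
        (use permutes_in_image[OF \<rho>(1)] i in \<open>simp_all add: bij_betw_def del: One_nat_def\<close>)
    have "(\<Prod>j\<in>{1..k} - {?\<rho> i}. s * of_bool (j < ?\<rho> i) + t * of_bool (subperm k z j < subperm k z (?\<rho> i))) =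
      (\<Prod>j\<in>{1..k} - {i}. s * of_bool (?\<rho> j < ?\<rho> i) + t * of_bool (subperm k z (?\<rho> j) < subperm k z (?\<rho> i)))"
      by (rule prod.reindex_bij_betw[OF b, symmetric])
    also have "\<dots> = (\<Prod>j\<in>{1..k} - {i}. sample_weight s t (z j) (z i))"
      using i \<rho>(2) \<eta>(2) by (intro prod.cong refl) (simp add: sub sample_weight_def)
    finally show "(\<Prod>j\<in>{1..k} - {?\<rho> i}. s * of_bool (j < ?\<rho> i) + t * of_bool (subperm k z j < subperm k z (?\<rho> i))) =
      (\<Prod>j\<in>{1..k} - {i}. sample_weight s t (z j) (z i))" .
  qed
  finally show ?thesis .
qed

text \<open>For each pair i, j, the i-th point is integrated first: with the j-th fixed, a tie
  confines it to a level set of h, which is null.\<close>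

lemma AE_PiM_inj_on:
  fixes \<nu> :: "'a measure" and h :: "'a \<Rightarrow> real" and I :: "nat set"
  assumes "prob_space \<nu>" and h[measurable]: "h \<in> borel_measurable \<nu>"
    and null: "\<And>c. emeasure \<nu> {z \<in> space \<nu>. h z = c} = 0" and I: "finite I"
  shows "AE z in (\<Pi>\<^sub>M i\<in>I. \<nu>). inj_on (\<lambda>i. h (z i)) I"
proof -
  interpret prob_space \<nu> by fact
  interpret product_sigma_finite "\<lambda>_::nat. \<nu>" by unfold_locales
  have pair: "AE z in (\<Pi>\<^sub>M i\<in>I. \<nu>). h (z i) \<noteq> h (z j)" if ij: "i \<in> I" "j \<in> I" "i \<noteq> j" for i j
  proof -
    let ?J = "I - {i}"
    have ins: "insert i ?J = I" using ij by auto
    have hij: "(\<lambda>z. h (z i)) \<in> borel_measurable (\<Pi>\<^sub>M i\<in>I. \<nu>)" "(\<lambda>z. h (z j)) \<in> borel_measurable (\<Pi>\<^sub>M i\<in>I. \<nu>)"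
      by (rule measurable_compose[OF measurable_component_singleton[of i I "\<lambda>_. \<nu>", OF ij(1)] h],
          rule measurable_compose[OF measurable_component_singleton[of j I "\<lambda>_. \<nu>", OF ij(2)] h])
    have "(\<lambda>z. indicator {0} (h (z i) - h (z j)) :: ennreal) \<in> borel_measurable (\<Pi>\<^sub>M i\<in>I. \<nu>)"
      by (rule measurable_compose[OF borel_measurable_diff[OF hij] borel_measurable_indicator]) simp
    moreover have "(\<lambda>z. indicator {0} (h (z i) - h (z j)) :: ennreal) = (\<lambda>z. indicator {z. h (z i) = h (z j)} z)"
      by (simp add: indicator_def fun_eq_iff)
    ultimately have f: "(\<lambda>z. indicator {z. h (z i) = h (z j)} z :: ennreal) \<in> borel_measurable (Pi\<^sub>M (insert i ?J) (\<lambda>_. \<nu>))"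
      unfolding ins by simp
    have "(\<integral>\<^sup>+z. indicator {z. h (z i) = h (z j)} z \<partial>(\<Pi>\<^sub>M i\<in>insert i ?J. \<nu>)) =
       (\<integral>\<^sup>+x. \<integral>\<^sup>+y. indicator {z. h (z i) = h (z j)} (x(i := y)) \<partial>\<nu> \<partial>(\<Pi>\<^sub>M i\<in>?J. \<nu>))"
      using I f by (intro product_nn_integral_insert) auto
    also have "\<dots> = (\<integral>\<^sup>+x. 0 \<partial>(\<Pi>\<^sub>M i\<in>?J. \<nu>))"
    proof (rule nn_integral_cong)
      fix x
      have "(\<integral>\<^sup>+y. indicator {z. h (z i) = h (z j)} (x(i := y)) \<partial>\<nu>) =
         (\<integral>\<^sup>+y. indicator {z \<in> space \<nu>. h z = h (x j)} y \<partial>\<nu>)"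
        using ij by (intro nn_integral_cong) (simp add: indicator_def)
      also have "\<dots> = 0" using null[of "h (x j)"] by (subst nn_integral_indicator) measurable
      finally show "(\<integral>\<^sup>+y. indicator {z. h (z i) = h (z j)} (x(i := y)) \<partial>\<nu>) = 0" .
    qed
    finally have "(\<integral>\<^sup>+z. indicator {z. h (z i) = h (z j)} z \<partial>(\<Pi>\<^sub>M i\<in>I. \<nu>)) = 0"
      unfolding ins by simp
    then have "AE z in (\<Pi>\<^sub>M i\<in>I. \<nu>). (indicator {z. h (z i) = h (z j)} z :: ennreal) = 0"
      using f unfolding ins by (subst (asm) nn_integral_0_iff_AE) auto
    then show ?thesis by eventually_elim (simp add: indicator_def split: if_splits)
  qed
  have "AE z in (\<Pi>\<^sub>M i\<in>I. \<nu>). \<forall>i\<in>I. \<forall>j\<in>I. i \<noteq> j \<longrightarrow> h (z i) \<noteq> h (z j)"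
    by (intro AE_finite_allI I) (use pair in \<open>auto intro: AE_I2\<close>)
  then show ?thesis by eventually_elim (auto simp: inj_on_def)
qed

text \<open>Given that the i-th point is w, the other k - 1 points are independent, and each factor
  has mean s x + t y at w = (x, y), because a uniform coordinate lies below x with probability
  x.\<close>

lemma nn_integral_PiM_sample_weight:
  assumes "permuton \<nu>" and st: "0 \<le> s" "0 \<le> t" and i: "i \<in> {1..k}"
  shows "(\<integral>\<^sup>+z. ennreal (\<Prod>j\<in>{1..k} - {i}. sample_weight s t (z j) (z i)) \<partial>(\<Pi>\<^sub>M i\<in>{1..k}. \<nu>)) =
    (\<integral>\<^sup>+w. ennreal ((s * fst w + t * snd w) ^ (k - 1)) \<partial>\<nu>)"
proof -
  interpret prob_space \<nu> using assms by (simp add: permuton_def)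
  interpret product_sigma_finite "\<lambda>_::nat. \<nu>" by unfold_locales
  have sets: "sets \<nu> = sets borel" and d: "distr \<nu> borel fst = uniform_measure lborel {0..1}"
    "distr \<nu> borel snd = uniform_measure lborel {0..1}"
    using assms by (auto simp: permuton_def)
  note fs[measurable] = permuton_fst_snd_measurable[OF sets]
  let ?J = "{1..k} - {i}"
  have ins: "insert i ?J = {1..k}" using i by auto
  have sw: "0 \<le> sample_weight s t z w" for z w using st by (simp add: sample_weight_def)
  have one: "(\<integral>\<^sup>+z. ennreal (sample_weight s t z w) \<partial>\<nu>) = ennreal (s * fst w + t * snd w)"
    if w: "fst w \<in> {0..1}" "snd w \<in> {0..1}" for w
  proof -
    have "(\<integral>\<^sup>+z. ennreal (sample_weight s t z w) \<partial>\<nu>) =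
      (\<integral>\<^sup>+z. ennreal s * indicator {z \<in> space \<nu>. fst z < fst w} z + ennreal t * indicator {z \<in> space \<nu>. snd z < snd w} z \<partial>\<nu>)"
      using st by (intro nn_integral_cong) (simp add: sample_weight_def indicator_def)
    also have "\<dots> = ennreal s * emeasure \<nu> {z \<in> space \<nu>. fst z < fst w} + ennreal t * emeasure \<nu> {z \<in> space \<nu>. snd z < snd w}"
      by (subst nn_integral_add) (simp_all add: nn_integral_cmult_indicator)
    also have "\<dots> = ennreal s * ennreal (fst w) + ennreal t * ennreal (snd w)"
      using w by (simp add: uniform_marginal(1)[OF fs(1) d(1)] uniform_marginal(1)[OF fs(2) d(2)])
    finally show ?thesis using st w by (simp add: ennreal_mult)
  qed
  have swm: "(\<lambda>z. ennreal (sample_weight s t z w)) \<in> borel_measurable \<nu>" for w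
    unfolding sample_weight_def by measurable
  have f: "(\<lambda>z. ennreal (\<Prod>j\<in>?J. sample_weight s t (z j) (z i))) \<in> borel_measurable (Pi\<^sub>M (insert i ?J) (\<lambda>_. \<nu>))"
    unfolding ins sample_weight_def using i by measurable
  have "(\<integral>\<^sup>+z. ennreal (\<Prod>j\<in>?J. sample_weight s t (z j) (z i)) \<partial>(\<Pi>\<^sub>M i\<in>insert i ?J. \<nu>)) =
    (\<integral>\<^sup>+w. \<integral>\<^sup>+x. ennreal (\<Prod>j\<in>?J. sample_weight s t ((x(i := w)) j) ((x(i := w)) i)) \<partial>(\<Pi>\<^sub>M i\<in>?J. \<nu>) \<partial>\<nu>)"
    using f by (intro product_nn_integral_insert_rev) auto
  also have "\<dots> = (\<integral>\<^sup>+w. \<integral>\<^sup>+x. (\<Prod>j\<in>?J. ennreal (sample_weight s t (x j) w)) \<partial>(\<Pi>\<^sub>M i\<in>?J. \<nu>) \<partial>\<nu>)"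
    by (intro nn_integral_cong) (simp add: prod_ennreal sw)
  also have "\<dots> = (\<integral>\<^sup>+w. (\<Prod>j\<in>?J. \<integral>\<^sup>+z. ennreal (sample_weight s t z w) \<partial>\<nu>) \<partial>\<nu>)"
    by (intro nn_integral_cong product_nn_integral_prod swm) auto
  also have "\<dots> = (\<integral>\<^sup>+w. ennreal ((s * fst w + t * snd w) ^ (k - 1)) \<partial>\<nu>)"
  proof (rule nn_integral_cong_AE)
    show "AE w in \<nu>. (\<Prod>j\<in>?J. \<integral>\<^sup>+z. ennreal (sample_weight s t z w) \<partial>\<nu>) =
        ennreal ((s * fst w + t * snd w) ^ (k - 1))"
      using uniform_marginal(3)[OF fs(1) d(1)] uniform_marginal(3)[OF fs(2) d(2)]
    proof eventually_elim
      case (elim w)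
      have "card ?J = k - 1" using i by simp
      moreover have "0 \<le> s * fst w + t * snd w" using elim st by simp
      ultimately show ?case by (simp add: one[OF elim] ennreal_power)
    qed
  qed
  finally show ?thesis unfolding ins .
qed

lemma nn_integral_perm_weight_subperm:
  assumes perm: "permuton \<nu>" and st: "0 \<le> s" "0 \<le> t"
  shows "(\<integral>\<^sup>+z. ennreal (perm_weight s t k (subperm k z)) \<partial>(\<Pi>\<^sub>M i\<in>{1..k}. \<nu>)) =
    of_nat k * (\<integral>\<^sup>+w. ennreal ((s * fst w + t * snd w) ^ (k - 1)) \<partial>\<nu>)"
proof -
  have prob: "prob_space \<nu>" and sets: "sets \<nu> = sets borel" and d: "distr \<nu> borel fst = uniform_measure lborel {0..1}"
    "distr \<nu> borel snd = uniform_measure lborel {0..1}"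
    using assms by (auto simp: permuton_def)
  note fs[measurable] = permuton_fst_snd_measurable[OF sets]
  have sw: "0 \<le> sample_weight s t z w" for z w using st by (simp add: sample_weight_def)
  have "(\<integral>\<^sup>+z. ennreal (perm_weight s t k (subperm k z)) \<partial>(\<Pi>\<^sub>M i\<in>{1..k}. \<nu>)) =
     (\<integral>\<^sup>+z. (\<Sum>i\<in>{1..k}. ennreal (\<Prod>j\<in>{1..k} - {i}. sample_weight s t (z j) (z i))) \<partial>(\<Pi>\<^sub>M i\<in>{1..k}. \<nu>))"
  proof (rule nn_integral_cong_AE)
    show "AE z in (\<Pi>\<^sub>M i\<in>{1..k}. \<nu>). ennreal (perm_weight s t k (subperm k z)) =
      (\<Sum>i\<in>{1..k}. ennreal (\<Prod>j\<in>{1..k} - {i}. sample_weight s t (z j) (z i)))"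
      using AE_PiM_inj_on[OF prob fs(1) uniform_marginal(2)[OF fs(1) d(1)] finite_atLeastAtMost[of 1 k]]
        AE_PiM_inj_on[OF prob fs(2) uniform_marginal(2)[OF fs(2) d(2)] finite_atLeastAtMost[of 1 k]]
      by eventually_elim (simp add: perm_weight_subperm sum_ennreal prod_nonneg sw)
  qed
  also have "\<dots> = (\<Sum>i\<in>{1..k}. \<integral>\<^sup>+z. ennreal (\<Prod>j\<in>{1..k} - {i}. sample_weight s t (z j) (z i)) \<partial>(\<Pi>\<^sub>M i\<in>{1..k}. \<nu>))"
    by (rule nn_integral_sum) (unfold sample_weight_def, measurable)
  also have "\<dots> = of_nat k * (\<integral>\<^sup>+w. ennreal ((s * fst w + t * snd w) ^ (k - 1)) \<partial>\<nu>)"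
  proof -
    have "(\<Sum>i\<in>{1..k}. \<integral>\<^sup>+z. ennreal (\<Prod>j\<in>{1..k} - {i}. sample_weight s t (z j) (z i)) \<partial>(\<Pi>\<^sub>M i\<in>{1..k}. \<nu>)) =
        (\<Sum>i\<in>{1..k}. \<integral>\<^sup>+w. ennreal ((s * fst w + t * snd w) ^ (k - 1)) \<partial>\<nu>)"
      by (intro sum.cong refl nn_integral_PiM_sample_weight[OF perm st])
    then show ?thesis by simp
  qed
  finally show ?thesis .
qed

lemma expected_permuton_eq_bind:
  assumes "random_permuton M \<mu>"
  shows "expected_permuton M \<mu> = M \<bind> \<mu>"
proof -
  have \<mu>: "\<mu> \<in> M \<rightarrow>\<^sub>M prob_algebra borel" and M: "M \<in> space (prob_algebra M)"
    using assms by (auto simp: random_permuton_def space_prob_algebra)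
  show ?thesis
    by (rule measure_eqI)
      (auto simp: sets_bind'[OF M \<mu>] emeasure_expected_permuton[OF assms] emeasure_bind_prob_algebra[OF M \<mu>])
qed

text \<open>Given \<omega>, the expected statistic is linear in the measure
  \<open>\<mu> \<omega>\<close>; averaging over \<omega> therefore involves the random permuton only
  through its expectation.\<close>

lemma nn_integral_subperm_law:
  assumes R: "random_permuton M \<mu>" and st: "0 \<le> s" "0 \<le> t"
  shows "(\<integral>\<^sup>+\<sigma>. ennreal (perm_weight s t k \<sigma>) \<partial>subperm_law M \<mu> k) =
    of_nat k * (\<integral>\<^sup>+w. ennreal ((s * fst w + t * snd w) ^ (k - 1)) \<partial>expected_permuton M \<mu>)"
proof -
  let ?K = "\<lambda>\<omega>. \<Pi>\<^sub>M i\<in>{1..k}. \<mu> \<omega>" and ?B = "\<Pi>\<^sub>M i\<in>{1..k}. borel :: (real \<times> real) measure"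
  let ?\<phi> = "\<lambda>w. ennreal ((s * fst w + t * snd w) ^ (k - 1))"
  have \<mu>: "\<mu> \<in> M \<rightarrow>\<^sub>M prob_algebra borel" and M: "M \<in> space (prob_algebra M)"
    and perm: "\<And>\<omega>. \<omega> \<in> space M \<Longrightarrow> permuton (\<mu> \<omega>)"
    using R by (auto simp: random_permuton_def space_prob_algebra)
  note K = measurable_iid_sample[OF R, of k]
  have sets: "sets (M \<bind> ?K) = sets ?B" by (rule sets_bind'[OF M K])
  have sub: "subperm k \<in> (M \<bind> ?K) \<rightarrow>\<^sub>M count_space UNIV"
    using subperm_measurable measurable_cong_sets[OF sets refl] by blast
  have \<phi>: "?\<phi> \<in> borel_measurable borel"
    by (intro measurable_compose[OF _ measurable_ennreal] borel_measurable_continuous_onI continuous_intros)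
  have int\<phi>: "(\<lambda>\<omega>. \<integral>\<^sup>+w. ?\<phi> w \<partial>\<mu> \<omega>) \<in> borel_measurable M"
    by (rule measurable_compose[OF measurable_prob_algebraD[OF \<mu>] nn_integral_measurable_subprob_algebra[OF \<phi>]])
  have "(\<integral>\<^sup>+\<sigma>. ennreal (perm_weight s t k \<sigma>) \<partial>subperm_law M \<mu> k) =
    (\<integral>\<^sup>+z. ennreal (perm_weight s t k (subperm k z)) \<partial>(M \<bind> ?K))"
    unfolding subperm_law_def by (rule nn_integral_distr[OF sub]) simp
  also have "\<dots> = (\<integral>\<^sup>+\<omega>. \<integral>\<^sup>+z. ennreal (perm_weight s t k (subperm k z)) \<partial>?K \<omega> \<partial>M)"
    by (rule nn_integral_bind[OF measurable_compose[OF subperm_measurable] measurable_prob_algebraD[OF K]]) simp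
  also have "\<dots> = (\<integral>\<^sup>+\<omega>. of_nat k * (\<integral>\<^sup>+w. ?\<phi> w \<partial>\<mu> \<omega>) \<partial>M)"
    by (intro nn_integral_cong nn_integral_perm_weight_subperm perm st)
  also have "\<dots> = of_nat k * (\<integral>\<^sup>+\<omega>. \<integral>\<^sup>+w. ?\<phi> w \<partial>\<mu> \<omega> \<partial>M)"
    by (rule nn_integral_cmult[OF int\<phi>])
  also have "(\<integral>\<^sup>+\<omega>. \<integral>\<^sup>+w. ?\<phi> w \<partial>\<mu> \<omega> \<partial>M) = (\<integral>\<^sup>+w. ?\<phi> w \<partial>expected_permuton M \<mu>)"
    unfolding expected_permuton_eq_bind[OF R]
    by (rule nn_integral_bind[OF \<phi> measurable_prob_algebraD[OF \<mu>], symmetric])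
  finally show ?thesis .
qed

section \<open>Uniqueness from linear moments\<close>

text \<open>The algebra for the Stone-Weierstrass theorem; it is closed under products because
  nonnegative exponents add up to nonnegative exponents.\<close>

inductive exp_polynomial :: "(real \<times> real \<Rightarrow> real) \<Rightarrow> bool" where
  exp_polynomial_exp: "0 \<le> s \<Longrightarrow> 0 \<le> t \<Longrightarrow> exp_polynomial (\<lambda>z. c * exp (s * fst z + t * snd z))"
| exp_polynomial_add: "exp_polynomial f \<Longrightarrow> exp_polynomial g \<Longrightarrow> exp_polynomial (\<lambda>z. f z + g z)"

lemma exp_polynomial_const: "exp_polynomial (\<lambda>z. c)"
  using exp_polynomial_exp[of 0 0 c] by simp

lemma exp_polynomial_mult:
  assumes "exp_polynomial f" "exp_polynomial g"
  shows "exp_polynomial (\<lambda>z. f z * g z)"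
  using assms(1)
proof induction
  case (exp_polynomial_exp s t c)
  from assms(2) show ?case
  proof induction
    case (exp_polynomial_exp s' t' c')
    have "(\<lambda>z. c * exp (s * fst z + t * snd z) * (c' * exp (s' * fst z + t' * snd z))) =
        (\<lambda>z. c * c' * exp ((s + s') * fst z + (t + t') * snd z))"
      by (simp add: fun_eq_iff algebra_simps exp_add)
    then show ?case
      using exp_polynomial.exp_polynomial_exp[of "s + s'" "t + t'" "c * c'"]
        exp_polynomial_exp \<open>0 \<le> s\<close> \<open>0 \<le> t\<close> by simp
  next
    case (exp_polynomial_add g h)
    then show ?case
      using exp_polynomial.exp_polynomial_add by (simp add: distrib_left)
  qed
next
  case (exp_polynomial_add g h)
  then show ?case
    using exp_polynomial.exp_polynomial_add by (simp add: distrib_right)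
qed

lemma exp_polynomial_continuous: "exp_polynomial f \<Longrightarrow> continuous_on S f"
  by (induction rule: exp_polynomial.induct) (auto intro!: continuous_intros)

lemma nn_integral_exp_moments:
  fixes f :: "'a \<Rightarrow> real"
  assumes [measurable]: "f \<in> borel_measurable M" and pos: "AE z in M. 0 \<le> f z"
  shows "(\<integral>\<^sup>+z. ennreal (exp (f z)) \<partial>M) =
    (\<Sum>n. ennreal (inverse (fact n)) * (\<integral>\<^sup>+z. ennreal (f z ^ n) \<partial>M))"
proof -
  have "(\<integral>\<^sup>+z. ennreal (exp (f z)) \<partial>M) =
      (\<integral>\<^sup>+z. (\<Sum>n. ennreal (inverse (fact n)) * ennreal (f z ^ n)) \<partial>M)"
  proof (rule nn_integral_cong_AE, use pos in eventually_elim)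
    case (elim z)
    have "ennreal (exp (f z)) = (\<Sum>n. ennreal (inverse (fact n) * f z ^ n))"
      using exp_converges[of "f z"] elim
      by (intro suminf_ennreal_eq[symmetric]) auto
    then show ?case using elim by (simp add: ennreal_mult)
  qed
  also have "\<dots> = (\<Sum>n. ennreal (inverse (fact n)) * (\<integral>\<^sup>+z. ennreal (f z ^ n) \<partial>M))"
    by (simp add: nn_integral_suminf nn_integral_cmult)
  finally show ?thesis .
qed

lemma integrable_continuous_AE_compact:
  fixes f :: "'a::topological_space \<Rightarrow> real"
  assumes "finite_measure M" and sets: "sets M = sets borel" and K: "compact K" "AE z in M. z \<in> K"
    and f: "continuous_on UNIV f"
  shows "integrable M f"
proof -
  interpret finite_measure M by fact
  have "bounded (f ` K)"
    using compact_continuous_image[OF continuous_on_subset[OF f] K(1)] by (auto intro: compact_imp_bounded)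
  then obtain B where "\<And>z. z \<in> K \<Longrightarrow> norm (f z) \<le> B"
    by (auto simp: bounded_iff)
  then have "AE z in M. norm (f z) \<le> B" using K(2) by (auto elim!: eventually_mono)
  moreover have "f \<in> borel_measurable M"
    using borel_measurable_continuous_onI[OF f] measurable_cong_sets[OF sets refl] by blast
  ultimately show ?thesis by (rule integrable_const_bound)
qed

text \<open>The indicator of a closed set is the limit of the ramps max 0 (1 - n d(z, F)), and the
  closed sets form an intersection-stable generator.\<close>

lemma prob_space_eqI_continuous:
  fixes M N :: "'a::metric_space measure"
  assumes "prob_space M" "prob_space N" and sets: "sets M = sets borel" "sets N = sets borel"
    and eq: "\<And>f :: 'a \<Rightarrow> real. continuous_on UNIV f \<Longrightarrow> (\<And>z. 0 \<le> f z \<and> f z \<le> 1) \<Longrightarrow> (\<integral>z. f z \<partial>M) = (\<integral>z. f z \<partial>N)"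
  shows "M = N"
proof -
  interpret M: prob_space M by fact
  interpret N: prob_space N by fact
  have closed: "measure M F = measure N F" if F: "closed F" for F
  proof (cases "F = {}")
    \<comment> \<open>The empty set is treated apart: \<open>infdist z {}\<close> is 0 by
      convention, so its ramps would be constantly 1.\<close>
    case False
    define f where "f n z = max 0 (1 - real n * infdist z F)" for n z
    have cont: "continuous_on UNIV (f n)" for n
      unfolding f_def by (intro continuous_intros)
    have b: "0 \<le> f n z \<and> f n z \<le> 1" for n z
      by (auto simp: f_def infdist_nonneg)
    have lim: "(\<lambda>n. f n z) \<longlonglongrightarrow> indicator F z" for z
    proof (cases "z \<in> F")
      case True
      then show ?thesis by (simp add: f_def)
    next
      case z: False
      then have d: "0 < infdist z F"
        using F False in_closed_iff_infdist_zero[of F z] infdist_nonneg[of z F] by fastforce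
      have "eventually (\<lambda>n. f n z = 0) sequentially"
      proof (rule eventually_sequentiallyI[of "nat \<lceil>1 / infdist z F\<rceil>"])
        fix n assume "nat \<lceil>1 / infdist z F\<rceil> \<le> n"
        then have "1 / infdist z F \<le> real n" by linarith
        then show "f n z = 0" using d by (simp add: f_def field_simps)
      qed
      then show ?thesis using z by (simp add: tendsto_eventually)
    qed
    have conv: "(\<lambda>n. \<integral>z. f n z \<partial>P) \<longlonglongrightarrow> measure P F"
      if "prob_space P" "sets P = sets borel" for P
    proof -
      interpret prob_space P by fact
      have Fm: "F \<in> sets P" using F that by auto
      have "(\<lambda>n. \<integral>z. f n z \<partial>P) \<longlonglongrightarrow> (\<integral>z. indicator F z \<partial>P)"
      proof (rule integral_dominated_convergence[where w = "\<lambda>_. 1"])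
        show "f n \<in> borel_measurable P" for n
          using borel_measurable_continuous_onI[OF cont] measurable_cong_sets[OF that(2) refl] by blast
      qed (use Fm lim b in auto)
      then show ?thesis using Fm by (simp add: Int_absorb2 sets.sets_into_space)
    qed
    have "(\<lambda>n. \<integral>z. f n z \<partial>M) \<longlonglongrightarrow> measure N F"
      using conv[OF assms(2) sets(2)] eq[OF cont b] by simp
    then show ?thesis using conv[OF assms(1) sets(1)] LIMSEQ_unique by blast
  qed simp
  show ?thesis
  proof (rule measure_eqI_generator_eq[where E = "Collect closed" and \<Omega> = UNIV and A = "\<lambda>_. UNIV"])
    show "Int_stable (Collect closed :: 'a set set)" by (auto simp: Int_stable_def)
    show "emeasure M X = emeasure N X" if "X \<in> Collect closed" for X
      using closed[of X] that by (simp add: M.emeasure_eq_measure N.emeasure_eq_measure)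
    show "sets M = sigma_sets UNIV (Collect closed)" "sets N = sigma_sets UNIV (Collect closed)"
      using sets borel_eq_closed by (metis sets_measure_of top_greatest Pow_UNIV)+
  qed (auto simp: M.emeasure_eq_measure)
qed

text \<open>Moments determine the integrals of exp (s x + t y) through the exponential series, and
  combinations of these are uniformly dense in the continuous functions on the square, which carries
  both measures.\<close>

lemma measure_eqI_linear_moments:
  fixes M N :: "(real \<times> real) measure"
  assumes M: "prob_space M" "sets M = sets borel" "AE z in M. z \<in> {0..1} \<times> {0..1}"
    and N: "prob_space N" "sets N = sets borel" "AE z in N. z \<in> {0..1} \<times> {0..1}"
    and mom: "\<And>s t n. 0 \<le> s \<Longrightarrow> 0 \<le> t \<Longrightarrow>
      (\<integral>\<^sup>+z. ennreal ((s * fst z + t * snd z) ^ n) \<partial>M) = (\<integral>\<^sup>+z. ennreal ((s * fst z + t * snd z) ^ n) \<partial>N)"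
  shows "M = N"
proof (rule prob_space_eqI_continuous[OF M(1) N(1) M(2) N(2)])
  let ?K = "{0..1} \<times> {0..1} :: (real \<times> real) set"
  have K: "compact ?K" by (intro compact_Times) auto
  have fin: "finite_measure M" "finite_measure N"
    using M(1) N(1) by (simp_all add: prob_space.finite_measure)
  have int: "integrable M f" "integrable N f" if "continuous_on UNIV f" for f :: "real \<times> real \<Rightarrow> real"
    using integrable_continuous_AE_compact[OF fin(1) M(2) K M(3) that]
      integrable_continuous_AE_compact[OF fin(2) N(2) K N(3) that] by auto
  have exp: "(\<integral>z. exp (s * fst z + t * snd z) \<partial>M) = (\<integral>z. exp (s * fst z + t * snd z) \<partial>N)"
    if st: "0 \<le> s" "0 \<le> t" for s t
  proof -
    have m: "(\<lambda>z. s * fst z + t * snd z) \<in> borel_measurable P" if "sets P = sets borel" for P :: "(real \<times> real) measure"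
    proof -
      have "(\<lambda>z::real \<times> real. s * fst z + t * snd z) \<in> borel_measurable borel"
        by (intro borel_measurable_continuous_onI continuous_intros)
      then show ?thesis using measurable_cong_sets[OF that refl] by blast
    qed
    have pos: "AE z in P. 0 \<le> s * fst z + t * snd z" if "AE z in P. z \<in> ?K" for P
      using that by eventually_elim (use st in \<open>auto intro!: add_nonneg_nonneg mult_nonneg_nonneg\<close>)
    have "ennreal (\<integral>z. exp (s * fst z + t * snd z) \<partial>M) = (\<integral>\<^sup>+z. ennreal (exp (s * fst z + t * snd z)) \<partial>M)"
      by (intro nn_integral_eq_integral[symmetric] int continuous_intros) auto
    also have "\<dots> = (\<integral>\<^sup>+z. ennreal (exp (s * fst z + t * snd z)) \<partial>N)"
      unfolding nn_integral_exp_moments[OF m[OF M(2)] pos[OF M(3)]]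
        nn_integral_exp_moments[OF m[OF N(2)] pos[OF N(3)]] mom[OF st] ..
    also have "\<dots> = ennreal (\<integral>z. exp (s * fst z + t * snd z) \<partial>N)"
      by (intro nn_integral_eq_integral int continuous_intros) auto
    finally show ?thesis by (subst (asm) ennreal_inj) auto
  qed
  have poly: "(\<integral>z. g z \<partial>M) = (\<integral>z. g z \<partial>N)" if "exp_polynomial g" for g
    using that
  proof induction
    case (exp_polynomial_exp s t c)
    then show ?case using exp by simp
  next
    case (exp_polynomial_add f g)
    then show ?case
      using int[OF exp_polynomial_continuous] by simp
  qed
  fix f :: "real \<times> real \<Rightarrow> real" assume f: "continuous_on UNIV f"
  have "\<bar>(\<integral>z. f z \<partial>M) - (\<integral>z. f z \<partial>N)\<bar> \<le> e" if e: "0 < e" for e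
  proof -
    have "\<exists>g. exp_polynomial g \<and> (\<forall>z\<in>?K. \<bar>f z - g z\<bar> < e / 2)"
    proof (rule Stone_Weierstrass_HOL[OF K])
      show "\<exists>h. exp_polynomial h \<and> h x \<noteq> h y" if "x \<in> ?K \<and> y \<in> ?K \<and> x \<noteq> y" for x y
      proof (cases "fst x = fst y")
        case True
        then have "exp (0 * fst x + 1 * snd x) \<noteq> exp (0 * fst y + 1 * snd y)"
          using that by (simp add: prod_eq_iff)
        then show ?thesis using exp_polynomial_exp[of 0 1 1]
          by (intro exI[of _ "\<lambda>z. 1 * exp (0 * fst z + 1 * snd z)"]) simp
      next
        case False
        then have "exp (1 * fst x + 0 * snd x) \<noteq> exp (1 * fst y + 0 * snd y)"
          by simp
        then show ?thesis using exp_polynomial_exp[of 1 0 1]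
          by (intro exI[of _ "\<lambda>z. 1 * exp (1 * fst z + 0 * snd z)"]) simp
      qed
      show "continuous_on ?K f" using f by (rule continuous_on_subset) auto
    qed (use e in \<open>auto intro: exp_polynomial_const exp_polynomial_add exp_polynomial_mult exp_polynomial_continuous\<close>)
    then obtain g where g: "exp_polynomial g" "\<And>z. z \<in> ?K \<Longrightarrow> \<bar>f z - g z\<bar> < e / 2" by blast
    have close: "\<bar>(\<integral>z. f z \<partial>P) - (\<integral>z. g z \<partial>P)\<bar> \<le> e / 2"
      if P: "prob_space P" "AE z in P. z \<in> ?K" "integrable P f" "integrable P g" for P
    proof -
      interpret prob_space P by fact
      have "\<bar>(\<integral>z. f z \<partial>P) - (\<integral>z. g z \<partial>P)\<bar> = \<bar>\<integral>z. f z - g z \<partial>P\<bar>"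
        using P by simp
      also have "\<dots> \<le> (\<integral>z. \<bar>f z - g z\<bar> \<partial>P)" by (rule integral_abs_bound)
      also have "\<dots> \<le> (\<integral>z. e / 2 \<partial>P)"
      proof (rule integral_mono_AE)
        show "AE z in P. \<bar>f z - g z\<bar> \<le> e / 2"
          using P(2) by eventually_elim (use g(2) in \<open>auto intro: less_imp_le\<close>)
      qed (use P in auto)
      finally show ?thesis by (simp add: prob_space)
    qed
    have "\<bar>(\<integral>z. f z \<partial>M) - (\<integral>z. g z \<partial>M)\<bar> \<le> e / 2" "\<bar>(\<integral>z. f z \<partial>N) - (\<integral>z. g z \<partial>N)\<bar> \<le> e / 2"
      by (rule close[OF M(1,3) int(1)[OF f] int(1)[OF exp_polynomial_continuous[OF g(1)]]],
          rule close[OF N(1,3) int(2)[OF f] int(2)[OF exp_polynomial_continuous[OF g(1)]]])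
    then show ?thesis using poly[OF g(1)] by linarith
  qed
  then show "(\<integral>z. f z \<partial>M) = (\<integral>z. f z \<partial>N)"
    using field_le_epsilon[of "\<bar>(\<integral>z. f z \<partial>M) - (\<integral>z. f z \<partial>N)\<bar>" 0] by auto
qed

section \<open>Comparison of the generating functions\<close>

text \<open>By \<open>catalan_series_nth_Suc\<close> this is n + 1 times a number of trees, and
  there is at least one tree. Strictness allows the coefficient to be cancelled when moments are
  compared.\<close>

lemma binomial_series_neg_half_pos: "0 < fps_nth (binomial_series (-1/2)) n"
proof -
  have "binary_trees [1..<Suc (Suc n)] \<noteq> {}"
    using plane_binary_trees_nonempty[of "Suc n"] by (simp add: plane_binary_trees_def binary_trees_def del: upt_Suc)
  then have "0 < fps_nth catalan_series (Suc n)"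
    using card_binary_trees[of "[1..<Suc (Suc n)]"] finite_binary_trees
    by (metis card_gt_0_iff diff_Suc_1 length_upt of_nat_0_less_iff)
  then show ?thesis unfolding catalan_series_nth_Suc[symmetric] by simp
qed

lemma binomial_series_sums:
  assumes "\<bar>4 * z\<bar> < 1"
  shows "(\<lambda>n. fps_nth (binomial_series a) n * z ^ n) sums (1 - 4 * z) powr a"
proof -
  have "(\<lambda>n. (a gchoose n) * (- 4 * z) ^ n) sums (1 + (- 4 * z)) powr a"
    using assms by (intro gen_binomial_real) simp
  then show ?thesis unfolding power_mult_distrib by (simp add: binomial_series_nth mult.assoc)
qed

lemma catalan_series_sums:
  assumes "\<bar>4 * z\<bar> < 1"
  shows "(\<lambda>n. fps_nth catalan_series n * z ^ n) sums ((1 - sqrt (1 - 4 * z)) / 2)"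
proof -
  have "(\<lambda>n. (fps_nth 1 n * z ^ n - fps_nth (binomial_series (1/2)) n * z ^ n) / 2) sums
      ((1 - (1 - 4 * z) powr (1/2)) / 2)"
  proof (intro sums_divide sums_diff binomial_series_sums assms)
    show "(\<lambda>n. fps_nth 1 n * z ^ n) sums 1"
      using sums_single[of 0 "\<lambda>n. z ^ n"] by (simp add: if_distrib if_distribR cong: if_cong)
  qed
  moreover have "(1 - 4 * z) powr (1/2) = sqrt (1 - 4 * z)"
    using assms by (intro powr_half_sqrt) linarith
  moreover have "1/2 * (a - b) * c = (a * c - b * c) / 2" for a b c :: real
    by (simp add: field_simps)
  ultimately show ?thesis
    unfolding catalan_series_def fps_mult_left_const_nth fps_sub_nth by simp
qed

lemma small_products:
  fixes s t w :: real
  assumes "0 \<le> s" "0 \<le> t" "0 \<le> w" "4 * w * (s + t) < 1"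
  shows "4 * w * s < 1" "4 * w * t < 1" "0 \<le> w * s" "0 \<le> w * t"
proof -
  show *: "0 \<le> w * s" "0 \<le> w * t" using assms by simp_all
  have "4 * (w * s) + 4 * (w * t) < 1" using assms(4) by (simp add: algebra_simps)
  then have "4 * (w * s) < 1" "4 * (w * t) < 1" using * by linarith+
  then show "4 * w * s < 1" "4 * w * t < 1" by (simp_all only: mult.assoc)
qed

text \<open>The constant terms leave 1 - (p + 2 (1 - p)) / 2 = p / 2. This is the isolated p that
  the fourth simplex coordinate produces in \<open>nn_integral_sep_density\<close>.\<close>

lemma spine_series_sums:
  assumes st: "0 \<le> s" "0 \<le> t" and w: "0 \<le> w" "4 * w * (s + t) < 1"
  shows "(\<lambda>n. fps_nth (1 - spine_series p s t) n * w ^ n) sums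
    ((p + p * sqrt (1 - 4 * w * (s + t)) + (1 - p) * sqrt (1 - 4 * w * s) + (1 - p) * sqrt (1 - 4 * w * t)) / 2)"
proof -
  note b = small_products[OF st w]
  have "(\<lambda>n. fps_nth 1 n * w ^ n - (p * (fps_nth catalan_series n * (w * (s + t)) ^ n)
      + (1 - p) * (fps_nth catalan_series n * (w * s) ^ n) + (1 - p) * (fps_nth catalan_series n * (w * t) ^ n)))
    sums (1 - (p * ((1 - sqrt (1 - 4 * (w * (s + t)))) / 2)
      + (1 - p) * ((1 - sqrt (1 - 4 * (w * s))) / 2) + (1 - p) * ((1 - sqrt (1 - 4 * (w * t))) / 2)))"
  proof (intro sums_diff sums_add sums_mult catalan_series_sums)
    show "(\<lambda>n. fps_nth 1 n * w ^ n) sums 1"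
      using sums_single[of 0 "\<lambda>n. w ^ n"] by (simp add: if_distrib if_distribR cong: if_cong)
  qed (use st w b in \<open>auto simp: abs_mult mult.assoc\<close>)
  moreover have "fps_nth (1 - spine_series p s t) n * w ^ n = fps_nth 1 n * w ^ n - (p * (fps_nth catalan_series n * (w * (s + t)) ^ n)
      + (1 - p) * (fps_nth catalan_series n * (w * s) ^ n) + (1 - p) * (fps_nth catalan_series n * (w * t) ^ n))" for n
    unfolding fps_sub_nth spine_series_nth power_mult_distrib by (simp only: algebra_simps)
  moreover have "1 - (p * ((1 - sqrt (1 - 4 * (w * (s + t)))) / 2)
      + (1 - p) * ((1 - sqrt (1 - 4 * (w * s))) / 2) + (1 - p) * ((1 - sqrt (1 - 4 * (w * t))) / 2)) =
    (p + p * sqrt (1 - 4 * w * (s + t)) + (1 - p) * sqrt (1 - 4 * w * s) + (1 - p) * sqrt (1 - 4 * w * t)) / 2"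
    by (simp add: field_simps)
  ultimately show ?thesis by (simp only:)
qed

text \<open>Dividing by w ^ m, with m the index of the first nonzero coefficient, and letting w tend
  to 0 from the right would make that coefficient 0. One-sided information suffices.\<close>

lemma fps_eq_0_if_sums_0:
  fixes f :: "real fps"
  assumes \<epsilon>: "0 < \<epsilon>" and sums: "\<And>w. 0 \<le> w \<Longrightarrow> w < \<epsilon> \<Longrightarrow> (\<lambda>n. fps_nth f n * w ^ n) sums 0"
  shows "f = 0"
proof (rule ccontr)
  assume "f \<noteq> 0"
  define m where "m = subdegree f"
  define a where "a n = fps_nth f (n + m)" for n
  let ?F = "\<lambda>x. \<Sum>n. a n * x ^ n"
  have a: "(\<lambda>n. a n * w ^ n) sums 0" if w: "0 < w" "w < \<epsilon>" for w
  proof -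
    have "(\<lambda>n. fps_nth f (n + m) * w ^ (n + m)) sums 0"
    proof -
      have "(\<Sum>i<m. fps_nth f i * w ^ i) = 0"
      proof (rule sum.neutral, rule ballI)
        fix i assume "i \<in> {..<m}"
        then have "fps_nth f i = 0" unfolding m_def by (intro nth_less_subdegree_zero) simp
        then show "fps_nth f i * w ^ i = 0" by simp
      qed
      then show ?thesis
        using sums[of w] w by (subst sums_iff_shift) simp
    qed
    from sums_divide[OF this, of "w ^ m"] show ?thesis
      using w by (simp add: a_def power_add)
  qed
  have "(?F \<longlongrightarrow> a 0) (at 0)"
  proof (rule powser_limit_0_strong[OF \<epsilon>])
    fix x :: real assume x: "x \<noteq> 0" "norm x < \<epsilon>"
    \<comment> \<open>The limit theorem asks for convergence on both sides of 0; convergence at a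
      slightly larger positive w provides it.\<close>
    then obtain w where "\<bar>x\<bar> < w" "w < \<epsilon>" using dense[of "\<bar>x\<bar>" \<epsilon>] by auto
    then have "summable (\<lambda>n. a n * w ^ n)" "norm x < norm w"
      using a[of w] by (auto simp: sums_iff)
    then have "summable (\<lambda>n. a n * x ^ n)"
      by (rule powser_inside)
    then show "(\<lambda>n. a n * x ^ n) sums ?F x" by (rule summable_sums)
  qed
  then have "(?F \<longlongrightarrow> a 0) (at_right 0)"
    by (rule tendsto_mono[rotated]) (simp add: at_le)
  moreover have "eventually (\<lambda>w. ?F w = 0) (at_right 0)"
    using eventually_at_right_real[OF \<epsilon>] by eventually_elim (use a in \<open>auto simp: sums_iff\<close>)
  ultimately have "((\<lambda>_. 0) \<longlongrightarrow> a 0) (at_right (0 :: real))"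
    by (rule Lim_transform_eventually)
  then have "a 0 = 0" by (simp add: tendsto_const_iff)
  then show False using \<open>f \<noteq> 0\<close> by (simp add: a_def m_def)
qed

lemma fps_mult_eq_1_if_sums:
  fixes f g :: "real fps"
  assumes \<epsilon>: "0 < \<epsilon>"
    and f: "\<And>w. 0 \<le> w \<Longrightarrow> w < \<epsilon> \<Longrightarrow> (\<lambda>n. fps_nth f n * w ^ n) sums F w"
    and g: "\<And>w. 0 \<le> w \<Longrightarrow> w < \<epsilon> \<Longrightarrow> (\<lambda>n. fps_nth g n * w ^ n) sums G w"
    and FG: "\<And>w. 0 \<le> w \<Longrightarrow> w < \<epsilon> \<Longrightarrow> F w * G w = 1"
  shows "f * g = 1"
proof -
  have abs: "summable (\<lambda>n. norm (fps_nth h n * w ^ n))"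
    if h: "\<And>w. 0 \<le> w \<Longrightarrow> w < \<epsilon> \<Longrightarrow> (\<lambda>n. fps_nth h n * w ^ n) sums H w" and w: "0 \<le> w" "w < \<epsilon>"
    for h :: "real fps" and H w
  proof -
    \<comment> \<open>The Cauchy product needs absolute convergence, which follows from convergence
      at a point v beyond w.\<close>
    obtain v where "w < v" "v < \<epsilon>" using dense[OF w(2)] by auto
    then show ?thesis using h[of v] w by (intro powser_insidea[of _ v]) (auto simp: sums_iff)
  qed
  have "f * g - 1 = 0"
  proof (rule fps_eq_0_if_sums_0[OF \<epsilon>])
    fix w :: real assume w: "0 \<le> w" "w < \<epsilon>"
    have "(\<lambda>n. \<Sum>i\<le>n. (fps_nth f i * w ^ i) * (fps_nth g (n - i) * w ^ (n - i))) sums (F w * G w)"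
      using Cauchy_product_sums[OF abs[OF f w] abs[OF g w]] f[OF w] g[OF w] by (simp add: sums_iff)
    moreover have "(\<Sum>i\<le>n. (fps_nth f i * w ^ i) * (fps_nth g (n - i) * w ^ (n - i))) = fps_nth (f * g) n * w ^ n" for n
      unfolding fps_mult_nth atLeast0AtMost sum_distrib_right
      by (intro sum.cong refl) (simp add: mult_ac flip: power_add)
    moreover have "(\<lambda>n. fps_nth 1 n * w ^ n) sums 1"
      using sums_single[of 0 "\<lambda>n. w ^ n"] by (simp add: if_distrib if_distribR cong: if_cong)
    ultimately have "(\<lambda>n. fps_nth (f * g) n * w ^ n - fps_nth 1 n * w ^ n) sums (1 - 1)"
      using FG[OF w] by (intro sums_diff) simp_all
    then show "(\<lambda>n. fps_nth (f * g - 1) n * w ^ n) sums 0"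
      by (simp add: left_diff_distrib)
  qed
  then show ?thesis by simp
qed

lemma marked_series_unique:
  assumes "f * (1 - spine_series p s t) = 1"
  shows "fps_nth (marked_series p s t) (Suc n) = fps_nth f n"
proof -
  have "inverse (1 - spine_series p s t) * (1 - spine_series p s t) = 1"
    by (rule inverse_mult_eq_1) (simp add: spine_series_nth)
  moreover from this have "1 - spine_series p s t \<noteq> 0" by auto
  ultimately have "f = inverse (1 - spine_series p s t)" using assms by (metis mult_cancel_right)
  then show ?thesis by (simp add: marked_series_def)
qed

text \<open>For k = n + 1, the factor k from sampling and the number of trees with k leaves merge
  into the coefficient of (1 - 4 z) powr (-1/2).\<close>

lemma brownian_moments:
  assumes p: "0 < p" "p < 1" and br: "brownian_separable_permuton p M \<mu>" and st: "0 \<le> s" "0 \<le> t"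
  shows "ennreal (fps_nth (binomial_series (-1/2)) n) *
      (\<integral>\<^sup>+z. ennreal ((s * fst z + t * snd z) ^ n) \<partial>expected_permuton M \<mu>) =
    ennreal (fps_nth (marked_series p s t) (Suc n))"
proof -
  have R: "random_permuton M \<mu>" and law: "subperm_law M \<mu> (Suc n) = measure_pmf (map_pmf perm (signed_tree_pmf (Suc n) p))"
    using br by (auto simp: brownian_separable_permuton_def)
  let ?I = "\<integral>\<^sup>+z. ennreal ((s * fst z + t * snd z) ^ n) \<partial>expected_permuton M \<mu>"
  have "ennreal (fps_nth (marked_series p s t) (Suc n)) = ennreal (fps_nth catalan_series (Suc n)) *
     (\<integral>\<^sup>+\<sigma>. ennreal (perm_weight s t (Suc n) \<sigma>) \<partial>subperm_law M \<mu> (Suc n))"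
    unfolding law by (rule nn_integral_perm_weight[symmetric]) (use p st in auto)
  also have "\<dots> = ennreal (fps_nth catalan_series (Suc n)) * (of_nat (Suc n) * ?I)"
    using nn_integral_subperm_law[OF R st, of "Suc n"] by simp
  also have "\<dots> = ennreal (fps_nth catalan_series (Suc n)) * ennreal (real (Suc n)) * ?I"
    by (simp only: ennreal_of_nat_eq_real_of_nat mult.assoc)
  also have "ennreal (fps_nth catalan_series (Suc n)) * ennreal (real (Suc n)) = ennreal (fps_nth (binomial_series (-1/2)) n)"
    unfolding catalan_series_nth_Suc[symmetric]
    by (subst ennreal_mult) (simp_all add: catalan_series_nonneg mult.commute)
  finally show ?thesis ..
qed

text \<open>The moments, weighted by the binomial coefficients, form a power series f. Its sum is
  known in closed form near 0 and is the reciprocal of that of 1 - \<open>spine_series\<close>, so f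
  is the inverse series and its coefficients can be read off.\<close>

lemma sep_density_moments:
  assumes p: "0 < p" "p < 1" and st: "0 \<le> s" "0 \<le> t"
    and N: "N = density lborel (\<lambda>(x, y). sep_density p x y)" "prob_space N" "AE z in N. z \<in> {0..1} \<times> {0..1}"
  shows "ennreal (fps_nth (binomial_series (-1/2)) n) *
      (\<integral>\<^sup>+z. ennreal ((s * fst z + t * snd z) ^ n) \<partial>N) =
    ennreal (fps_nth (marked_series p s t) (Suc n))"
proof -
  interpret N: prob_space N by fact
  let ?B = "fps_nth (binomial_series (-1/2))"
  let ?z = "\<lambda>z. s * fst z + t * snd z"
  let ?I = "\<lambda>n. \<integral>\<^sup>+z. ennreal (?z z ^ n) \<partial>N"
  let ?S = "\<lambda>w. p + p * sqrt (1 - 4 * w * (s + t)) + (1 - p) * sqrt (1 - 4 * w * s) + (1 - p) * sqrt (1 - 4 * w * t)"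
  \<comment> \<open>Any w below this bound satisfies 4 w (s + t) < 1; the summand 1 keeps the
    denominator positive when s = t = 0.\<close>
  define \<epsilon> where "\<epsilon> = 1 / (4 * (s + t) + 1)"
  have \<epsilon>: "0 < \<epsilon>" using st by (simp add: \<epsilon>_def)
  have \<epsilon>4: "4 * w * (s + t) < 1" if w: "0 \<le> w" "w < \<epsilon>" for w
  proof -
    have "w * (4 * (s + t) + 1) < 1" using w st by (simp add: \<epsilon>_def pos_less_divide_eq)
    then show ?thesis using w by (simp add: algebra_simps)
  qed
  have sets: "sets N = sets borel" by (simp add: N)
  have zm: "?z \<in> borel_measurable borel"
    by (intro borel_measurable_continuous_onI continuous_intros)
  have [measurable]: "?z \<in> borel_measurable N"
    using zm measurable_cong_sets[OF sets refl] by blast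
  have zb: "AE z in N. 0 \<le> ?z z \<and> ?z z \<le> s + t"
    using N(3)
  proof eventually_elim
    case (elim z)
    then have "s * fst z \<le> s" "t * snd z \<le> t" using st by (auto intro!: mult_left_le)
    then show ?case using elim st by auto
  qed
  have fin: "?I n < \<top>" for n
  proof -
    have "?I n \<le> (\<integral>\<^sup>+z. ennreal ((s + t) ^ n) \<partial>N)"
      by (rule nn_integral_mono_AE, use zb in eventually_elim) (auto intro!: ennreal_leI power_mono)
    also have "\<dots> < \<top>" by (simp add: N.emeasure_space_1)
    finally show ?thesis .
  qed
  define m where "m n = enn2real (?I n)" for n
  have m: "?I n = ennreal (m n)" "0 \<le> m n" for n using fin[of n] by (simp_all add: m_def)
  define f where "f = Abs_fps (\<lambda>n. ?B n * m n)"
  have S_pos: "0 < ?S w" if w: "0 \<le> w" "w < \<epsilon>" for w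
  proof -
    have "0 \<le> p * sqrt (1 - 4 * w * (s + t))" "0 \<le> (1 - p) * sqrt (1 - 4 * w * s)" "0 \<le> (1 - p) * sqrt (1 - 4 * w * t)"
      using p \<epsilon>4[OF w] small_products[OF st w(1) \<epsilon>4[OF w]] by (auto intro!: mult_nonneg_nonneg)
    then show ?thesis using p by linarith
  qed
  have f: "(\<lambda>n. fps_nth f n * w ^ n) sums (2 / ?S w)" if w: "0 \<le> w" "w < \<epsilon>" for w
  proof -
    note w4 = \<epsilon>4[OF w]
    have "(\<Sum>n. ennreal (fps_nth f n * w ^ n)) = (\<Sum>n. ennreal (?B n * w ^ n) * ?I n)"
    proof (rule suminf_cong)
      fix n
      have "fps_nth f n * w ^ n = ?B n * w ^ n * m n" by (simp add: f_def)
      moreover have "0 \<le> ?B n * w ^ n" using w binomial_series_neg_half_pos[of n] by simp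
      ultimately show "ennreal (fps_nth f n * w ^ n) = ennreal (?B n * w ^ n) * ?I n"
        unfolding m(1) by (simp only: ennreal_mult m(2))
    qed
    also have "\<dots> = (\<integral>\<^sup>+z. (\<Sum>n. ennreal (?B n * w ^ n) * ennreal (?z z ^ n)) \<partial>N)"
      by (simp add: nn_integral_suminf nn_integral_cmult)
    \<comment> \<open>Almost everywhere 4 w (s x + t y) <= 4 w (s + t) < 1, so the binomial series
      converges under the integral.\<close>
    also have "\<dots> = (\<integral>\<^sup>+z. ennreal ((1 - (4 * w * s * fst z + 4 * w * t * snd z)) powr (-1/2)) \<partial>N)"
    proof (rule nn_integral_cong_AE, use zb in eventually_elim)
      case (elim z)
      have "4 * (w * ?z z) \<le> 4 * w * (s + t)" using elim w by (simp add: mult_left_mono)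
      then have "\<bar>4 * (w * ?z z)\<bar> < 1" using w4 elim w by simp
      from binomial_series_sums[OF this, of "-1/2"]
      have "(\<lambda>n. ?B n * w ^ n * ?z z ^ n) sums ((1 - 4 * (w * ?z z)) powr (-1/2))"
        by (simp only: power_mult_distrib mult.assoc)
      then have "(\<Sum>n. ennreal (?B n * w ^ n * ?z z ^ n)) = ennreal ((1 - 4 * (w * ?z z)) powr (-1/2))"
        using elim w less_imp_le[OF binomial_series_neg_half_pos]
        by (intro suminf_ennreal_eq) (auto intro!: mult_nonneg_nonneg)
      moreover have "4 * (w * ?z z) = 4 * w * s * fst z + 4 * w * t * snd z" by (simp add: algebra_simps)
      ultimately show ?case using elim by (simp add: ennreal_mult'')
    qed
    also have "\<dots> = (\<integral>\<^sup>+z. sep_density p (fst z) (snd z) *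
        ennreal ((1 - (4 * w * s * fst z + 4 * w * t * snd z)) powr (-1/2)) \<partial>lborel)"
    proof -
      have "(\<lambda>z::real \<times> real. ennreal ((1 - (4 * w * s * fst z + 4 * w * t * snd z)) powr (-1/2))) \<in> borel_measurable (borel \<Otimes>\<^sub>M borel)"
        by measurable
      then have g: "(\<lambda>z::real \<times> real. ennreal ((1 - (4 * w * s * fst z + 4 * w * t * snd z)) powr (-1/2))) \<in> borel_measurable lborel"
        by (simp only: borel_prod measurable_lborel2)
      have "(\<lambda>(x, y). sep_density p x y) \<in> borel_measurable lborel"
        using sep_density_measurable[of p] by (simp only: measurable_lborel2)
      from nn_integral_density[OF this g] show ?thesis
        unfolding N(1) case_prod_beta .
    qed
    \<comment> \<open>The transform is taken at 4 w s and 4 w t in place of s and t.\<close>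
    also have "\<dots> = ennreal (2 / (p + p * sqrt (1 - (4 * w * s + 4 * w * t)) + (1 - p) * sqrt (1 - 4 * w * s) + (1 - p) * sqrt (1 - 4 * w * t)))"
      by (rule nn_integral_sep_density[OF p]) (use w st w4 in \<open>auto simp: algebra_simps\<close>)
    also have "4 * w * s + 4 * w * t = 4 * w * (s + t)" by (simp add: algebra_simps)
    finally have sum: "(\<Sum>n. ennreal (fps_nth f n * w ^ n)) = ennreal (2 / ?S w)" .
    have nonneg: "0 \<le> fps_nth f n * w ^ n" for n
      using w m binomial_series_neg_half_pos[of n] by (simp add: f_def)
    have summ: "summable (\<lambda>n. fps_nth f n * w ^ n)"
      by (rule summable_suminf_not_top[OF nonneg]) (simp add: sum)
    have "ennreal (\<Sum>n. fps_nth f n * w ^ n) = ennreal (2 / ?S w)"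
      unfolding sum[symmetric] by (rule suminf_ennreal2[OF nonneg summ, symmetric])
    then have "(\<Sum>n. fps_nth f n * w ^ n) = 2 / ?S w"
      using ennreal_inj[OF suminf_nonneg[OF summ nonneg], of "2 / ?S w"] S_pos[OF w] by simp
    then show ?thesis using summ by (simp only: sums_iff)
  qed
  have "f * (1 - spine_series p s t) = 1"
  proof (rule fps_mult_eq_1_if_sums[OF \<epsilon> f])
    show "(\<lambda>n. fps_nth (1 - spine_series p s t) n * w ^ n) sums (?S w / 2)" if "0 \<le> w" "w < \<epsilon>" for w
      using spine_series_sums[OF st that(1) \<epsilon>4[OF that]] .
    show "2 / ?S w * (?S w / 2) = 1" if "0 \<le> w" "w < \<epsilon>" for w
      using S_pos[OF that] by simp
  qed
  then have "fps_nth (marked_series p s t) (Suc n) = fps_nth f n"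
    by (rule marked_series_unique)
  then have eq: "fps_nth (marked_series p s t) (Suc n) = ?B n * m n"
    by (simp only: f_def fps_nth_Abs_fps)
  show ?thesis
    unfolding eq m(1) using less_imp_le[OF binomial_series_neg_half_pos] m(2)
    by (rule ennreal_mult[symmetric])
qed

lemma expected_permuton_unit_square:
  assumes "random_permuton M \<mu>"
  shows "prob_space (expected_permuton M \<mu>)" "AE z in expected_permuton M \<mu>. z \<in> {0..1} \<times> {0..1}"
proof -
  interpret M: prob_space M using assms by (simp add: random_permuton_def)
  have sp: "space (expected_permuton M \<mu>) = UNIV"
    using sets_eq_imp_space_eq[OF sets_expected_permuton[of M \<mu>]] by simp
  have perm: "\<And>\<omega>. \<omega> \<in> space M \<Longrightarrow> permuton (\<mu> \<omega>)"
    using assms by (simp add: random_permuton_def)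
  have UNIV_in_borel: "UNIV \<in> sets (borel :: (real \<times> real) measure)" by simp
  have "emeasure (\<mu> \<omega>) UNIV = 1" if "\<omega> \<in> space M" for \<omega>
  proof -
    have "prob_space (\<mu> \<omega>)" "space (\<mu> \<omega>) = UNIV"
      using perm[OF that] sets_eq_imp_space_eq[of "\<mu> \<omega>" borel] by (auto simp: permuton_def)
    then show ?thesis using prob_space.emeasure_space_1 by metis
  qed
  then have "emeasure (expected_permuton M \<mu>) UNIV = (\<integral>\<^sup>+\<omega>. 1 \<partial>M)"
    unfolding emeasure_expected_permuton[OF assms UNIV_in_borel] by (intro nn_integral_cong) auto
  then show prob: "prob_space (expected_permuton M \<mu>)"
    by (intro prob_spaceI) (simp add: sp M.emeasure_space_1)
  interpret E: prob_space "expected_permuton M \<mu>" by (rule prob)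
  have K: "{0..1} \<times> {0..1} \<in> sets (borel :: (real \<times> real) measure)"
    by (intro borel_closed closed_Times) auto
  have "emeasure (expected_permuton M \<mu>) ({0..1} \<times> {0..1}) = (\<integral>\<^sup>+\<omega>. 1 \<partial>M)"
    unfolding emeasure_expected_permuton[OF assms K]
    by (intro nn_integral_cong permuton_unit_square perm)
  then have "E.prob ({0..1} \<times> {0..1}) = 1"
    by (simp add: measure_def M.emeasure_space_1)
  then show "AE z in expected_permuton M \<mu>. z \<in> {0..1} \<times> {0..1}"
    using E.prob_eq_1[of "{0..1} \<times> {0..1}"] K by simp
qed

lemma sep_density_unit_square:
  assumes "0 < p" "p < 1"
  shows "prob_space (density lborel (\<lambda>(x, y). sep_density p x y))"
    "AE z in density lborel (\<lambda>(x, y). sep_density p x y). z \<in> {0..1} \<times> {0..1}"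
proof -
  show "prob_space (density lborel (\<lambda>(x, y). sep_density p x y))"
    using nn_integral_sep_density_1[OF assms] sep_density_measurable[of p]
    by (intro prob_spaceI, subst emeasure_density) (simp_all add: case_prod_beta')
  have "AE z in lborel. 0 < (case z of (x, y) \<Rightarrow> sep_density p x y) \<longrightarrow> z \<in> {0..1} \<times> {0..1}"
  proof (intro AE_I2 impI)
    fix z :: "real \<times> real" assume z: "0 < (case z of (x, y) \<Rightarrow> sep_density p x y)"
    obtain x y where "z = (x, y)" by (cases z)
    then show "z \<in> {0..1} \<times> {0..1}"
      using z sep_density_outside[of x y p] by (metis case_prod_conv less_irrefl)
  qed
  then show "AE z in density lborel (\<lambda>(x, y). sep_density p x y). z \<in> {0..1} \<times> {0..1}"
    using AE_density[of "\<lambda>(x, y). sep_density p x y" lborel] sep_density_measurable[of p] by simp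
qed

theorem theorem1p7:
  fixes p :: real and M :: "'w measure" and \<mu> :: "'w \<Rightarrow> (real \<times> real) measure"
  assumes "0 < p" and "p < 1"
    and "brownian_separable_permuton p M \<mu>"
  shows "expected_permuton M \<mu> =
    density lborel (\<lambda>(x, y). ennreal (separable_density p x y) *
      indicator ({0..1} \<times> {0..1}) (x, y))"
proof -
  have R: "random_permuton M \<mu>" using assms(3) by (simp add: brownian_separable_permuton_def)
  have "expected_permuton M \<mu> = density lborel (\<lambda>(x, y). sep_density p x y)"
  proof (rule measure_eqI_linear_moments)
    fix s t :: real and n assume st: "0 \<le> s" "0 \<le> t"
    note N = sep_density_unit_square[OF assms(1,2)]
    let ?B = "fps_nth (binomial_series (-1/2)) n"
    \<comment> \<open>Both sides are the coefficient of \<open>marked_series p s t\<close> at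
      \<open>Suc n\<close>.\<close>
    have "ennreal ?B * (\<integral>\<^sup>+z. ennreal ((s * fst z + t * snd z) ^ n) \<partial>expected_permuton M \<mu>) =
       ennreal ?B * (\<integral>\<^sup>+z. ennreal ((s * fst z + t * snd z) ^ n) \<partial>density lborel (\<lambda>(x, y). sep_density p x y))"
      using brownian_moments[OF assms st] sep_density_moments[OF assms(1,2) st refl N] by simp
    then show "(\<integral>\<^sup>+z. ennreal ((s * fst z + t * snd z) ^ n) \<partial>expected_permuton M \<mu>) =
       (\<integral>\<^sup>+z. ennreal ((s * fst z + t * snd z) ^ n) \<partial>density lborel (\<lambda>(x, y). sep_density p x y))"
      using binomial_series_neg_half_pos[of n] by (simp add: ennreal_mult_cancel_left)
  qed (use expected_permuton_unit_square[OF R] sep_density_unit_square[OF assms(1,2)] in simp_all)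
  then show ?thesis by (simp only: density_separable_density[OF assms(1,2)])
qed

end
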